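(* Let $(\Lambda,d)$ be a row-finite, source-free $k$-graph and let $(\Lambda_D,d_D)$ be the graph of $\Lambda$ delayed at an edge $f\in\Lambda^1$. Then $C^*(\Lambda_D)$ is Morita equivalent to $C^*(\Lambda)$.
   Context: Fix $k\ge1$; $0\in\mathbb{N}$; $e_1,\dots,e_k$ are the standard basis vectors of $\mathbb{N}^k$, and $\mathbb{N}^k$ is regarded as a category with one object, composition being addition. For $n=\sum n_ie_i$, $|n|=\sum n_i$. A $k$-graph is a countable category $\Lambda$ with a functor $d:\Lambda\to\mathbb{N}^k$ satisfying the factorization rule: for every morphism $\lambda$ and $n,m\in\mathbb{N}^k$ with $d(\lambda)=n+m$ there exist unique $\mu,\nu\in\Lambda$ with $d(\mu)=m$, $d(\nu)=n$, $\lambda=\mu\nu$. $\Lambda^n=d^{-1}(n)$; $\Lambda^0$ is the set of vertices (identified with objects); $\Lambda^1=\{\lambda:|d(\lambda)|=1\}$ is the set of edges. $r(\lambda),s(\lambda)\in\Lambda^0$ are the unique vertices with $r(\lambda)\lambda s(\lambda)=\lambda$. $\Lambda$ is row-finite if $|\{\lambda\in\Lambda^{e_i}:r(\lambda)=v\}|<\infty$ for all $v\in\Lambda^0$, $1\le i\le k$. A vertex $v$ is a source if $r^{-1}(v)\cap\Lambda^{e_i}=\emptyset$ for some $i$; $\Lambda$ is source-free if it has no sources. The 1-skeleton of $\Lambda$ is the directed graph $G=(\Lambda^0,\Lambda^1,r,s)$ with edges colored by $d$. For any $k$-colored directed graph, the path category (denoted by $*$, e.g. $G^*$) consists of all finite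 paths $f_n\cdots f_1$ with $s(f_i)=r(f_{i-1})$, including vertices as paths of length $0$, with range, source and (additively extended) degree. On $G^*$, $\lambda\sim\mu$ means that $\lambda$ and $\mu$ compose to the same morphism of $\Lambda$, and $[\lambda]\in\Lambda$ denotes that morphism; thus $\Lambda=G^*/\sim$. Delay at $f$: after relabelling the basis vectors, assume $d(f)=e_1$. Put $A_1=\{f\}\cup\{g\in\Lambda^{e_1}: ag\sim fb\text{ or }ga\sim bf\text{ for some }a,b\in\Lambda^{e_i},\ 2\le i\le k\}$, and for $m\ge2$ $A_m=\{e\in\Lambda^{e_1}: ag\sim eb\text{ or }ga\sim be\text{ for some }a,b\in\Lambda^{e_i},\ 2\le i\le k,\ g\in A_{m-1}\}$. Let $\mathcal{E}^{e_1}=\bigcup_{j\ge1}A_j$, and for $2\le i\le k$ let $\mathcal{E}^{e_i}=\{[ga]\in\Lambda: g\in\mathcal{E}^{e_1},\ a\in\Lambda^{e_i}\}$ (a set of commuting squares of degree $e_1+e_i$). Introduce new vertices $v_g$ ($g\in\mathcal{E}^{e_1}$) and new edges $\mathcal{E}_D^{e_1}=\{g^1,g^2:g\in\mathcal{E}^{e_1}\}$ of degree $e_1$, and $\mathcal{E}_D^{e_i}=\{e_\alpha:\alpha\in\mathcal{E}^{e_i}\}$ of degree $e_i$ for $2\le i\le k$. Define the $k$-colored graph $G_D=(\Lambda_D^0,\Lambda_D^1,r_D,s_D)$ by $\Lambda_D^0=\Lambda^0\cup\{v_g:g\in\mathcal{E}^{e_1}\}$, $\Lambda_D^{e_1}=(\Lambda^{e_1}\setminus\mathcal{E}^{e_1})\cup\mathcal{E}_D^{e_1}$,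 $\Lambda_D^{e_i}=\Lambda^{e_i}\cup\mathcal{E}_D^{e_i}$ for $i\ge2$; with $s_D(g^1)=s(g)$, $r_D(g^1)=v_g$, $s_D(g^2)=v_g$, $r_D(g^2)=r(g)$; and if $\alpha=[bg]=[ha]\in\mathcal{E}^{e_i}$ with $a,b\in\Lambda^{e_i}$ and $g,h\in\Lambda^{e_1}$, then $s_D(e_\alpha)=v_g$ and $r_D(e_\alpha)=v_h$. All other (old) edges keep their range, source and degree from $\Lambda$. The relation $\sim_D$ on two-colored paths of length 2 in $G_D$ is given as follows. Case 1: two such paths with all edges old (i.e. not in $\bigcup_{i=1}^k\mathcal{E}_D^{e_i}$) are equivalent iff they are equivalent under $\sim$ in $G$. Case 2: for each $2\le i\le k$ and each commuting square $[bg]=[ha]\in\mathcal{E}^{e_i}$ of $\Lambda$, where $g,h\in\mathcal{E}^{e_1}$ and $a,b\in\Lambda^{e_i}$ (so that $bg\sim ha$), $b\,g^2\sim_D h^2e_{[bg]}$ and $e_{[bg]}\,g^1\sim_D h^1a$. Case 3: let $e_\beta e_\alpha$ be a path with $\alpha\in\mathcal{E}^{e_i}$, $\beta\in\mathcal{E}^{e_j}$, $i\neq j$, $i,j\ge2$, so that $\alpha=[ga]=[bh]$ and $\beta=[cg]=[ld]$ with $g,h,l\in\mathcal{E}^{e_1}$, $a,b\in\Lambda^{e_i}$, $c,d\in\Lambda^{e_j}$. The morphism $[cga]$ of degree $e_1+e_i+e_j$ determines a 3-cube of commuting squares in $\Lambda$; let $\delta$ and $\gamma$ be the faces opposite $\beta$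 and $\alpha$ respectively. Explicitly, write $cb\sim b'c'$ with $b'\in\Lambda^{e_i}$, $c'\in\Lambda^{e_j}$, and $c'h\sim l'd'$ with $l'\in\Lambda^{e_1}$, $d'\in\Lambda^{e_j}$; then $\delta=[c'h]\in\mathcal{E}^{e_j}$ and $\gamma=[b'l']\in\mathcal{E}^{e_i}$. Set $e_\beta e_\alpha\sim_D e_\gamma e_\delta$. Extend $\sim_D$ to the smallest equivalence relation on $G_D^*$ that contains these relations and is compatible with concatenation (if $\lambda=\lambda_2\lambda_1$, $p_1\sim_D\lambda_1$ and $p_2\sim_D\lambda_2$, then $p_2p_1\sim_D\lambda$); on single edges it is equality. Define $\Lambda_D=G_D^*/\sim_D$, with composition induced by concatenation and degree map $d_D$ induced by the coloring. This is the graph of $\Lambda$ delayed at $f$ (it is a row-finite source-free $k$-graph). For a row-finite source-free $k$-graph $\Lambda$, a Cuntz–Krieger $\Lambda$-family is a collection of projections $\{P_v:v\in\Lambda^0\}$ and partial isometries $\{T_f:f\in\Lambda^1\}$ such that: (CK1) the $P_v$ are mutually orthogonal; (CK2) if $a,b,f,g\in\Lambda^1$ satisfy $af\sim gb$, then $T_aT_f=T_gT_b$; (CK3) $T_f^*T_f=P_{s(f)}$ for all $f\in\Lambda^1$; (CK4) $P_v=\sum_{f:\,r(f)=v,\ d(f)=e_i}T_fT_f^*$ for all $v\in\Lambda^0$, $1\le i\le k$. $C^*(\Lambda)$ is the universal $C^*$-algebra generated by a Cuntz–Krieger $\Lambda$-family. *)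

theory Defs
  imports "HOL-Analysis.Analysis" "HOL-Algebra.Module"
begin

section \<open>Higher-rank graphs\<close>

text \<open>
  The rank is \<open>k = CARD('k)\<close>; degrees are vectors in \<open>nat ^ 'k\<close> and \<open>axis i 1\<close> is the basis
  vector \<open>e\<^sub>i\<close>. A category is given by its morphisms alone, an object being identified with its
  identity morphism. \<open>cmp \<Lambda> \<mu> \<nu>\<close> is the composite \<open>\<mu>\<nu>\<close> (first \<open>\<nu>\<close>, then \<open>\<mu>\<close>).
\<close>

record ('m, 'k::finite) kgraph =
  Mor :: "'m set"
  rng :: "'m \<Rightarrow> 'm"
  src :: "'m \<Rightarrow> 'm"
  cmp :: "'m \<Rightarrow> 'm \<Rightarrow> 'm"
  deg :: "'m \<Rightarrow> nat ^ 'k"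

definition abs_deg :: "nat ^ 'k::finite \<Rightarrow> nat" where
  "abs_deg n = (\<Sum>i\<in>UNIV. n $ i)"

definition of_degree :: "('m, 'k::finite) kgraph \<Rightarrow> nat ^ 'k \<Rightarrow> 'm set" where
  "of_degree \<Lambda> n = {\<kappa> \<in> Mor \<Lambda>. deg \<Lambda> \<kappa> = n}"

abbreviation kverts :: "('m, 'k::finite) kgraph \<Rightarrow> 'm set" where
  "kverts \<Lambda> \<equiv> of_degree \<Lambda> 0"

definition kedges :: "('m, 'k::finite) kgraph \<Rightarrow> 'm set" where
  "kedges \<Lambda> = {\<kappa> \<in> Mor \<Lambda>. abs_deg (deg \<Lambda> \<kappa>) = 1}"

definition is_category :: "('m, 'k::finite) kgraph \<Rightarrow> bool" where
  "is_category \<Lambda> \<longleftrightarrow>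
     (\<forall>\<kappa>\<in>Mor \<Lambda>. rng \<Lambda> \<kappa> \<in> Mor \<Lambda> \<and> src \<Lambda> \<kappa> \<in> Mor \<Lambda> \<and>
        rng \<Lambda> (rng \<Lambda> \<kappa>) = rng \<Lambda> \<kappa> \<and> src \<Lambda> (rng \<Lambda> \<kappa>) = rng \<Lambda> \<kappa> \<and>
        rng \<Lambda> (src \<Lambda> \<kappa>) = src \<Lambda> \<kappa> \<and> src \<Lambda> (src \<Lambda> \<kappa>) = src \<Lambda> \<kappa> \<and>
        cmp \<Lambda> (rng \<Lambda> \<kappa>) \<kappa> = \<kappa> \<and> cmp \<Lambda> \<kappa> (src \<Lambda> \<kappa>) = \<kappa>) \<and>
     (\<forall>\<mu>\<in>Mor \<Lambda>. \<forall>\<nu>\<in>Mor \<Lambda>. src \<Lambda> \<mu> = rng \<Lambda> \<nu> \<longrightarrow>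
        cmp \<Lambda> \<mu> \<nu> \<in> Mor \<Lambda> \<and> rng \<Lambda> (cmp \<Lambda> \<mu> \<nu>) = rng \<Lambda> \<mu> \<and> src \<Lambda> (cmp \<Lambda> \<mu> \<nu>) = src \<Lambda> \<nu>) \<and>
     (\<forall>\<kappa>\<in>Mor \<Lambda>. \<forall>\<mu>\<in>Mor \<Lambda>. \<forall>\<nu>\<in>Mor \<Lambda>. src \<Lambda> \<kappa> = rng \<Lambda> \<mu> \<and> src \<Lambda> \<mu> = rng \<Lambda> \<nu> \<longrightarrow>
        cmp \<Lambda> (cmp \<Lambda> \<kappa> \<mu>) \<nu> = cmp \<Lambda> \<kappa> (cmp \<Lambda> \<mu> \<nu>))"

definition degree_functor :: "('m, 'k::finite) kgraph \<Rightarrow> bool" where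
  "degree_functor \<Lambda> \<longleftrightarrow>
     (\<forall>\<kappa>\<in>Mor \<Lambda>. deg \<Lambda> (rng \<Lambda> \<kappa>) = 0 \<and> deg \<Lambda> (src \<Lambda> \<kappa>) = 0) \<and>
     (\<forall>\<mu>\<in>Mor \<Lambda>. \<forall>\<nu>\<in>Mor \<Lambda>. src \<Lambda> \<mu> = rng \<Lambda> \<nu> \<longrightarrow>
        deg \<Lambda> (cmp \<Lambda> \<mu> \<nu>) = deg \<Lambda> \<mu> + deg \<Lambda> \<nu>)"

definition factorization_rule :: "('m, 'k::finite) kgraph \<Rightarrow> bool" where
  "factorization_rule \<Lambda> \<longleftrightarrow>
     (\<forall>\<kappa>\<in>Mor \<Lambda>. \<forall>n m. deg \<Lambda> \<kappa> = n + m \<longrightarrow>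
        (\<exists>!(\<mu>, \<nu>). \<mu> \<in> of_degree \<Lambda> m \<and> \<nu> \<in> of_degree \<Lambda> n \<and> src \<Lambda> \<mu> = rng \<Lambda> \<nu> \<and>
           cmp \<Lambda> \<mu> \<nu> = \<kappa>))"

definition k_graph :: "('m, 'k::finite) kgraph \<Rightarrow> bool" where
  "k_graph \<Lambda> \<longleftrightarrow>
     countable (Mor \<Lambda>) \<and> is_category \<Lambda> \<and> degree_functor \<Lambda> \<and> factorization_rule \<Lambda>"

definition row_finite :: "('m, 'k::finite) kgraph \<Rightarrow> bool" where
  "row_finite \<Lambda> \<longleftrightarrow>
     (\<forall>v\<in>kverts \<Lambda>. \<forall>i. finite {\<kappa> \<in> of_degree \<Lambda> (axis i 1). rng \<Lambda> \<kappa> = v})"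

definition is_source :: "('m, 'k::finite) kgraph \<Rightarrow> 'm \<Rightarrow> bool" where
  "is_source \<Lambda> v \<longleftrightarrow> (\<exists>i. {\<kappa> \<in> of_degree \<Lambda> (axis i 1). rng \<Lambda> \<kappa> = v} = {})"

definition source_free :: "('m, 'k::finite) kgraph \<Rightarrow> bool" where
  "source_free \<Lambda> \<longleftrightarrow> (\<forall>v\<in>kverts \<Lambda>. \<not> is_source \<Lambda> v)"

text \<open>
  For edges, \<open>x y \<sim> z w\<close>: both are paths of length two in the 1-skeleton and they compose to the
  same morphism.
\<close>

definition commutes :: "('m, 'k::finite) kgraph \<Rightarrow> 'm \<Rightarrow> 'm \<Rightarrow> 'm \<Rightarrow> 'm \<Rightarrow> bool" where
  "commutes \<Lambda> x y z w \<longleftrightarrow>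
     {x, y, z, w} \<subseteq> kedges \<Lambda> \<and> src \<Lambda> x = rng \<Lambda> y \<and> src \<Lambda> z = rng \<Lambda> w \<and> cmp \<Lambda> x y = cmp \<Lambda> z w"


section \<open>Path categories of colored graphs and their quotients\<close>

text \<open>The color of an edge is recorded as its degree, a basis vector.\<close>

record ('v, 'e, 'k::finite) cgraph =
  gverts :: "'v set"
  gedges :: "'e set"
  grng :: "'e \<Rightarrow> 'v"
  gsrc :: "'e \<Rightarrow> 'v"
  gdeg :: "'e \<Rightarrow> nat ^ 'k"

text \<open>
  The path \<open>f\<^sub>n \<dots> f\<^sub>1\<close> with source \<open>v\<close> is the pair \<open>([f\<^sub>n, \<dots>, f\<^sub>1], v)\<close>; thus the vertex \<open>v\<close>, as a
  path of length \<open>0\<close>, is \<open>([], v)\<close>.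
\<close>

type_synonym ('v, 'e) path = "'e list \<times> 'v"

fun path_rng :: "('v, 'e, 'k::finite) cgraph \<Rightarrow> ('v, 'e) path \<Rightarrow> 'v" where
  "path_rng G ([], v) = v"
| "path_rng G (x # xs, v) = grng G x"

fun path_src :: "('v, 'e) path \<Rightarrow> 'v" where
  "path_src (xs, v) = v"

fun path_deg :: "('v, 'e, 'k::finite) cgraph \<Rightarrow> ('v, 'e) path \<Rightarrow> nat ^ 'k" where
  "path_deg G (xs, v) = (\<Sum>x\<leftarrow>xs. gdeg G x)"

fun path_cat :: "('v, 'e) path \<Rightarrow> ('v, 'e) path \<Rightarrow> ('v, 'e) path" where
  "path_cat (xs, v) (ys, w) = (xs @ ys, w)"

fun is_path :: "('v, 'e, 'k::finite) cgraph \<Rightarrow> ('v, 'e) path \<Rightarrow> bool" where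
  "is_path G ([], v) \<longleftrightarrow> v \<in> gverts G"
| "is_path G (x # xs, v) \<longleftrightarrow>
     x \<in> gedges G \<and> is_path G (xs, v) \<and> gsrc G x = path_rng G (xs, v)"

text \<open>
  The smallest equivalence relation on paths that is compatible with concatenation and contains
  the given relation, \<open>R x y z w\<close> meaning that the paths \<open>x y\<close> and \<open>z w\<close> of length two are to be
  identified.
\<close>

inductive path_equiv ::
  "('v, 'e, 'k::finite) cgraph \<Rightarrow> ('e \<Rightarrow> 'e \<Rightarrow> 'e \<Rightarrow> 'e \<Rightarrow> bool) \<Rightarrow> ('v, 'e) path \<Rightarrow> ('v, 'e) path \<Rightarrow> bool"
  for G R where
  base: "path_equiv G R ([x, y], v) ([z, w], v)"
    if "R x y z w" "is_path G ([x, y], v)" "is_path G ([z, w], v)"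
| refl: "path_equiv G R p p" if "is_path G p"
| sym: "path_equiv G R q p" if "path_equiv G R p q"
| trans: "path_equiv G R p r" if "path_equiv G R p q" "path_equiv G R q r"
| cat: "path_equiv G R (path_cat p2 p1) (path_cat q2 q1)"
    if "path_equiv G R p1 q1" "path_equiv G R p2 q2"
       "path_src p2 = path_rng G p1" "path_src q2 = path_rng G q1"

definition path_class ::
  "('v, 'e, 'k::finite) cgraph \<Rightarrow> ('e \<Rightarrow> 'e \<Rightarrow> 'e \<Rightarrow> 'e \<Rightarrow> bool) \<Rightarrow> ('v, 'e) path \<Rightarrow> ('v, 'e) path set" where
  "path_class G R p = {q. path_equiv G R p q}"

text \<open>
  The category \<open>G\<^sup>*/\<sim>\<close>. The unions are over all representatives of the classes and collapse to a
  single class when the operation is well defined on classes.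
\<close>

definition path_quotient ::
  "('v, 'e, 'k::finite) cgraph \<Rightarrow> ('e \<Rightarrow> 'e \<Rightarrow> 'e \<Rightarrow> 'e \<Rightarrow> bool) \<Rightarrow> (('v, 'e) path set, 'k) kgraph" where
  "path_quotient G R =
     \<lparr>Mor = {p. is_path G p} // {(p, q). path_equiv G R p q},
      rng = (\<lambda>C. \<Union>p\<in>C. path_class G R ([], path_rng G p)),
      src = (\<lambda>C. \<Union>p\<in>C. path_class G R ([], path_src p)),
      cmp = (\<lambda>C D. \<Union>p\<in>C. \<Union>q\<in>D. path_class G R (path_cat p q)),
      deg = (\<lambda>C. the_elem (path_deg G ` C))\<rparr>"


section \<open>Delay at an edge\<close>

text \<open>
  The degree of \<open>f\<close> plays the role of \<open>e\<^sub>1\<close>, so that no relabelling of the basis is needed; the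
  degrees \<open>e\<^sub>2, \<dots>, e\<^sub>k\<close> are the following ones.
\<close>

definition other_deg :: "('m, 'k::finite) kgraph \<Rightarrow> 'm \<Rightarrow> (nat ^ 'k) set" where
  "other_deg \<Lambda> f = {axis i 1 | i. True} - {deg \<Lambda> f}"

text \<open>\<open>a g \<sim> e b\<close> or \<open>g a \<sim> b e\<close> for some \<open>a, b\<close> of a common degree \<open>e\<^sub>i\<close>, \<open>2 \<le> i \<le> k\<close>.\<close>

definition opposite_in_square :: "('m, 'k::finite) kgraph \<Rightarrow> 'm \<Rightarrow> 'm \<Rightarrow> 'm \<Rightarrow> bool" where
  "opposite_in_square \<Lambda> f g e \<longleftrightarrow>
     (\<exists>n\<in>other_deg \<Lambda> f. \<exists>a\<in>of_degree \<Lambda> n. \<exists>b\<in>of_degree \<Lambda> n.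
        commutes \<Lambda> a g e b \<or> commutes \<Lambda> g a b e)"

text \<open>\<open>delay_level \<Lambda> f j\<close> is \<open>A\<^bsub>j+1\<^esub>\<close>.\<close>

primrec delay_level :: "('m, 'k::finite) kgraph \<Rightarrow> 'm \<Rightarrow> nat \<Rightarrow> 'm set" where
  "delay_level \<Lambda> f 0 =
     {f} \<union> {g \<in> of_degree \<Lambda> (deg \<Lambda> f). opposite_in_square \<Lambda> f g f}"
| "delay_level \<Lambda> f (Suc j) =
     {e \<in> of_degree \<Lambda> (deg \<Lambda> f). \<exists>g\<in>delay_level \<Lambda> f j. opposite_in_square \<Lambda> f g e}"

definition delay_edges :: "('m, 'k::finite) kgraph \<Rightarrow> 'm \<Rightarrow> 'm set" where
  "delay_edges \<Lambda> f = (\<Union>j. delay_level \<Lambda> f j)"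

text \<open>\<open>delay_squares \<Lambda> f n\<close> is \<open>\<E>\<^bsup>n\<^esup>\<close> for \<open>n = e\<^sub>i\<close>, \<open>2 \<le> i \<le> k\<close>.\<close>

definition delay_squares :: "('m, 'k::finite) kgraph \<Rightarrow> 'm \<Rightarrow> nat ^ 'k \<Rightarrow> 'm set" where
  "delay_squares \<Lambda> f n =
     {cmp \<Lambda> g a | g a. g \<in> delay_edges \<Lambda> f \<and> a \<in> of_degree \<Lambda> n \<and> src \<Lambda> g = rng \<Lambda> a}"

text \<open>
  \<open>\<alpha> = [b g] = [h a]\<close> with \<open>a, b\<close> of degree \<open>n\<close> and \<open>g, h\<close> of the same degree as \<open>f\<close>.
\<close>

definition square ::
  "('m, 'k::finite) kgraph \<Rightarrow> 'm \<Rightarrow> nat ^ 'k \<Rightarrow> 'm \<Rightarrow> 'm \<Rightarrow> 'm \<Rightarrow> 'm \<Rightarrow> 'm \<Rightarrow> bool" where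
  "square \<Lambda> f n \<alpha> b g h a \<longleftrightarrow>
     a \<in> of_degree \<Lambda> n \<and> b \<in> of_degree \<Lambda> n \<and>
     g \<in> of_degree \<Lambda> (deg \<Lambda> f) \<and> h \<in> of_degree \<Lambda> (deg \<Lambda> f) \<and>
     commutes \<Lambda> b g h a \<and> cmp \<Lambda> b g = \<alpha>"

datatype 'm delay_vert = OldV 'm | NewV 'm

text \<open>\<open>Edge1 g\<close>, \<open>Edge2 g\<close> and \<open>EdgeSq \<alpha>\<close> are \<open>g\<^sup>1\<close>, \<open>g\<^sup>2\<close> and \<open>e\<^sub>\<alpha>\<close>; \<open>NewV g\<close> is \<open>v\<^sub>g\<close>.\<close>

datatype 'm delay_edge = OldE 'm | Edge1 'm | Edge2 'm | EdgeSq 'm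

definition delay_graph ::
  "('m, 'k::finite) kgraph \<Rightarrow> 'm \<Rightarrow> ('m delay_vert, 'm delay_edge, 'k) cgraph" where
  "delay_graph \<Lambda> f =
     \<lparr>gverts = OldV ` kverts \<Lambda> \<union> NewV ` delay_edges \<Lambda> f,
      gedges = OldE ` (kedges \<Lambda> - delay_edges \<Lambda> f)
               \<union> Edge1 ` delay_edges \<Lambda> f \<union> Edge2 ` delay_edges \<Lambda> f
               \<union> (\<Union>n\<in>other_deg \<Lambda> f. EdgeSq ` delay_squares \<Lambda> f n),
      grng = (\<lambda>x. case x of
                OldE e \<Rightarrow> OldV (rng \<Lambda> e)
              | Edge1 g \<Rightarrow> NewV g
              | Edge2 g \<Rightarrow> OldV (rng \<Lambda> g)
              | EdgeSq \<alpha> \<Rightarrow> NewV (THE h. \<exists>n\<in>other_deg \<Lambda> f. \<exists>b g a. square \<Lambda> f n \<alpha> b g h a)),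
      gsrc = (\<lambda>x. case x of
                OldE e \<Rightarrow> OldV (src \<Lambda> e)
              | Edge1 g \<Rightarrow> OldV (src \<Lambda> g)
              | Edge2 g \<Rightarrow> NewV g
              | EdgeSq \<alpha> \<Rightarrow> NewV (THE g. \<exists>n\<in>other_deg \<Lambda> f. \<exists>b h a. square \<Lambda> f n \<alpha> b g h a)),
      gdeg = (\<lambda>x. case x of
                OldE e \<Rightarrow> deg \<Lambda> e
              | Edge1 g \<Rightarrow> deg \<Lambda> f
              | Edge2 g \<Rightarrow> deg \<Lambda> f
              | EdgeSq \<alpha> \<Rightarrow> (THE n. n \<in> other_deg \<Lambda> f \<and> \<alpha> \<in> delay_squares \<Lambda> f n))\<rparr>"

text \<open>The equivalences between paths of length two that generate \<open>\<sim>\<^sub>D\<close>.\<close>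

inductive delay_rel ::
  "('m, 'k::finite) kgraph \<Rightarrow> 'm \<Rightarrow>
     'm delay_edge \<Rightarrow> 'm delay_edge \<Rightarrow> 'm delay_edge \<Rightarrow> 'm delay_edge \<Rightarrow> bool"
  for \<Lambda> f where
  old: "delay_rel \<Lambda> f (OldE x) (OldE y) (OldE z) (OldE w)"
    if "commutes \<Lambda> x y z w" "deg \<Lambda> x \<noteq> deg \<Lambda> y" "deg \<Lambda> z \<noteq> deg \<Lambda> w"
       "{x, y, z, w} \<inter> delay_edges \<Lambda> f = {}"
| square_out: "delay_rel \<Lambda> f (OldE b) (Edge2 g) (Edge2 h) (EdgeSq \<alpha>)"
    if "n \<in> other_deg \<Lambda> f" "\<alpha> \<in> delay_squares \<Lambda> f n" "square \<Lambda> f n \<alpha> b g h a"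
       "g \<in> delay_edges \<Lambda> f" "h \<in> delay_edges \<Lambda> f"
| square_in: "delay_rel \<Lambda> f (EdgeSq \<alpha>) (Edge1 g) (Edge1 h) (OldE a)"
    if "n \<in> other_deg \<Lambda> f" "\<alpha> \<in> delay_squares \<Lambda> f n" "square \<Lambda> f n \<alpha> b g h a"
       "g \<in> delay_edges \<Lambda> f" "h \<in> delay_edges \<Lambda> f"
| cube: "delay_rel \<Lambda> f (EdgeSq \<beta>) (EdgeSq \<alpha>) (EdgeSq (cmp \<Lambda> b' l')) (EdgeSq (cmp \<Lambda> c' h))"
    if "n \<in> other_deg \<Lambda> f" "m \<in> other_deg \<Lambda> f" "n \<noteq> m"
       "\<alpha> \<in> delay_squares \<Lambda> f n" "\<beta> \<in> delay_squares \<Lambda> f m"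
       "square \<Lambda> f n \<alpha> b h g a" "square \<Lambda> f m \<beta> c g l d"
       "{g, h, l} \<subseteq> delay_edges \<Lambda> f"
       "b' \<in> of_degree \<Lambda> n" "c' \<in> of_degree \<Lambda> m" "commutes \<Lambda> c b b' c'"
       "l' \<in> of_degree \<Lambda> (deg \<Lambda> f)" "d' \<in> of_degree \<Lambda> m" "commutes \<Lambda> c' h l' d'"

definition delay ::
  "('m, 'k::finite) kgraph \<Rightarrow> 'm \<Rightarrow> (('m delay_vert, 'm delay_edge) path set, 'k) kgraph" where
  "delay \<Lambda> f = path_quotient (delay_graph \<Lambda> f) (delay_rel \<Lambda> f)"


section \<open>\<open>C\<^sup>*\<close>-algebras\<close>

definition complex_ring :: "complex ring" where
  "complex_ring = \<lparr>carrier = UNIV, mult = (*), one = 1, zero = 0, add = (+)\<rparr>"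

lemma cring_complex_ring: "cring complex_ring"
  by (rule cringI) (auto simp: complex_ring_def algebra_simps intro!: abelian_groupI comm_monoidI
        exI[of _ "- x" for x])

text \<open>
  Algebras need not have a unit: the field \<open>one\<close> inherited from the record of modules is ignored,
  both for algebras and for bimodules (for the latter \<open>mult\<close> is ignored as well).
\<close>

record 'a cstar = "(complex, 'a) module" +
  star :: "'a \<Rightarrow> 'a"
  cnorm :: "'a \<Rightarrow> real"

text \<open>
  The library's notion of metric space wants symmetry and nonnegativity of the distance also
  outside the carrier.
\<close>

definition norm_dist :: "('r, 'a, 'z) module_scheme \<Rightarrow> ('a \<Rightarrow> real) \<Rightarrow> 'a \<Rightarrow> 'a \<Rightarrow> real" where
  "norm_dist V N x y = (if x \<in> carrier V \<and> y \<in> carrier V then N (x \<ominus>\<^bsub>V\<^esub> y) else 0)"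

locale cstar_algebra = Module.module complex_ring A for A :: "'a cstar" (structure) +
  assumes mult_closed: "\<lbrakk>x \<in> carrier A; y \<in> carrier A\<rbrakk> \<Longrightarrow> x \<otimes> y \<in> carrier A"
    and mult_assoc: "\<lbrakk>x \<in> carrier A; y \<in> carrier A; z \<in> carrier A\<rbrakk>
      \<Longrightarrow> (x \<otimes> y) \<otimes> z = x \<otimes> (y \<otimes> z)"
    and mult_l_distr: "\<lbrakk>x \<in> carrier A; y \<in> carrier A; z \<in> carrier A\<rbrakk>
      \<Longrightarrow> (x \<oplus> y) \<otimes> z = x \<otimes> z \<oplus> y \<otimes> z"
    and mult_r_distr: "\<lbrakk>x \<in> carrier A; y \<in> carrier A; z \<in> carrier A\<rbrakk>
      \<Longrightarrow> x \<otimes> (y \<oplus> z) = x \<otimes> y \<oplus> x \<otimes> z"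
    and mult_smult_l: "\<lbrakk>x \<in> carrier A; y \<in> carrier A\<rbrakk> \<Longrightarrow> (t \<odot> x) \<otimes> y = t \<odot> (x \<otimes> y)"
    and mult_smult_r: "\<lbrakk>x \<in> carrier A; y \<in> carrier A\<rbrakk> \<Longrightarrow> x \<otimes> (t \<odot> y) = t \<odot> (x \<otimes> y)"
    and star_closed: "x \<in> carrier A \<Longrightarrow> star A x \<in> carrier A"
    and star_star: "x \<in> carrier A \<Longrightarrow> star A (star A x) = x"
    and star_add: "\<lbrakk>x \<in> carrier A; y \<in> carrier A\<rbrakk> \<Longrightarrow> star A (x \<oplus> y) = star A x \<oplus> star A y"
    and star_smult: "x \<in> carrier A \<Longrightarrow> star A (t \<odot> x) = cnj t \<odot> star A x"
    and star_mult: "\<lbrakk>x \<in> carrier A; y \<in> carrier A\<rbrakk> \<Longrightarrow> star A (x \<otimes> y) = star A y \<otimes> star A x"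
    and norm_nonneg: "x \<in> carrier A \<Longrightarrow> 0 \<le> cnorm A x"
    and norm_eq_zero: "x \<in> carrier A \<Longrightarrow> cnorm A x = 0 \<longleftrightarrow> x = \<zero>"
    and norm_triangle: "\<lbrakk>x \<in> carrier A; y \<in> carrier A\<rbrakk>
      \<Longrightarrow> cnorm A (x \<oplus> y) \<le> cnorm A x + cnorm A y"
    and norm_smult: "x \<in> carrier A \<Longrightarrow> cnorm A (t \<odot> x) = cmod t * cnorm A x"
    and norm_mult: "\<lbrakk>x \<in> carrier A; y \<in> carrier A\<rbrakk> \<Longrightarrow> cnorm A (x \<otimes> y) \<le> cnorm A x * cnorm A y"
    and cstar_identity: "x \<in> carrier A \<Longrightarrow> cnorm A (star A x \<otimes> x) = (cnorm A x)\<^sup>2"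
    and complete: "Metric_space.mcomplete (carrier A) (norm_dist A (cnorm A))"

definition closed_subspace :: "'a cstar \<Rightarrow> 'a set \<Rightarrow> bool" where
  "closed_subspace A S \<longleftrightarrow>
     S \<subseteq> carrier A \<and> \<zero>\<^bsub>A\<^esub> \<in> S \<and>
     (\<forall>x\<in>S. \<forall>y\<in>S. x \<oplus>\<^bsub>A\<^esub> y \<in> S) \<and> (\<forall>t. \<forall>x\<in>S. t \<odot>\<^bsub>A\<^esub> x \<in> S) \<and>
     closedin (Metric_space.mtopology (carrier A) (norm_dist A (cnorm A))) S"

definition cstar_subalgebra :: "'a cstar \<Rightarrow> 'a set \<Rightarrow> bool" where
  "cstar_subalgebra A S \<longleftrightarrow>
     closed_subspace A S \<and> (\<forall>x\<in>S. \<forall>y\<in>S. x \<otimes>\<^bsub>A\<^esub> y \<in> S) \<and> (\<forall>x\<in>S. star A x \<in> S)"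

definition generates :: "'a cstar \<Rightarrow> 'a set \<Rightarrow> bool" where
  "generates A W \<longleftrightarrow> W \<subseteq> carrier A \<and> (\<forall>S. cstar_subalgebra A S \<and> W \<subseteq> S \<longrightarrow> S = carrier A)"

definition star_hom :: "'a cstar \<Rightarrow> 'b cstar \<Rightarrow> ('a \<Rightarrow> 'b) \<Rightarrow> bool" where
  "star_hom A B \<phi> \<longleftrightarrow>
     \<phi> \<in> carrier A \<rightarrow> carrier B \<and>
     (\<forall>x\<in>carrier A. \<forall>y\<in>carrier A.
        \<phi> (x \<oplus>\<^bsub>A\<^esub> y) = \<phi> x \<oplus>\<^bsub>B\<^esub> \<phi> y \<and> \<phi> (x \<otimes>\<^bsub>A\<^esub> y) = \<phi> x \<otimes>\<^bsub>B\<^esub> \<phi> y) \<and>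
     (\<forall>t. \<forall>x\<in>carrier A. \<phi> (t \<odot>\<^bsub>A\<^esub> x) = t \<odot>\<^bsub>B\<^esub> \<phi> x) \<and>
     (\<forall>x\<in>carrier A. \<phi> (star A x) = star B (\<phi> x))"

definition positive :: "'a cstar \<Rightarrow> 'a \<Rightarrow> bool" where
  "positive A x \<longleftrightarrow> (\<exists>y\<in>carrier A. x = star A y \<otimes>\<^bsub>A\<^esub> y)"

definition projection :: "'a cstar \<Rightarrow> 'a \<Rightarrow> bool" where
  "projection A p \<longleftrightarrow> p \<in> carrier A \<and> star A p = p \<and> p \<otimes>\<^bsub>A\<^esub> p = p"

definition partial_isometry :: "'a cstar \<Rightarrow> 'a \<Rightarrow> bool" where
  "partial_isometry A t \<longleftrightarrow> t \<in> carrier A \<and> t \<otimes>\<^bsub>A\<^esub> star A t \<otimes>\<^bsub>A\<^esub> t = t"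


section \<open>Morita equivalence\<close>

text \<open>
  \<open>L a x\<close> and \<open>R x b\<close> are the left and the right action. The left inner product \<open>ip\<close> is linear in
  its first variable, the right one in its second variable. Fullness: the inner products span a
  dense subspace of the algebra.
\<close>

definition full_inner_product :: "'a cstar \<Rightarrow> (complex, 'x) module \<Rightarrow> ('x \<Rightarrow> 'x \<Rightarrow> 'a) \<Rightarrow> bool" where
  "full_inner_product A X ip \<longleftrightarrow>
     (\<forall>S. closed_subspace A S \<and> (\<forall>x\<in>carrier X. \<forall>y\<in>carrier X. ip x y \<in> S) \<longrightarrow> S = carrier A)"

definition left_hilbert_module ::
  "'a cstar \<Rightarrow> (complex, 'x) module \<Rightarrow> ('a \<Rightarrow> 'x \<Rightarrow> 'x) \<Rightarrow> ('x \<Rightarrow> 'x \<Rightarrow> 'a) \<Rightarrow> bool" where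
  "left_hilbert_module A X L ip \<longleftrightarrow>
     Module.module complex_ring X \<and>
     (\<forall>a\<in>carrier A. \<forall>x\<in>carrier X. L a x \<in> carrier X) \<and>
     (\<forall>a\<in>carrier A. \<forall>x\<in>carrier X. \<forall>y\<in>carrier X. L a (x \<oplus>\<^bsub>X\<^esub> y) = L a x \<oplus>\<^bsub>X\<^esub> L a y) \<and>
     (\<forall>a\<in>carrier A. \<forall>b\<in>carrier A. \<forall>x\<in>carrier X.
        L (a \<oplus>\<^bsub>A\<^esub> b) x = L a x \<oplus>\<^bsub>X\<^esub> L b x \<and> L (a \<otimes>\<^bsub>A\<^esub> b) x = L a (L b x)) \<and>
     (\<forall>t. \<forall>a\<in>carrier A. \<forall>x\<in>carrier X.
        L (t \<odot>\<^bsub>A\<^esub> a) x = t \<odot>\<^bsub>X\<^esub> L a x \<and> L a (t \<odot>\<^bsub>X\<^esub> x) = t \<odot>\<^bsub>X\<^esub> L a x) \<and>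
     (\<forall>x\<in>carrier X. \<forall>y\<in>carrier X. ip x y \<in> carrier A \<and> star A (ip x y) = ip y x) \<and>
     (\<forall>x\<in>carrier X. \<forall>y\<in>carrier X. \<forall>z\<in>carrier X. ip (x \<oplus>\<^bsub>X\<^esub> y) z = ip x z \<oplus>\<^bsub>A\<^esub> ip y z) \<and>
     (\<forall>t. \<forall>x\<in>carrier X. \<forall>y\<in>carrier X. ip (t \<odot>\<^bsub>X\<^esub> x) y = t \<odot>\<^bsub>A\<^esub> ip x y) \<and>
     (\<forall>a\<in>carrier A. \<forall>x\<in>carrier X. \<forall>y\<in>carrier X. ip (L a x) y = a \<otimes>\<^bsub>A\<^esub> ip x y) \<and>
     (\<forall>x\<in>carrier X. positive A (ip x x) \<and> (ip x x = \<zero>\<^bsub>A\<^esub> \<longrightarrow> x = \<zero>\<^bsub>X\<^esub>)) \<and>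
     Metric_space.mcomplete (carrier X) (norm_dist X (\<lambda>x. sqrt (cnorm A (ip x x))))"

definition right_hilbert_module ::
  "'b cstar \<Rightarrow> (complex, 'x) module \<Rightarrow> ('x \<Rightarrow> 'b \<Rightarrow> 'x) \<Rightarrow> ('x \<Rightarrow> 'x \<Rightarrow> 'b) \<Rightarrow> bool" where
  "right_hilbert_module B X R ip \<longleftrightarrow>
     Module.module complex_ring X \<and>
     (\<forall>b\<in>carrier B. \<forall>x\<in>carrier X. R x b \<in> carrier X) \<and>
     (\<forall>b\<in>carrier B. \<forall>x\<in>carrier X. \<forall>y\<in>carrier X. R (x \<oplus>\<^bsub>X\<^esub> y) b = R x b \<oplus>\<^bsub>X\<^esub> R y b) \<and>
     (\<forall>a\<in>carrier B. \<forall>b\<in>carrier B. \<forall>x\<in>carrier X.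
        R x (a \<oplus>\<^bsub>B\<^esub> b) = R x a \<oplus>\<^bsub>X\<^esub> R x b \<and> R x (a \<otimes>\<^bsub>B\<^esub> b) = R (R x a) b) \<and>
     (\<forall>t. \<forall>b\<in>carrier B. \<forall>x\<in>carrier X.
        R x (t \<odot>\<^bsub>B\<^esub> b) = t \<odot>\<^bsub>X\<^esub> R x b \<and> R (t \<odot>\<^bsub>X\<^esub> x) b = t \<odot>\<^bsub>X\<^esub> R x b) \<and>
     (\<forall>x\<in>carrier X. \<forall>y\<in>carrier X. ip x y \<in> carrier B \<and> star B (ip x y) = ip y x) \<and>
     (\<forall>x\<in>carrier X. \<forall>y\<in>carrier X. \<forall>z\<in>carrier X. ip x (y \<oplus>\<^bsub>X\<^esub> z) = ip x y \<oplus>\<^bsub>B\<^esub> ip x z) \<and>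
     (\<forall>t. \<forall>x\<in>carrier X. \<forall>y\<in>carrier X. ip x (t \<odot>\<^bsub>X\<^esub> y) = t \<odot>\<^bsub>B\<^esub> ip x y) \<and>
     (\<forall>b\<in>carrier B. \<forall>x\<in>carrier X. \<forall>y\<in>carrier X. ip x (R y b) = ip x y \<otimes>\<^bsub>B\<^esub> b) \<and>
     (\<forall>x\<in>carrier X. positive B (ip x x) \<and> (ip x x = \<zero>\<^bsub>B\<^esub> \<longrightarrow> x = \<zero>\<^bsub>X\<^esub>)) \<and>
     Metric_space.mcomplete (carrier X) (norm_dist X (\<lambda>x. sqrt (cnorm B (ip x x))))"

definition imprimitivity_bimodule ::
  "'a cstar \<Rightarrow> 'b cstar \<Rightarrow> (complex, 'x) module \<Rightarrow> ('a \<Rightarrow> 'x \<Rightarrow> 'x) \<Rightarrow> ('x \<Rightarrow> 'b \<Rightarrow> 'x) \<Rightarrow>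
     ('x \<Rightarrow> 'x \<Rightarrow> 'a) \<Rightarrow> ('x \<Rightarrow> 'x \<Rightarrow> 'b) \<Rightarrow> bool" where
  "imprimitivity_bimodule A B X L R ipA ipB \<longleftrightarrow>
     left_hilbert_module A X L ipA \<and> full_inner_product A X ipA \<and>
     right_hilbert_module B X R ipB \<and> full_inner_product B X ipB \<and>
     (\<forall>a\<in>carrier A. \<forall>x\<in>carrier X. \<forall>b\<in>carrier B. R (L a x) b = L a (R x b)) \<and>
     (\<forall>a\<in>carrier A. \<forall>x\<in>carrier X. \<forall>y\<in>carrier X. ipB (L a x) y = ipB x (L (star A a) y)) \<and>
     (\<forall>b\<in>carrier B. \<forall>x\<in>carrier X. \<forall>y\<in>carrier X. ipA (R x b) y = ipA x (R y (star B b))) \<and>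
     (\<forall>x\<in>carrier X. \<forall>y\<in>carrier X. \<forall>z\<in>carrier X. L (ipA x y) z = R x (ipB y z))"

text \<open>
  Restricting the bimodule to subsets of \<open>'a \<times> 'b\<close> is no loss. If \<open>X\<close> is nonzero, a dense subset of
  \<open>A\<close> and one of \<open>B\<close> yield a dense subset of \<open>X\<close> of no larger cardinality, so \<open>X\<close> has at most as
  many elements as \<open>A \<times> B\<close>.
\<close>

definition morita_equivalent :: "'a cstar \<Rightarrow> 'b cstar \<Rightarrow> bool" where
  "morita_equivalent A B \<longleftrightarrow>
     cstar_algebra A \<and> cstar_algebra B \<and>
     (\<exists>(X :: (complex, 'a \<times> 'b) module) L R ipA ipB. imprimitivity_bimodule A B X L R ipA ipB)"


section \<open>The \<open>C\<^sup>*\<close>-algebra of a higher-rank graph\<close>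

text \<open>
  The index set of the sum is finite if \<open>\<Lambda>\<close> is row-finite. The values of \<open>P\<close> off the vertices and
  of \<open>T\<close> off the edges are irrelevant.
\<close>

definition CK_family ::
  "('m, 'k::finite) kgraph \<Rightarrow> 'a cstar \<Rightarrow> ('m \<Rightarrow> 'a) \<Rightarrow> ('m \<Rightarrow> 'a) \<Rightarrow> bool" where
  "CK_family \<Lambda> A P T \<longleftrightarrow>
     (\<forall>v\<in>kverts \<Lambda>. projection A (P v)) \<and>
     (\<forall>e\<in>kedges \<Lambda>. partial_isometry A (T e)) \<and>
     (\<forall>v\<in>kverts \<Lambda>. \<forall>w\<in>kverts \<Lambda>. v \<noteq> w \<longrightarrow> P v \<otimes>\<^bsub>A\<^esub> P w = \<zero>\<^bsub>A\<^esub>) \<and>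
     (\<forall>a b f g. commutes \<Lambda> a f g b \<longrightarrow> T a \<otimes>\<^bsub>A\<^esub> T f = T g \<otimes>\<^bsub>A\<^esub> T b) \<and>
     (\<forall>e\<in>kedges \<Lambda>. star A (T e) \<otimes>\<^bsub>A\<^esub> T e = P (src \<Lambda> e)) \<and>
     (\<forall>v\<in>kverts \<Lambda>. \<forall>i.
        P v = (\<Oplus>\<^bsub>A\<^esub>e \<in> {e \<in> of_degree \<Lambda> (axis i 1). rng \<Lambda> e = v}. T e \<otimes>\<^bsub>A\<^esub> star A (T e)))"

text \<open>
  The universal property is tested on the \<open>C\<^sup>*\<close>-algebras whose elements form a subset of the
  following type. As a \<open>k\<close>-graph is countable, a Cuntz--Krieger family generates a separable
  \<open>C\<^sup>*\<close>-algebra; it has at most continuum many elements and hence a copy inside this type.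
  So the property below is equivalent to the one for arbitrary \<open>C\<^sup>*\<close>-algebras.
\<close>

type_synonym test_space = "(nat \<Rightarrow> complex) \<Rightarrow> (nat \<Rightarrow> complex)"

text \<open>
  \<open>A\<close>, generated by the family \<open>P, T\<close>, is \<open>C\<^sup>*(\<Lambda>)\<close>. The homomorphism \<open>\<phi>\<close> is unique because \<open>A\<close> is generated by
  the family.
\<close>

definition universal_CK_algebra ::
  "('m, 'k::finite) kgraph \<Rightarrow> 'a cstar \<Rightarrow> ('m \<Rightarrow> 'a) \<Rightarrow> ('m \<Rightarrow> 'a) \<Rightarrow> bool" where
  "universal_CK_algebra \<Lambda> A P T \<longleftrightarrow>
     cstar_algebra A \<and> CK_family \<Lambda> A P T \<and> generates A (P ` kverts \<Lambda> \<union> T ` kedges \<Lambda>) \<and>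
     (\<forall>(B :: test_space cstar) Q S. cstar_algebra B \<and> CK_family \<Lambda> B Q S \<longrightarrow>
        (\<exists>\<phi>. star_hom A B \<phi> \<and>
           (\<forall>v\<in>kverts \<Lambda>. \<phi> (P v) = Q v) \<and> (\<forall>e\<in>kedges \<Lambda>. \<phi> (T e) = S e)))"

end

theory Submission
  imports Defs
begin

text \<open>
  The algebra \<open>B = C\<^sup>*(\<Lambda>\<^sub>D)\<close> contains a full copy \<open>C\<close> of \<open>A = C\<^sup>*(\<Lambda>)\<close>, and the part of \<open>B\<close> on one
  side of \<open>C\<close> is the bimodule.

  Let \<open>Q, S\<close> generate \<open>B\<close>. A delayed edge \<open>g\<close> is traversed in \<open>\<Lambda>\<^sub>D\<close> as \<open>g\<^sup>2 g\<^sup>1\<close>, so the \<open>Q\<^sub>v\<close> for old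
  vertices together with \<open>S\<^bsub>g\<^sup>2\<^esub> S\<^bsub>g\<^sup>1\<^esub>\<close> for delayed and \<open>S\<^sub>e\<close> for other edges form a Cuntz--Krieger
  \<open>\<Lambda>\<close>-family (\<open>inner_family_ck\<close>), and the universal property of \<open>A\<close> yields \<open>\<pi> : A \<rightarrow> B\<close>.

  The map \<open>\<pi>\<close> is isometric because the construction can be reversed inside the \<open>2 \<times> 2\<close> matrices over
  \<open>A\<close>. Distinct edges of the same degree have orthogonal range projections \<open>T\<^sub>g T\<^sub>g\<^sup>*\<close>; moved to the
  lower right entry, these projections represent the new vertices \<open>v\<^sub>g\<close>. With \<open>T\<^sub>g\<close> and \<open>T\<^sub>g T\<^sub>g\<^sup>*\<close> in the
  two off-diagonal entries for \<open>g\<^sup>1\<close> and \<open>g\<^sup>2\<close>, and \<open>T\<^sub>b T\<^sub>g T\<^sub>g\<^sup>*\<close> in the lower right entry for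
  \<open>e\<^bsub>[bg]\<^esub>\<close>, this is a \<open>\<Lambda>\<^sub>D\<close>-family (\<open>matrix_family_ck\<close>). The resulting composite \<open>A \<rightarrow> B \<rightarrow> M\<^sub>2(A)\<close> is
  the inclusion of the upper left entry, hence isometric, and so is \<open>\<pi>\<close> (\<open>isometric_rep\<close>). This takes
  the place of a uniqueness theorem for Cuntz--Krieger algebras.

  Put \<open>C = \<pi>(A)\<close> and \<open>V\<^sub>g = S\<^bsub>g\<^sup>1\<^esub>\<close>. The only edge of the delayed degree that enters \<open>v\<^sub>g\<close> is \<open>g\<^sup>1\<close>, so
  \<open>V\<^sub>g V\<^sub>g\<^sup>* = Q\<^bsub>v\<^sub>g\<^esub>\<close>, and \<open>B\<close> is generated by \<open>C\<close> and the \<open>V\<^sub>g\<close>. Moreover \<open>C V\<^sub>g = 0\<close>, while \<open>V\<^sub>g\<^sup>* V\<^sub>h\<close>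
  vanishes for \<open>g \<noteq> h\<close> and is a projection of \<open>C\<close> for \<open>g = h\<close>. Therefore the closed span \<open>X\<close> of \<open>C\<close>
  and all \<open>V\<^sub>g C\<close> satisfies \<open>B X \<subseteq> X\<close> and \<open>X\<^sup>* X \<subseteq> C\<close>, and with the inner products \<open>x y\<^sup>*\<close> and
  \<open>\<pi>\<^sup>-\<^sup>1(x\<^sup>* y)\<close> it is an imprimitivity bimodule (locale \<open>corner\<close>).

  The analysis behind this is elementary. Positivity of \<open>x\<^sup>* x\<close> and square roots inside a given
  subalgebra make the \<open>A\<close>-valued inner product positive, the Cauchy--Schwarz inequality gives the norm
  on matrices, and representations are contractive. All of it is proved for a type class of unital
  \<open>C\<^sup>*\<close>-algebras without spectra: an element \<open>h = h\<^sup>*\<close> counts as positive if \<open>\<parallel>t - h\<parallel> \<le> t\<close> for some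
  \<open>t \<ge> 0\<close>. A \<open>C\<^sup>*\<close>-algebra on a carrier embeds isometrically into the type of multipliers
  (\<open>faithful_rep_exists\<close>). Conversely, a separable closed subalgebra of a type has a copy in the test
  space of the universal property (\<open>universal_rep\<close>).
\<close>

section \<open>Unital \<open>C\<^sup>*\<close>-algebras as types\<close>

text \<open>
  Complex scalars enter through the central element \<open>imag\<close>, the scalar \<open>\<i>\<close>, so that the real classes
  of the library apply. The unit comes from \<open>monoid_mult\<close>, which admits the zero algebra.
\<close>

class unital_cstar = real_normed_algebra + banach + monoid_mult +
  fixes adj :: "'a \<Rightarrow> 'a" and imag :: 'a
  assumes adj_adj [simp]: "adj (adj x) = x"
    and adj_add [simp]: "adj (x + y) = adj x + adj y"
    and adj_scaleR [simp]: "adj (r *\<^sub>R x) = r *\<^sub>R adj x"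
    and adj_mult [simp]: "adj (x * y) = adj y * adj x"
    and imag_square: "imag * imag = - 1"
    and imag_commute: "imag * x = x * imag"
    and adj_imag [simp]: "adj imag = - imag"
    and norm_adj_mult_self: "norm (adj x * x) = (norm x)\<^sup>2"

lemma adj_0 [simp]: "adj 0 = 0"
  using adj_scaleR[of 0 0] by simp

lemma adj_minus [simp]: "adj (- x) = - adj x"
  using adj_scaleR[of "-1" x] by simp

lemma adj_diff [simp]: "adj (x - y) = adj x - adj y"
  using adj_add[of x "- y"] by simp

lemma adj_1 [simp]: "adj 1 = 1"
  by (metis adj_adj adj_mult mult_1_left mult_1_right)

lemma norm_adj [simp]: "norm (adj x) = norm x"
proof -
  have *: "norm y \<le> norm (adj y)" for y :: 'a
  proof (cases "y = 0")
    case False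
    have "norm y * norm y \<le> norm (adj y) * norm y"
      using norm_adj_mult_self[of y] norm_mult_ineq[of "adj y" y] by (simp add: power2_eq_square)
    then show ?thesis using False by simp
  qed simp
  show ?thesis using *[of x] *[of "adj x"] by simp
qed

lemma norm_mult_adj_self: "norm (x * adj x) = (norm x)\<^sup>2"
  using norm_adj_mult_self[of "adj x"] by simp

lemma norm_one_le: "norm (1 :: 'a::unital_cstar) \<le> 1"
proof (cases "norm (1 :: 'a) = 0")
  case False
  then show ?thesis using norm_adj_mult_self[of "1::'a"] by (simp add: power2_eq_square)
qed simp

lemma norm_square_selfadj: "adj x = x \<Longrightarrow> norm (x * x) = (norm x)\<^sup>2"
  using norm_adj_mult_self[of x] by simp

lemma norm_imag_mult_le: "norm (imag * x) \<le> norm x"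
  for x :: "'a::unital_cstar"
proof -
  have "(norm (imag :: 'a))\<^sup>2 \<le> 1"
    using norm_adj_mult_self[of "imag :: 'a"] norm_one_le[where 'a='a] by (simp add: imag_square)
  then have "norm (imag :: 'a) \<le> 1"
    by (simp add: power2_le_iff_abs_le abs_le_square_iff power_le_one_iff)
  then show ?thesis
    by (metis (full_types) mult_left_le_one_le norm_ge_zero norm_mult_ineq order_trans)
qed

lemma imag_imag_mult [simp]: "imag * (imag * x) = - x"
  by (simp add: imag_square flip: mult.assoc)

lemma mult_imag_left: "x * (imag * y) = imag * (x * y)"
  using imag_commute by (metis mult.assoc)

lemma bounded_linear_adj: "bounded_linear adj"
  by (rule bounded_linear_intro[where K=1]) auto

lemmas continuous_on_adj [continuous_intros] =
  bounded_linear.continuous_on[OF bounded_linear_adj]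
lemmas tendsto_adj [tendsto_intros] = bounded_linear.tendsto[OF bounded_linear_adj]

definition cscale :: "complex \<Rightarrow> 'u::unital_cstar \<Rightarrow> 'u" where
  "cscale t x = Re t *\<^sub>R x + Im t *\<^sub>R (imag * x)"

definition csubspace :: "'u::unital_cstar set \<Rightarrow> bool" where
  "csubspace S \<longleftrightarrow> 0 \<in> S \<and> (\<forall>x\<in>S. \<forall>y\<in>S. x + y \<in> S) \<and> (\<forall>t. \<forall>x\<in>S. cscale t x \<in> S)"

definition closed_star_subalg :: "'u::unital_cstar set \<Rightarrow> bool" where
  "closed_star_subalg S \<longleftrightarrow> closed S \<and> csubspace S \<and>
     (\<forall>x\<in>S. \<forall>y\<in>S. x * y \<in> S) \<and> (\<forall>x\<in>S. adj x \<in> S)"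

lemma cscale_of_real [simp]: "cscale (complex_of_real r) x = r *\<^sub>R x"
  by (simp add: cscale_def)

lemma cscale_imag [simp]: "cscale \<i> x = imag * x"
  by (simp add: cscale_def)

lemma cscale_1 [simp]: "cscale 1 x = x"
  by (simp add: cscale_def)

lemma cscale_add_right: "cscale t (x + y) = cscale t x + cscale t y"
  by (simp add: cscale_def algebra_simps)

lemma cscale_add_left: "cscale (s + t) x = cscale s x + cscale t x"
  by (simp add: cscale_def algebra_simps)

lemma cscale_cscale: "cscale s (cscale t x) = cscale (s * t) x"
  by (simp add: cscale_def algebra_simps)

lemma cscale_mult_left: "cscale t x * y = cscale t (x * y)"
  by (simp add: cscale_def algebra_simps)

lemma cscale_mult_right: "x * cscale t y = cscale t (x * y)"
  by (simp add: cscale_def distrib_left mult_imag_left)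

lemma adj_cscale: "adj (cscale t x) = cscale (cnj t) (adj x)"
proof -
  have "adj x * imag = imag * adj x" using imag_commute[of "adj x"] by simp
  then show ?thesis by (simp add: cscale_def)
qed

lemma cscale_0 [simp]: "cscale t 0 = 0"
  by (simp add: cscale_def)

lemma csubspaceD:
  assumes "csubspace S"
  shows "0 \<in> S" "x \<in> S \<Longrightarrow> y \<in> S \<Longrightarrow> x + y \<in> S" "x \<in> S \<Longrightarrow> cscale t x \<in> S"
    "x \<in> S \<Longrightarrow> r *\<^sub>R x \<in> S" "x \<in> S \<Longrightarrow> imag * x \<in> S" "x \<in> S \<Longrightarrow> - x \<in> S"
    "x \<in> S \<Longrightarrow> y \<in> S \<Longrightarrow> x - y \<in> S"
proof -
  have *: "cscale t x \<in> S" if "x \<in> S" for t x using assms that by (simp add: csubspace_def)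
  show "0 \<in> S" and add: "x \<in> S \<Longrightarrow> y \<in> S \<Longrightarrow> x + y \<in> S" for x y
    using assms by (auto simp: csubspace_def)
  show "x \<in> S \<Longrightarrow> cscale t x \<in> S" by (rule *)
  show "x \<in> S \<Longrightarrow> r *\<^sub>R x \<in> S" using *[of x "complex_of_real r"] by simp
  show "x \<in> S \<Longrightarrow> imag * x \<in> S" using *[of x \<i>] by simp
  show "x \<in> S \<Longrightarrow> - x \<in> S" using *[of x "complex_of_real (-1)"] by (simp only: cscale_of_real) simp
  show "x \<in> S \<Longrightarrow> y \<in> S \<Longrightarrow> x - y \<in> S"
    using add[of x "- y"] *[of y "complex_of_real (-1)"] by (simp only: cscale_of_real) simp
qed

lemma closed_star_subalgD:
  assumes "closed_star_subalg S"
  shows "closed S" "csubspace S" "x \<in> S \<Longrightarrow> y \<in> S \<Longrightarrow> x * y \<in> S" "x \<in> S \<Longrightarrow> adj x \<in> S"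
  using assms by (auto simp: closed_star_subalg_def)

section \<open>Square roots and positivity\<close>

text \<open>
  A fixed point \<open>v\<close> of \<open>v \<mapsto> (c + v\<^sup>2) / 2\<close> satisfies \<open>(1 - v)\<^sup>2 = 1 - c\<close>. The iteration with the number
  \<open>1\<close> in place of \<open>c\<close> is \<open>sqrt_bound\<close>; for \<open>\<parallel>c\<parallel> \<le> 1\<close> it dominates the norms of the iterates and of
  their increments, so that convergence reduces to that of a monotone sequence of numbers.
\<close>

primrec sqrt_iter :: "'u::unital_cstar \<Rightarrow> nat \<Rightarrow> 'u" where
  "sqrt_iter c 0 = 0"
| "sqrt_iter c (Suc n) = (1/2) *\<^sub>R (c + sqrt_iter c n * sqrt_iter c n)"

primrec sqrt_bound :: "nat \<Rightarrow> real" where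
  "sqrt_bound 0 = 0"
| "sqrt_bound (Suc n) = (1 + sqrt_bound n * sqrt_bound n) / 2"

lemma sqrt_bound_range: "0 \<le> sqrt_bound n" "sqrt_bound n \<le> 1"
proof -
  have "0 \<le> sqrt_bound n \<and> sqrt_bound n \<le> 1"
    by (induction n) (auto simp: mult_le_one)
  then show "0 \<le> sqrt_bound n" "sqrt_bound n \<le> 1" by auto
qed

lemma sqrt_bound_step: "sqrt_bound n \<le> sqrt_bound (Suc n)"
proof -
  have "0 \<le> (1 - sqrt_bound n)\<^sup>2" by simp
  then show ?thesis by (simp add: power2_eq_square algebra_simps)
qed

lemma sqrt_bound_mono: "m \<le> n \<Longrightarrow> sqrt_bound m \<le> sqrt_bound n"
  using sqrt_bound_step by (rule lift_Suc_mono_le)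

lemma sqrt_bound_tendsto: "sqrt_bound \<longlonglongrightarrow> 1"
proof -
  have "incseq sqrt_bound" by (auto simp: incseq_def sqrt_bound_mono)
  then obtain L where L: "sqrt_bound \<longlonglongrightarrow> L"
    using incseq_convergent[of sqrt_bound 1] sqrt_bound_range(2) by blast
  have "(\<lambda>n. sqrt_bound (Suc n)) \<longlonglongrightarrow> L" using L by (rule LIMSEQ_Suc)
  moreover have "(\<lambda>n. sqrt_bound (Suc n)) \<longlonglongrightarrow> (1 + L * L) / 2"
    using L by (auto intro!: tendsto_intros)
  ultimately have "L = (1 + L * L) / 2" by (rule LIMSEQ_unique)
  then have "(L - 1)\<^sup>2 = 0" by (simp add: power2_eq_square algebra_simps)
  then show ?thesis using L by simp
qed

lemma sqrt_iter_commute: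
  assumes "w * c = c * w" shows "w * sqrt_iter c n = sqrt_iter c n * w"
proof (induction n)
  case (Suc n)
  have "w * (sqrt_iter c n * sqrt_iter c n) = sqrt_iter c n * sqrt_iter c n * w"
    using Suc by (metis mult.assoc)
  then show ?case using assms by (simp add: algebra_simps)
qed simp

lemma norm_sqrt_iter: 
  assumes "norm c \<le> 1" shows "norm (sqrt_iter c n) \<le> sqrt_bound n"
proof (induction n)
  case (Suc n)
  have "norm (sqrt_iter c n * sqrt_iter c n) \<le> sqrt_bound n * sqrt_bound n"
    using Suc norm_mult_ineq[of "sqrt_iter c n" "sqrt_iter c n"]
    by (meson mult_mono norm_ge_zero order_trans sqrt_bound_range)
  then have "norm (c + sqrt_iter c n * sqrt_iter c n) \<le> 1 + sqrt_bound n * sqrt_bound n"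
    using assms norm_triangle_ineq[of c "sqrt_iter c n * sqrt_iter c n"] by linarith
  then show ?case by simp
qed simp

lemma norm_sqrt_iter_step:
  assumes "norm c \<le> 1"
  shows "norm (sqrt_iter c (Suc n) - sqrt_iter c n) \<le> sqrt_bound (Suc n) - sqrt_bound n"
proof (induction n)
  case (Suc n)
  let ?v = "sqrt_iter c" and ?p = "sqrt_bound"
  have "c * ?v n = ?v n * c" by (rule sqrt_iter_commute) simp
  then have "?v n * c = c * ?v n" by simp
  then have com: "?v n * ?v (Suc n) = ?v (Suc n) * ?v n" by (rule sqrt_iter_commute)
  have "?v (Suc (Suc n)) - ?v (Suc n) = (1/2) *\<^sub>R (?v (Suc n) * ?v (Suc n) - ?v n * ?v n)"
    by (simp only: sqrt_iter.simps) (simp add: algebra_simps)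
  also have "?v (Suc n) * ?v (Suc n) - ?v n * ?v n = (?v (Suc n) + ?v n) * (?v (Suc n) - ?v n)"
    using com by (simp add: algebra_simps del: sqrt_iter.simps)
  finally have eq: "norm (?v (Suc (Suc n)) - ?v (Suc n)) =
      norm ((?v (Suc n) + ?v n) * (?v (Suc n) - ?v n)) / 2" by (simp del: sqrt_iter.simps)
  have "norm (?v (Suc n) + ?v n) \<le> ?p (Suc n) + ?p n"
    using norm_triangle_ineq[of "?v (Suc n)" "?v n"] norm_sqrt_iter[OF assms, of "Suc n"]
      norm_sqrt_iter[OF assms, of n] by linarith
  then have "norm ((?v (Suc n) + ?v n) * (?v (Suc n) - ?v n)) \<le> (?p (Suc n) + ?p n) * (?p (Suc n) - ?p n)"
    using Suc norm_mult_ineq[of "?v (Suc n) + ?v n" "?v (Suc n) - ?v n"]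
    by (meson add_nonneg_nonneg mult_mono norm_ge_zero order_trans sqrt_bound_range)
  moreover have "(?p (Suc n) + ?p n) * (?p (Suc n) - ?p n) / 2 = ?p (Suc (Suc n)) - ?p (Suc n)"
    by (simp only: sqrt_bound.simps) (simp add: algebra_simps field_simps)
  ultimately show ?case using eq by linarith
qed (use assms in simp)

lemma norm_sqrt_iter_diff:
  assumes "norm c \<le> 1" and "m \<le> n"
  shows "norm (sqrt_iter c n - sqrt_iter c m) \<le> sqrt_bound n - sqrt_bound m"
  using assms(2)
proof (induction n rule: dec_induct)
  case (step n)
  then show ?case
    using norm_sqrt_iter_step[OF assms(1), of n]
      norm_triangle_ineq[of "sqrt_iter c (Suc n) - sqrt_iter c n" "sqrt_iter c n - sqrt_iter c m"]
    by (simp del: sqrt_iter.simps sqrt_bound.simps)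
qed simp

text \<open>
  The root stays in every closed subalgebra containing \<open>1 - c\<close>, even one without unit: the elements
  \<open>p\<^sub>n 1 - v\<^sub>n\<close>, with \<open>v\<^sub>n\<close> the iterates and \<open>p\<^sub>n\<close> their numerical bounds, belong to the subalgebra by
  induction, and \<open>p\<^sub>n \<rightarrow> 1\<close>.
\<close>

lemma sqrt_one_minus:
  fixes c :: "'u::unital_cstar"
  assumes "adj c = c" and "norm c \<le> 1"
  obtains v where "adj v = v" "norm v \<le> 1" "(1 - v) * (1 - v) = 1 - c"
    "\<And>w. w * c = c * w \<Longrightarrow> w * v = v * w"
    "\<And>S. closed_star_subalg S \<Longrightarrow> c \<in> S \<Longrightarrow> v \<in> S"
    "\<And>S. closed_star_subalg S \<Longrightarrow> 1 - c \<in> S \<Longrightarrow> 1 - v \<in> S"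
proof -
  let ?v = "sqrt_iter c" and ?p = "sqrt_bound"
  have "Cauchy ?p" using sqrt_bound_tendsto LIMSEQ_imp_Cauchy by blast
  have "Cauchy ?v"
  proof (rule CauchyI')
    fix e :: real assume "0 < e"
    then obtain M where M: "\<And>m n. m \<ge> M \<Longrightarrow> n \<ge> M \<Longrightarrow> norm (?p m - ?p n) < e"
      using CauchyD[OF \<open>Cauchy ?p\<close>] by meson
    show "\<exists>M. \<forall>m\<ge>M. \<forall>n>m. dist (?v m) (?v n) < e"
    proof (intro exI allI impI)
      fix m n assume "M \<le> m" "m < n"
      then show "dist (?v m) (?v n) < e"
        using norm_sqrt_iter_diff[OF assms(2), of m n] M[of n m]
        by (simp add: dist_norm norm_minus_commute)
    qed
  qed
  then obtain v where v: "?v \<longlonglongrightarrow> v" using Cauchy_convergent convergentD by blast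
  have "(\<lambda>n. ?v (Suc n)) \<longlonglongrightarrow> v" using v by (rule LIMSEQ_Suc)
  moreover have "(\<lambda>n. ?v (Suc n)) \<longlonglongrightarrow> (1/2) *\<^sub>R (c + v * v)"
    using v by (auto intro!: tendsto_intros)
  ultimately have fix_eq: "v = (1/2) *\<^sub>R (c + v * v)" by (rule LIMSEQ_unique)
  have "v + v = 2 *\<^sub>R v" by (simp add: scaleR_2)
  also have "\<dots> = c + v * v" using fix_eq by (metis scaleR_half_double scaleR_2 scaleR_right_distrib)
  finally have sq: "(1 - v) * (1 - v) = 1 - c" by (simp add: algebra_simps)
  have "adj (?v n) = ?v n" for n by (induction n) (use assms(1) in auto)
  then have adjv: "adj v = v"
    using tendsto_adj[OF v] v LIMSEQ_unique by fastforce
  have "norm (?v n) \<le> 1" for n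
    using norm_sqrt_iter[OF assms(2), of n] sqrt_bound_range(2)[of n] by linarith
  then have nv: "norm v \<le> 1"
    using tendsto_norm[OF v] by (intro LIMSEQ_le_const2) auto
  have com: "w * v = v * w" if "w * c = c * w" for w
  proof -
    have "(\<lambda>n. w * ?v n) \<longlonglongrightarrow> w * v" by (intro tendsto_intros v)
    moreover have "(\<lambda>n. w * ?v n) \<longlonglongrightarrow> v * w"
      unfolding sqrt_iter_commute[OF that] by (intro tendsto_intros v)
    ultimately show ?thesis by (rule LIMSEQ_unique)
  qed
  have mem: "v \<in> S" if S: "closed_star_subalg S" "c \<in> S" for S
  proof -
    have "?v n \<in> S" for n
      by (induction n) (use closed_star_subalgD[OF S(1)] csubspaceD[of S] S(2) in auto)
    then show ?thesis using v closed_star_subalgD(1)[OF S(1)] closed_sequentially by blast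
  qed
  have mem1: "1 - v \<in> S" if S: "closed_star_subalg S" "1 - c \<in> S" for S
  proof -
    note D = closed_star_subalgD[OF S(1)] csubspaceD[OF closed_star_subalgD(2)[OF S(1)]]
    have "?p n *\<^sub>R 1 - ?v n \<in> S" for n
    proof (induction n)
      case (Suc n)
      define y where "y = ?p n *\<^sub>R 1 - ?v n"
      have vn: "?v n = ?p n *\<^sub>R 1 - y" by (simp add: y_def)
      have half: "(?p n / 2) *\<^sub>R y + (?p n / 2) *\<^sub>R y = ?p n *\<^sub>R y"
        by (simp flip: scaleR_add_left)
      have "?p (Suc n) *\<^sub>R 1 - ?v (Suc n) = (1/2) *\<^sub>R ((1 - c) + (2 * ?p n) *\<^sub>R y - y * y)"
        using half by (simp add: vn algebra_simps add_divide_distrib)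
      moreover have "\<dots> \<in> S"
        using Suc unfolding y_def[symmetric]
        by (blast intro: D(8)[OF D(11)[OF D(6)[OF S(2) D(8)] D(3)]])
      ultimately show ?case by (simp del: sqrt_iter.simps)
    qed (simp add: D)
    moreover have "(\<lambda>n. ?p n *\<^sub>R 1 - ?v n) \<longlonglongrightarrow> 1 *\<^sub>R 1 - v"
      by (intro tendsto_intros v sqrt_bound_tendsto)
    ultimately have "1 *\<^sub>R 1 - v \<in> S" by (rule closed_sequentially[OF D(1)])
    then show ?thesis by simp
  qed
  show thesis by (rule that[of v]) (use adjv nv sq com mem mem1 in auto)
qed

text \<open>
  The norm condition says that the spectrum of \<open>h\<close> lies in \<open>[0, 2t]\<close>. In this form sums of positive
  elements are positive by the triangle inequality.
\<close>

definition pos :: "'u::unital_cstar \<Rightarrow> bool" where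
  "pos h \<longleftrightarrow> adj h = h \<and> (\<exists>t\<ge>0. norm (t *\<^sub>R 1 - h) \<le> t)"

lemma pos_adj: "pos h \<Longrightarrow> adj h = h"
  by (simp add: pos_def)

lemma pos_0 [simp]: "pos 0"
  by (auto simp: pos_def intro!: exI[of _ 0])

lemma pos_add: "pos a \<Longrightarrow> pos b \<Longrightarrow> pos (a + b)"
proof -
  assume "pos a" "pos b"
  then obtain s t where *: "s \<ge> 0" "t \<ge> 0" "norm (s *\<^sub>R 1 - a) \<le> s" "norm (t *\<^sub>R 1 - b) \<le> t"
    and "adj a = a" "adj b = b"
    by (auto simp: pos_def)
  have "(s + t) *\<^sub>R 1 - (a + b) = (s *\<^sub>R 1 - a) + (t *\<^sub>R 1 - b)" by (simp add: algebra_simps)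
  then have "norm ((s + t) *\<^sub>R 1 - (a + b)) \<le> s + t"
    using norm_triangle_ineq[of "s *\<^sub>R 1 - a" "t *\<^sub>R 1 - b"] * unfolding \<open>(s + t) *\<^sub>R 1 - (a + b) = _\<close> by linarith
  then show ?thesis
    using * \<open>adj a = a\<close> \<open>adj b = b\<close> by (auto simp: pos_def intro!: exI[of _ "s + t"])
qed

lemma pos_sum: "(\<And>i. i \<in> I \<Longrightarrow> pos (a i)) \<Longrightarrow> pos (sum a I)"
  by (induction I rule: infinite_finite_induct) (auto intro: pos_add)

lemma pos_scaleR: "pos a \<Longrightarrow> 0 \<le> r \<Longrightarrow> pos (r *\<^sub>R a)"
proof -
  assume "pos a" "0 \<le> r"
  then obtain t where *: "t \<ge> 0" "norm (t *\<^sub>R 1 - a) \<le> t" "adj a = a" by (auto simp: pos_def)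
  have "(r * t) *\<^sub>R 1 - r *\<^sub>R a = r *\<^sub>R (t *\<^sub>R 1 - a)" by (simp add: algebra_simps)
  then have "norm ((r * t) *\<^sub>R 1 - r *\<^sub>R a) \<le> r * t"
    using * \<open>0 \<le> r\<close> by (simp add: mult_left_mono)
  then show ?thesis using * \<open>0 \<le> r\<close> by (auto simp: pos_def intro!: exI[of _ "r * t"])
qed

lemma pos_sqrt:
  assumes "pos h"
  obtains k where "pos k" "k * k = h" "\<And>w. w * h = h * w \<Longrightarrow> w * k = k * w"
    "\<And>S. closed_star_subalg S \<Longrightarrow> h \<in> S \<Longrightarrow> k \<in> S"
proof -
  obtain t where t: "t \<ge> 0" "norm (t *\<^sub>R 1 - h) \<le> t" and h: "adj h = h"
    using assms by (auto simp: pos_def)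
  show thesis
  proof (cases "t = 0")
    case True
    then have "h = 0" using t by simp
    then show thesis using that[of 0] by simp
  next
    case False
    define c where "c = 1 - (1/t) *\<^sub>R h"
    have c: "adj c = c" by (simp add: c_def h)
    have "c = (1/t) *\<^sub>R (t *\<^sub>R 1 - h)" using False by (simp add: c_def algebra_simps)
    then have "norm c = norm (t *\<^sub>R 1 - h) / t" using t(1) by simp
    then have nc: "norm c \<le> 1" using t False by (simp add: divide_le_eq)
    obtain v where v: "adj v = v" "norm v \<le> 1" "(1 - v) * (1 - v) = 1 - c"
      "\<And>w. w * c = c * w \<Longrightarrow> w * v = v * w"
      "\<And>S. closed_star_subalg S \<Longrightarrow> c \<in> S \<Longrightarrow> v \<in> S"
      "\<And>S. closed_star_subalg S \<Longrightarrow> 1 - c \<in> S \<Longrightarrow> 1 - v \<in> S"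
      by (rule sqrt_one_minus[OF c nc]) (rule that)
    define k where "k = sqrt t *\<^sub>R (1 - v)"
    show thesis
    proof (rule that[of k])
      have "pos (1 - v)" using v by (auto simp: pos_def intro!: exI[of _ 1])
      then show "pos k" unfolding k_def using t by (intro pos_scaleR) auto
      show "k * k = h" using t False v(3) by (simp add: k_def c_def)
      show "w * k = k * w" if "w * h = h * w" for w
        using v(4)[of w] that by (simp add: k_def c_def algebra_simps)
      show "k \<in> S" if "closed_star_subalg S" "h \<in> S" for S
      proof -
        note D = csubspaceD[OF closed_star_subalgD(2)[OF that(1)]]
        have "1 - c \<in> S" using that(2) D(4) by (simp add: c_def)
        then show ?thesis using v(6) that(1) D(4) by (simp add: k_def)
      qed
    qed
  qed
qed

text \<open>
  The element \<open>l + \<i> q\<close> is \<open>\<surd>r\<close> times a unitary, and \<open>l\<close> is the mean of it and its adjoint.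
\<close>

lemma norm_le_of_squares_eq:
  assumes "adj l = l" "adj q = q" "l * q = q * l" "l * l + q * q = r *\<^sub>R 1" "0 \<le> r"
  shows "(norm l)\<^sup>2 \<le> r"
proof -
  define U where "U = l + imag * q"
  have aU: "adj U = l - imag * q"
    using imag_commute[of q] by (simp add: U_def assms)
  have "adj U * U = l * l + q * q"
    unfolding aU using imag_commute[of l] mult_imag_left[of q q]
    by (simp add: U_def distrib_left left_diff_distrib mult.assoc assms(3) mult_imag_left[of l])
  then have "(norm U)\<^sup>2 \<le> r"
    using norm_adj_mult_self[of U] assms(4,5) mult_left_le[OF norm_one_le[where 'a='a] assms(5)]
    by simp
  moreover have "2 *\<^sub>R l = U + adj U" unfolding aU by (simp add: U_def scaleR_2)
  then have "2 * norm l \<le> norm U + norm (adj U)"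
    by (metis norm_triangle_ineq norm_scaleR abs_numeral)
  then have "norm l \<le> norm U" by simp
  ultimately show ?thesis by (meson norm_ge_zero order_trans power_mono)
qed

text \<open>
  With \<open>w = \<surd>(1 - k\<^sup>2)\<close> one has \<open>w\<^sup>2 + k\<^sup>2 = 1\<close>, hence \<open>\<parallel>1 - k\<^sup>2\<parallel> = \<parallel>w\<parallel>\<^sup>2 \<le> 1\<close>.
\<close>

lemma pos_square_bound:
  assumes "adj k = k" "(norm k)\<^sup>2 \<le> 1"
  shows "norm (1 - k * k) \<le> 1"
proof -
  have c: "adj (k * k) = k * k" "norm (k * k) \<le> 1"
    using assms norm_square_selfadj[of k] by auto
  obtain v where v: "adj v = v" "(1 - v) * (1 - v) = 1 - k * k"
      "\<And>w. w * (k * k) = k * k * w \<Longrightarrow> w * v = v * w"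
    using sqrt_one_minus[OF c] by metis
  have kv: "k * v = v * k" by (rule v(3)) (simp add: mult.assoc)
  have "(norm (1 - v))\<^sup>2 \<le> 1"
  proof (rule norm_le_of_squares_eq[where q=k])
    show "(1 - v) * (1 - v) + k * k = 1 *\<^sub>R 1" by (simp add: v)
  qed (use v(1) assms kv in \<open>auto simp: algebra_simps\<close>)
  then show ?thesis using norm_square_selfadj[of "1 - v"] v by simp
qed

lemma pos_square: assumes "adj k = k" shows "pos (k * k)"
proof (cases "k = 0")
  case False
  define m where "m = (1 / norm k) *\<^sub>R k"
  have "norm (1 - m * m) \<le> 1"
    by (rule pos_square_bound) (use False assms in \<open>auto simp: m_def\<close>)
  then have "pos (m * m)" using assms by (auto simp: pos_def m_def intro!: exI[of _ 1])
  then have "pos ((norm k * norm k) *\<^sub>R (m * m))" by (rule pos_scaleR) simp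
  then show ?thesis using False by (simp add: m_def)
qed simp

lemma pos_complement: "adj a = a \<Longrightarrow> norm a \<le> r \<Longrightarrow> pos (r *\<^sub>R 1 - a)"
  unfolding pos_def by (auto intro!: exI[of _ r] intro: order_trans[OF norm_ge_zero])

text \<open>
  The square roots of \<open>p\<close> and \<open>r - p\<close> commute and their squares add up to \<open>r\<close>.
\<close>

lemma norm_le_of_pos_complement:
  assumes "pos p" "pos (r *\<^sub>R 1 - p)" "0 \<le> r"
  shows "norm p \<le> r"
proof -
  obtain k where k: "pos k" "k * k = p" using pos_sqrt[OF assms(1)] by metis
  obtain w where w: "pos w" "w * w = r *\<^sub>R 1 - p"
    "\<And>z. z * (r *\<^sub>R 1 - p) = (r *\<^sub>R 1 - p) * z \<Longrightarrow> z * w = w * z"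
    using pos_sqrt[OF assms(2)] by metis
  have "k * p = p * k" by (metis k(2) mult.assoc)
  then have "k * w = w * k"
    by (intro w(3)) (simp add: right_diff_distrib left_diff_distrib)
  then have "(norm k)\<^sup>2 \<le> r"
    using w(2) k assms(3) pos_adj[OF w(1)] pos_adj[OF k(1)]
    by (intro norm_le_of_squares_eq[where q = w]) simp_all
  then show ?thesis using norm_square_selfadj[of k] k pos_adj[of k] by simp
qed

lemma pos_norm_mono:
  assumes "pos a" "pos b" shows "norm a \<le> norm (a + b)"
proof (rule norm_le_of_pos_complement)
  have "pos (norm (a + b) *\<^sub>R 1 - (a + b) + b)"
    using assms by (intro pos_add pos_complement) (simp_all add: pos_adj)
  then show "pos (norm (a + b) *\<^sub>R 1 - a)" by (simp add: algebra_simps)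
qed (use assms in auto)

lemma pos_minus_pos: "pos h \<Longrightarrow> pos (- h) \<Longrightarrow> h = 0"
  by (drule (1) pos_norm_mono) simp

lemma norm_power_selfadj:
  fixes z :: "'u::unital_cstar"
  assumes "adj z = z" shows "norm (z ^ (2 ^ j)) = norm z ^ (2 ^ j)"
proof (induction j)
  case (Suc j)
  have a: "adj (z ^ n) = z ^ n" for n
    by (induction n) (auto simp: assms power_commutes)
  have "z ^ (2 ^ Suc j) = z ^ (2 ^ j) * z ^ (2 ^ j)"
    by (simp add: mult_2 power_add)
  then show ?case
    using norm_square_selfadj[OF a] Suc by (simp add: mult_2 power_add power2_eq_square)
qed simp

text \<open>
  Along the exponents \<open>2\<^sup>j\<close> the powers of a selfadjoint element have norm \<open>\<parallel>z\<parallel>\<close> to the same exponent,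
  which outgrows every linear bound if \<open>\<parallel>z\<parallel> > 1\<close>.
\<close>

lemma norm_le_1_of_power_growth:
  fixes z :: "'u::unital_cstar"
  assumes "adj z = z" and growth: "\<And>n. norm (z ^ n) \<le> 1 + real n * C"
  shows "norm z \<le> 1"
proof (rule ccontr)
  assume "\<not> norm z \<le> 1"
  define x where "x = 1 / norm z"
  have x: "0 < x" "x < 1" using \<open>\<not> norm z \<le> 1\<close> by (auto simp: x_def divide_less_eq)
  have "(\<lambda>n. x ^ n + (real n * x ^ n) * C) \<longlonglongrightarrow> 0 + 0 * C"
    using x by (intro tendsto_intros LIMSEQ_power_zero powser_times_n_limit_0) auto
  then have "\<forall>\<^sub>F n in sequentially. x ^ n + (real n * x ^ n) * C < 1"
    by (rule order_tendstoD) simp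
  then obtain N where N: "\<And>n. n \<ge> N \<Longrightarrow> x ^ n + (real n * x ^ n) * C < 1"
    by (auto simp: eventually_sequentially)
  define n :: nat where "n = 2 ^ N"
  have "N \<le> n" by (simp add: n_def less_imp_le)
  have "1 = x ^ n * norm z ^ n"
    using x by (simp add: x_def power_one_over flip: power_mult_distrib)
  also have "\<dots> \<le> x ^ n * (1 + real n * C)"
    using growth[of n] norm_power_selfadj[OF assms(1), of N] x by (simp add: n_def mult_left_mono)
  also have "\<dots> < 1" using N[OF \<open>N \<le> n\<close>] by (simp add: algebra_simps)
  finally show False by simp
qed

text \<open>
  Put \<open>s = - y\<^sup>* y\<close>. The identity \<open>y (1 + s)\<^sup>n = (1 - y y\<^sup>*)\<^sup>n y\<close> bounds \<open>s (1 + s)\<^sup>n\<close>, so the powers of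
  \<open>1 + s\<close> grow at most linearly. Hence \<open>\<parallel>1 + s\<parallel> \<le> 1\<close>, which makes \<open>- s\<close> positive as well as \<open>s\<close>.
\<close>

lemma eq_0_of_opposite_signs_aux:
  fixes y :: "'u::unital_cstar"
  assumes p: "norm (1 - y * adj y) \<le> 1" and s: "pos (- (adj y * y))"
  shows "y = 0"
proof -
  define s where "s = - (adj y * y)"
  define z where "z = 1 + s"
  have yz: "y * z ^ n = (1 - y * adj y) ^ n * y" for n
  proof (induction n)
    case (Suc n)
    have "y * z = (1 - y * adj y) * y" by (simp add: z_def s_def algebra_simps)
    then have "y * z ^ Suc n = (1 - y * adj y) * (y * z ^ n)"
      by (simp flip: mult.assoc)
    then show ?case using Suc by (simp add: mult.assoc)
  qed simp
  have "norm (y * z ^ n) \<le> norm y" for n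
    unfolding yz
  proof (induction n)
    case (Suc n)
    have "norm ((1 - y * adj y) ^ Suc n * y) \<le> norm (1 - y * adj y) * norm ((1 - y * adj y) ^ n * y)"
      using norm_mult_ineq by (simp add: mult.assoc)
    also have "\<dots> \<le> 1 * norm y" using p Suc by (intro mult_mono) auto
    finally show ?case by simp
  qed simp
  then have sz: "norm (s * z ^ n) \<le> (norm y)\<^sup>2" for n
    using norm_mult_ineq[of "adj y" "y * z ^ n"]
    by (simp add: s_def mult.assoc power2_eq_square) (meson mult_left_mono norm_ge_zero order_trans)
  have "norm (z ^ n) \<le> 1 + real n * (norm y)\<^sup>2" for n
  proof (induction n)
    case (Suc n)
    have "z ^ Suc n = z ^ n + s * z ^ n" by (simp add: z_def algebra_simps)
    then show ?case
      using Suc sz[of n] norm_triangle_ineq[of "z ^ n" "s * z ^ n"] by (simp add: algebra_simps)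
  qed (simp add: norm_one_le)
  moreover have "adj z = z" by (simp add: z_def s_def)
  ultimately have "norm z \<le> 1" by (intro norm_le_1_of_power_growth)
  then have "pos (- s)" by (auto simp: pos_def s_def z_def intro!: exI[of _ 1])
  then have "s = 0" using s pos_minus_pos[of s] by (simp add: s_def)
  then show ?thesis using norm_adj_mult_self[of y] by (simp add: s_def)
qed

lemma eq_0_of_opposite_signs:
  fixes y :: "'u::unital_cstar"
  assumes p: "pos (y * adj y)" and s: "pos (- (adj y * y))"
  shows "y = 0"
proof -
  obtain t where t: "t \<ge> 0" "norm (t *\<^sub>R 1 - y * adj y) \<le> t" using p by (auto simp: pos_def)
  show ?thesis
  proof (cases "t = 0")
    case True
    then show ?thesis using t norm_mult_adj_self[of y] by simp
  next
    case False
    define x where "x = (1 / sqrt t) *\<^sub>R y"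
    have xx: "x * adj x = (1/t) *\<^sub>R (y * adj y)" "adj x * x = (1/t) *\<^sub>R (adj y * y)"
      using t(1) by (auto simp: x_def simp flip: real_sqrt_mult)
    have "1 - x * adj x = (1/t) *\<^sub>R (t *\<^sub>R 1 - y * adj y)"
      using False by (simp add: xx algebra_simps)
    then have "norm (1 - x * adj x) \<le> 1"
      using t False by (simp add: divide_le_eq)
    moreover have "pos (- (adj x * x))"
      using pos_scaleR[OF s, of "1/t"] t by (simp add: xx)
    ultimately have "x = 0" by (rule eq_0_of_opposite_signs_aux)
    then show ?thesis using False t by (simp add: x_def)
  qed
qed

lemma selfadj_square_0: "adj m = m \<Longrightarrow> m * m = 0 \<Longrightarrow> m = (0 :: 'u::unital_cstar)"
  using norm_square_selfadj[of m] by simp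

text \<open>
  Let \<open>h = x\<^sup>* x\<close> and \<open>k = |h|\<close>. The difference \<open>d = k - h\<close> is twice the negative part of \<open>h\<close>. For
  \<open>y = x d\<close> the element \<open>- y\<^sup>* y = d k d\<close> is a square, hence positive, and writing \<open>y = a + \<i> b\<close> one finds that
  \<open>y y\<^sup>* = 2 a\<^sup>2 + 2 b\<^sup>2 - y\<^sup>* y\<close> is positive too. These opposite signs force \<open>y = 0\<close>, and from that
  \<open>d = 0\<close> follows.
\<close>

theorem pos_adj_mult_self: "pos (adj x * x)"
  for x :: "'u::unital_cstar"
proof -
  define h where "h = adj x * x"
  have h: "adj h = h" by (simp add: h_def)
  obtain k where k: "pos k" "k * k = h * h" "\<And>w. w * (h * h) = h * h * w \<Longrightarrow> w * k = k * w"
    using pos_sqrt[OF pos_square[OF h]] by metis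
  have hk: "h * k = k * h" by (rule k(3)) (simp add: mult.assoc)
  obtain m where m: "pos m" "m * m = k" "\<And>w. w * k = k * w \<Longrightarrow> w * m = m * w"
    using pos_sqrt[OF k(1)] by metis
  have hm: "h * m = m * h" by (rule m(3)) (rule hk)
  have km: "k * m = m * k" by (rule m(3)) simp
  note sa = h pos_adj[OF k(1)] pos_adj[OF m(1)]
  define d where "d = k - h"
  have dm: "d * m = m * d" by (simp add: d_def algebra_simps hm km)
  have kd: "(k + h) * d = 0" by (simp add: d_def algebra_simps hk k)
  define y where "y = x * d"
  have d: "adj d = d" by (simp add: d_def sa)
  have md: "adj (m * d) = m * d" by (simp add: sa d dm)
  have yy: "adj y * y = d * h * d" by (simp add: y_def d h_def mult.assoc)
  have hd: "h * d = - (k * d)" using kd by (simp add: distrib_right eq_neg_iff_add_eq_0 add.commute)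
  have "m * d * (m * d) = d * k * d" by (metis dm m(2) mult.assoc)
  then have "- (adj y * y) = m * d * (m * d)"
    unfolding yy by (simp add: mult.assoc hd)
  then have n: "pos (- (adj y * y))" using pos_square[OF md] by simp
  define a where "a = (1/2) *\<^sub>R (y + adj y)"
  define b where "b = (1/2) *\<^sub>R (imag * (y - adj y))"
  have sab: "adj a = a" "adj b = b"
    using imag_commute[of "y - adj y"]
    by (simp_all add: a_def b_def add.commute right_diff_distrib left_diff_distrib)
  have "2 *\<^sub>R (a * a) + 2 *\<^sub>R (b * b) = y * adj y + adj y * y"
  proof -
    have aa: "4 *\<^sub>R (a * a) = (y + adj y) * (y + adj y)" by (simp add: a_def)
    have bb: "4 *\<^sub>R (b * b) = - ((y - adj y) * (y - adj y))" by (simp add: b_def mult.assoc mult_imag_left[of "y - adj y"])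
    have "2 *\<^sub>R (2 *\<^sub>R (a * a) + 2 *\<^sub>R (b * b)) = 4 *\<^sub>R (a * a) + 4 *\<^sub>R (b * b)"
      by (simp add: algebra_simps)
    also have "\<dots> = 2 *\<^sub>R (y * adj y + adj y * y)"
      unfolding aa bb by (simp add: algebra_simps scaleR_2)
    finally show ?thesis by simp
  qed
  then have "y * adj y = 2 *\<^sub>R (a * a) + 2 *\<^sub>R (b * b) + - (adj y * y)" by simp
  moreover have "pos (2 *\<^sub>R (a * a) + 2 *\<^sub>R (b * b) + - (adj y * y))"
    using n sab by (intro pos_add pos_scaleR pos_square) auto
  ultimately have "y = 0" using n by (intro eq_0_of_opposite_signs) auto
  then have "m * d * (m * d) = 0"
    using \<open>- (adj y * y) = m * d * (m * d)\<close> by simp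
  then have "m * d = 0" by (rule selfadj_square_0[OF md])
  then have kd0: "k * d = 0" by (metis m(2) mult.assoc mult_zero_right)
  moreover have "h * d = 0" using hd kd0 by simp
  ultimately have "d * d = 0" by (simp add: d_def left_diff_distrib)
  then have "d = 0" by (rule selfadj_square_0[OF d])
  then show ?thesis using k(1) by (simp add: d_def h_def)
qed

lemma pos_conj: assumes "pos p" shows "pos (adj x * p * x)"
proof -
  obtain k where k: "pos k" "k * k = p" using pos_sqrt[OF assms] by metis
  have "adj x * p * x = adj (k * x) * (k * x)"
    using pos_adj[OF k(1)] by (simp add: mult.assoc flip: k(2))
  then show ?thesis using pos_adj_mult_self by metis
qed

lemma norm_le_sum_adj_mult_self:
  fixes x :: "'u::unital_cstar"
  assumes "pos q" shows "(norm x)\<^sup>2 \<le> norm (adj x * x + q)"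
  using pos_norm_mono[OF pos_adj_mult_self[of x] assms] norm_adj_mult_self[of x] by simp

lemma sum_pos_eq_0:
  assumes "finite I" "\<And>i. i \<in> I \<Longrightarrow> pos (a i)" "sum a I = 0" "i \<in> I"
  shows "a i = 0"
proof -
  have "norm (a i) \<le> norm (a i + sum a (I - {i}))"
    using assms by (intro pos_norm_mono pos_sum) auto
  also have "a i + sum a (I - {i}) = 0" using assms by (simp add: sum.remove)
  finally show ?thesis by simp
qed

text \<open>
  With \<open>P\<close> the sum, the elements \<open>(1 - P) p\<^sub>i (1 - P)\<close> are positive and add up to zero, hence vanish;
  so \<open>p\<^sub>i \<le> P\<close>. Then compressing \<open>P\<close> by \<open>p\<^sub>j\<close> leaves a vanishing sum of the positive elements
  \<open>p\<^sub>j p\<^sub>i p\<^sub>j\<close> with \<open>i \<noteq> j\<close>.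
\<close>

lemma orthogonal_of_sum_projection:
  fixes p :: "'i \<Rightarrow> 'u::unital_cstar"
  assumes "finite I" and p: "\<And>i. i \<in> I \<Longrightarrow> adj (p i) = p i \<and> p i * p i = p i"
    and sum: "sum p I * sum p I = sum p I" and "i \<in> I"
  shows "sum p I * p i = p i" and "j \<in> I \<Longrightarrow> i \<noteq> j \<Longrightarrow> p i * p j = 0"
proof -
  define P where "P = sum p I"
  have adj_sum: "adj (sum p J) = sum p J" if "J \<subseteq> I" for J
    using that p by (induction J rule: infinite_finite_induct) auto
  have P: "adj P = P" "P * P = P"
    using sum adj_sum[of I] by (auto simp: P_def)
  have vanish: "p i * (1 - P) = 0" if "i \<in> I" for i
  proof -
    have "adj (p i * (1 - P)) * (p i * (1 - P)) = 0"
    proof (rule sum_pos_eq_0[OF assms(1) _ _ that])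
      have "(\<Sum>i\<in>I. adj (p i * (1 - P)) * (p i * (1 - P))) = (\<Sum>i\<in>I. (1 - P) * p i * (1 - P))"
      proof (rule sum.cong)
        fix i assume "i \<in> I"
        then have "p i * (p i * (1 - P)) = p i * (1 - P)" "adj (p i) = p i"
          using p by (simp_all flip: mult.assoc)
        then show "adj (p i * (1 - P)) * (p i * (1 - P)) = (1 - P) * p i * (1 - P)"
          by (simp add: P mult.assoc)
      qed simp
      also have "\<dots> = (1 - P) * P * (1 - P)"
        by (simp add: P_def sum_distrib_left sum_distrib_right)
      also have "\<dots> = 0" by (simp add: algebra_simps P)
      finally show "(\<Sum>i\<in>I. adj (p i * (1 - P)) * (p i * (1 - P))) = 0" .
    qed (rule pos_adj_mult_self)
    then show ?thesis
      using norm_adj_mult_self[of "p i * (1 - P)"] by simp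
  qed
  then have pP: "p i * P = p i" if "i \<in> I" for i using that by (simp add: right_diff_distrib)
  have "P * p i = p i"
    using arg_cong[OF pP[OF \<open>i \<in> I\<close>], of adj] p[OF \<open>i \<in> I\<close>] by (simp add: P)
  then show "sum p I * p i = p i" by (simp add: P_def)
  assume "j \<in> I" "i \<noteq> j"
  have "adj (p i * p j) * (p i * p j) = 0"
  proof (rule sum_pos_eq_0[where I = "I - {j}" and a = "\<lambda>i. adj (p i * p j) * (p i * p j)"])
    have *: "adj (p i * p j) * (p i * p j) = p j * p i * p j" if "i \<in> I" for i
    proof -
      have "p i * (p i * p j) = p i * p j" using p[OF that] by (simp flip: mult.assoc)
      then show ?thesis using p[OF that] p[OF \<open>j \<in> I\<close>] by (simp add: mult.assoc)
    qed
    have "p j * P * p j = (\<Sum>i\<in>I. p j * p i * p j)"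
      by (simp add: P_def sum_distrib_left sum_distrib_right)
    also have "\<dots> = p j * p j * p j + (\<Sum>i\<in>I - {j}. p j * p i * p j)"
      by (rule sum.remove) (use assms \<open>j \<in> I\<close> in auto)
    finally have "(\<Sum>i\<in>I - {j}. p j * p i * p j) = 0"
      using p[OF \<open>j \<in> I\<close>] pP[OF \<open>j \<in> I\<close>] by simp
    then show "(\<Sum>i\<in>I - {j}. adj (p i * p j) * (p i * p j)) = 0" using * by simp
  qed (use assms \<open>i \<noteq> j\<close> in \<open>auto intro: pos_adj_mult_self simp del: adj_mult\<close>)
  then show "p i * p j = 0" using norm_adj_mult_self[of "p i * p j"] by simp
qed

section \<open>Embedding a \<open>C\<^sup>*\<close>-algebra with a carrier into a type\<close>

lemma complex_ring_simps [simp]: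
  "carrier complex_ring = UNIV" "mult complex_ring s t = s * t" "one complex_ring = 1"
  "zero complex_ring = 0" "add complex_ring s t = s + t"
  by (simp_all add: complex_ring_def)

lemma complex_ring_a_inv [simp]: "a_inv complex_ring t = - t"
proof -
  interpret cring complex_ring by (rule cring_complex_ring)
  show ?thesis by (rule minus_equality) auto
qed

text \<open>
  With the inner product \<open>x\<^sup>* y\<close> the algebra is a Hilbert module over itself, and the pairs below are
  its adjointable operators with their adjoints. Adjointness makes both maps linear.
\<close>

definition mult_pair :: "'a cstar \<Rightarrow> ('a \<Rightarrow> 'a) \<Rightarrow> ('a \<Rightarrow> 'a) \<Rightarrow> bool" where
  "mult_pair A S T \<longleftrightarrow> S \<in> carrier A \<rightarrow> carrier A \<and> T \<in> carrier A \<rightarrow> carrier A \<and>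
     (\<forall>x\<in>carrier A. \<forall>y\<in>carrier A. star A (S x) \<otimes>\<^bsub>A\<^esub> y = star A x \<otimes>\<^bsub>A\<^esub> T y)"

context cstar_algebra
begin

lemmas closed [simp, intro] = mult_closed star_closed

lemma smult_in [simp, intro]: "x \<in> carrier A \<Longrightarrow> t \<odot> x \<in> carrier A"
  using smult_closed by simp

lemma smult_1 [simp]: "x \<in> carrier A \<Longrightarrow> 1 \<odot> x = x"
  using smult_one by simp

lemma smult_0 [simp]: "x \<in> carrier A \<Longrightarrow> 0 \<odot> x = \<zero>"
  using smult_l_null by simp

lemma smult_zero [simp]: "t \<odot> \<zero> = \<zero>"
  using smult_r_null[of t] by simp

lemma smult_add: "x \<in> carrier A \<Longrightarrow> y \<in> carrier A \<Longrightarrow> t \<odot> (x \<oplus> y) = t \<odot> x \<oplus> t \<odot> y"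
  using smult_r_distr by simp

lemma add_smult: "x \<in> carrier A \<Longrightarrow> (s + t) \<odot> x = s \<odot> x \<oplus> t \<odot> x"
  using smult_l_distr[of s t x] by simp

lemma smult_smult: "x \<in> carrier A \<Longrightarrow> s \<odot> (t \<odot> x) = (s * t) \<odot> x"
  using smult_assoc1[of s t x] by simp

lemma minus_eq_smult: "x \<in> carrier A \<Longrightarrow> y \<in> carrier A \<Longrightarrow> x \<ominus> y = x \<oplus> (-1) \<odot> y"
  using smult_l_minus[of 1 y] by (simp add: a_minus_def)

lemma diff_in [simp, intro]: "x \<in> carrier A \<Longrightarrow> y \<in> carrier A \<Longrightarrow> x \<ominus> y \<in> carrier A"
  by simp

lemma norm_zero [simp]: "cnorm A \<zero> = 0"
  using norm_eq_zero by simp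

lemma zero_mult [simp]: "x \<in> carrier A \<Longrightarrow> \<zero> \<otimes> x = \<zero>"
  using mult_smult_l[of \<zero> x 0] by simp

lemma mult_zero [simp]: "x \<in> carrier A \<Longrightarrow> x \<otimes> \<zero> = \<zero>"
  using mult_smult_r[of x \<zero> 0] by simp

lemma star_zero [simp]: "star A \<zero> = \<zero>"
  using star_smult[of \<zero> 0] by simp

lemma diff_add_diff:
  "x \<in> carrier A \<Longrightarrow> y \<in> carrier A \<Longrightarrow> z \<in> carrier A \<Longrightarrow> x \<ominus> z = (x \<ominus> y) \<oplus> (y \<ominus> z)"
  by (simp add: a_minus_def a_assoc r_neg2 l_neg r_neg1)

lemma norm_diff_triangle:
  "x \<in> carrier A \<Longrightarrow> y \<in> carrier A \<Longrightarrow> z \<in> carrier A \<Longrightarrow>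
     cnorm A (x \<ominus> z) \<le> cnorm A (x \<ominus> y) + cnorm A (y \<ominus> z)"
  using norm_triangle[of "x \<ominus> y" "y \<ominus> z"] by (simp add: diff_add_diff[of x y z])

lemma diff_eq_zero: "x \<in> carrier A \<Longrightarrow> y \<in> carrier A \<Longrightarrow> x \<ominus> y = \<zero> \<longleftrightarrow> x = y"
  by (metis a_minus_def add.inv_closed minus_equality minus_minus r_neg)

lemma norm_diff_swap:
  assumes "x \<in> carrier A" "y \<in> carrier A" shows "cnorm A (x \<ominus> y) = cnorm A (y \<ominus> x)"
proof -
  have "x \<ominus> y = (-1) \<odot> (y \<ominus> x)"
    using assms by (simp add: minus_eq_smult smult_add smult_smult a_comm)
  then show ?thesis using norm_smult[of "y \<ominus> x" "-1"] assms by simp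
qed

lemma star_diff: "x \<in> carrier A \<Longrightarrow> y \<in> carrier A \<Longrightarrow> star A (x \<ominus> y) = star A x \<ominus> star A y"
  by (simp add: minus_eq_smult star_add star_smult)

lemma diff_mult: "x \<in> carrier A \<Longrightarrow> y \<in> carrier A \<Longrightarrow> z \<in> carrier A \<Longrightarrow>
    (x \<ominus> y) \<otimes> z = x \<otimes> z \<ominus> y \<otimes> z"
  by (simp add: minus_eq_smult mult_l_distr mult_smult_l)

lemma mult_diff: "x \<in> carrier A \<Longrightarrow> y \<in> carrier A \<Longrightarrow> z \<in> carrier A \<Longrightarrow>
    z \<otimes> (x \<ominus> y) = z \<otimes> x \<ominus> z \<otimes> y"
  by (simp add: minus_eq_smult mult_r_distr mult_smult_r)

lemma norm_star: assumes "x \<in> carrier A" shows "cnorm A (star A x) = cnorm A x"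
proof -
  have *: "cnorm A y \<le> cnorm A (star A y)" if "y \<in> carrier A" for y
  proof (cases "cnorm A y = 0")
    case False
    have "cnorm A y * cnorm A y \<le> cnorm A (star A y) * cnorm A y"
      using cstar_identity[of y] norm_mult[of "star A y" y] that by (simp add: power2_eq_square)
    then show ?thesis using False norm_nonneg[of y] that by simp
  qed (use that norm_nonneg in simp)
  show ?thesis using *[of x] *[of "star A x"] assms by (simp add: star_star)
qed

lemma star_mult_cancel:
  assumes "u \<in> carrier A" "v \<in> carrier A"
    and "\<And>z. z \<in> carrier A \<Longrightarrow> star A u \<otimes> z = star A v \<otimes> z"
  shows "u = v"
proof -
  have "star A (u \<ominus> v) \<otimes> (u \<ominus> v) = \<zero>"
    using assms by (simp add: star_diff diff_mult diff_eq_zero)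
  then have "cnorm A (u \<ominus> v) = 0" using cstar_identity[of "u \<ominus> v"] assms by simp
  then show ?thesis using assms norm_eq_zero diff_eq_zero by auto
qed

lemma complete_sequence:
  fixes s :: "nat \<Rightarrow> 'a"
  assumes s: "\<And>n. s n \<in> carrier A"
    and C: "\<And>e. 0 < e \<Longrightarrow> \<exists>N. \<forall>m\<ge>N. \<forall>n\<ge>N. cnorm A (s m \<ominus> s n) < e"
  shows "\<exists>l\<in>carrier A. \<forall>e>0. \<exists>N. \<forall>n\<ge>N. cnorm A (s n \<ominus> l) < e"
proof -
  interpret M: Metric_space "carrier A" "norm_dist A (cnorm A)"
  proof
    show "0 \<le> norm_dist A (cnorm A) x y" for x y by (simp add: norm_dist_def norm_nonneg)
    show "norm_dist A (cnorm A) x y = norm_dist A (cnorm A) y x" for x y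
      by (simp add: norm_dist_def norm_diff_swap)
    show "norm_dist A (cnorm A) x y = 0 \<longleftrightarrow> x = y" if "x \<in> carrier A" "y \<in> carrier A" for x y
      using that by (simp add: norm_dist_def norm_eq_zero diff_eq_zero)
    show "norm_dist A (cnorm A) x z \<le> norm_dist A (cnorm A) x y + norm_dist A (cnorm A) y z"
      if "x \<in> carrier A" "y \<in> carrier A" "z \<in> carrier A" for x y z
      using that by (simp add: norm_dist_def norm_diff_triangle)
  qed
  have "M.MCauchy s"
    unfolding M.MCauchy_def using s C by (auto simp: norm_dist_def)
  then obtain l where "limitin M.mtopology s l sequentially"
    using complete by (auto simp: M.mcomplete_def)
  then have "l \<in> carrier A" "\<forall>e>0. \<exists>N. \<forall>n\<ge>N. norm_dist A (cnorm A) (s n) l < e"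
    unfolding M.limit_metric_sequentially by blast+
  then show ?thesis using s by (auto simp: norm_dist_def)
qed

lemma mult_pairD:
  assumes "mult_pair A S T" "x \<in> carrier A"
  shows "S x \<in> carrier A" "T x \<in> carrier A"
    "y \<in> carrier A \<Longrightarrow> star A (S x) \<otimes> y = star A x \<otimes> T y"
  using assms by (auto simp: mult_pair_def)

lemma mult_pair_swap: assumes "mult_pair A S T" shows "mult_pair A T S"
proof -
  have "star A (T x) \<otimes> y = star A x \<otimes> S y" if "x \<in> carrier A" "y \<in> carrier A" for x y
  proof -
    have "star A (star A (S y) \<otimes> x) = star A (star A y \<otimes> T x)"
      using mult_pairD(3)[OF assms that(2,1)] by simp
    then show ?thesis
      using that mult_pairD(1,2)[OF assms that(1)] mult_pairD(1,2)[OF assms that(2)]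
      by (simp add: star_mult star_star)
  qed
  then show ?thesis using assms by (auto simp: mult_pair_def)
qed

lemma mult_pair_unique:
  assumes "mult_pair A S T" "mult_pair A S' T'" "\<And>x. x \<in> carrier A \<Longrightarrow> S x = S' x" "y \<in> carrier A"
  shows "T y = T' y"
proof (rule star_mult_cancel)
  note sw = mult_pair_swap[OF assms(1)] mult_pair_swap[OF assms(2)]
  show "star A (T y) \<otimes> z = star A (T' y) \<otimes> z" if "z \<in> carrier A" for z
    using mult_pairD(3)[OF sw(1)] mult_pairD(3)[OF sw(2)] assms(3,4) that by simp
qed (use mult_pairD assms in auto)

lemma mult_pair_add:
  assumes "mult_pair A S T" "x \<in> carrier A" "y \<in> carrier A"
  shows "S (x \<oplus> y) = S x \<oplus> S y"
  by (rule star_mult_cancel)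
    (use assms mult_pairD[OF assms(1)] in \<open>auto simp: star_add mult_l_distr\<close>)

lemma mult_pair_smult:
  assumes "mult_pair A S T" "x \<in> carrier A"
  shows "S (t \<odot> x) = t \<odot> S x"
  by (rule star_mult_cancel)
    (use assms mult_pairD[OF assms(1)] in \<open>auto simp: star_smult mult_smult_l\<close>)

lemma norm_mult_pair:
  assumes "mult_pair A S T" "x \<in> carrier A"
  shows "(cnorm A (S x))\<^sup>2 \<le> cnorm A x * cnorm A (T (S x))"
proof -
  have "(cnorm A (S x))\<^sup>2 = cnorm A (star A x \<otimes> T (S x))"
    using assms mult_pairD[OF assms(1)] cstar_identity[of "S x"] by simp
  also have "\<dots> \<le> cnorm A (star A x) * cnorm A (T (S x))"
    using assms mult_pairD[OF assms(1)] by (intro norm_mult) auto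
  finally show ?thesis using assms by (simp add: norm_star)
qed

end

text \<open>
  A type cannot depend on an algebra, so a multiplier acts on all \<open>C\<^sup>*\<close>-algebras with elements of a given type at
  once: it is a uniformly bounded family of adjointable operators, together with the adjoint family.
  The families are normalized off the carriers to make equality extensional.
\<close>

type_synonym 'a op_family = "'a cstar \<Rightarrow> 'a \<Rightarrow> 'a"

definition multiplier_pair :: "'a op_family \<Rightarrow> 'a op_family \<Rightarrow> bool" where
  "multiplier_pair S T \<longleftrightarrow> (\<forall>A. cstar_algebra A \<longrightarrow> mult_pair A (S A) (T A)) \<and>
     (\<exists>K\<ge>0. \<forall>A. cstar_algebra A \<longrightarrow> (\<forall>x\<in>carrier A. cnorm A (S A x) \<le> K * cnorm A x))"

definition restrict_family :: "'a op_family \<Rightarrow> 'a op_family" where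
  "restrict_family S = (\<lambda>A x. if cstar_algebra A \<and> x \<in> carrier A then S A x else undefined)"

typedef 'a multiplier =
  "{(S :: 'a op_family, T). multiplier_pair S T \<and> restrict_family S = S \<and> restrict_family T = T}"
  by (rule exI[of _ "(restrict_family (\<lambda>A x. x), restrict_family (\<lambda>A x. x))"])
    (auto simp: multiplier_pair_def mult_pair_def restrict_family_def fun_eq_iff intro!: exI[of _ 1])

definition op :: "'a multiplier \<Rightarrow> 'a op_family" where
  "op u = fst (Rep_multiplier u)"

definition op_adj :: "'a multiplier \<Rightarrow> 'a op_family" where
  "op_adj u = snd (Rep_multiplier u)"

definition Mult :: "'a op_family \<Rightarrow> 'a op_family \<Rightarrow> 'a multiplier" where
  "Mult S T = Abs_multiplier (restrict_family S, restrict_family T)"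

lemma multiplier_pair_swap:
  assumes "multiplier_pair S T" shows "multiplier_pair T S"
proof -
  obtain K where K: "K \<ge> 0" "\<And>A x. cstar_algebra A \<Longrightarrow> x \<in> carrier A \<Longrightarrow> cnorm A (S A x) \<le> K * cnorm A x"
    and p: "\<And>A. cstar_algebra A \<Longrightarrow> mult_pair A (S A) (T A)"
    using assms by (auto simp: multiplier_pair_def)
  have "cnorm A (T A x) \<le> K * cnorm A x" if "cstar_algebra A" "x \<in> carrier A" for A x
  proof -
    interpret cstar_algebra A by fact
    have T: "T A x \<in> carrier A" using mult_pairD(2)[OF p] that by blast
    have "(cnorm A (T A x))\<^sup>2 \<le> cnorm A x * cnorm A (S A (T A x))"
      by (rule norm_mult_pair[OF mult_pair_swap[OF p]]) (use that in auto)
    also have "\<dots> \<le> cnorm A x * (K * cnorm A (T A x))"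
      using K(2)[of A "T A x"] that T norm_nonneg by (intro mult_left_mono) auto
    finally have "cnorm A (T A x) * cnorm A (T A x) \<le> (K * cnorm A x) * cnorm A (T A x)"
      by (simp add: power2_eq_square algebra_simps)
    then show ?thesis
      using K(1) norm_nonneg[of x] norm_nonneg[OF T] that
      by (cases "cnorm A (T A x) = 0") auto
  qed
  moreover have "mult_pair A (T A) (S A)" if "cstar_algebra A" for A
    using cstar_algebra.mult_pair_swap[OF that p[OF that]] .
  ultimately show ?thesis using K(1) by (auto simp: multiplier_pair_def)
qed

lemma multiplier_pair_restrict:
  assumes "multiplier_pair S T"
  shows "multiplier_pair (restrict_family S) (restrict_family T)"
proof -
  have *: "mult_pair A (restrict_family S A) (restrict_family T A) = mult_pair A (S A) (T A)"
    if "cstar_algebra A" for A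
    using that by (auto simp: mult_pair_def restrict_family_def Pi_iff)
  have "cnorm A (restrict_family S A x) = cnorm A (S A x)" if "cstar_algebra A" "x \<in> carrier A" for A x
    using that by (simp add: restrict_family_def)
  with * assms show ?thesis by (simp add: multiplier_pair_def)
qed

lemma Rep_Mult:
  assumes "multiplier_pair S T"
  shows "Rep_multiplier (Mult S T) = (restrict_family S, restrict_family T)"
  unfolding Mult_def using multiplier_pair_restrict[OF assms]
  by (intro Abs_multiplier_inverse) (auto simp: restrict_family_def fun_eq_iff)

lemma op_Mult:
  assumes "multiplier_pair S T" "cstar_algebra A" "x \<in> carrier A"
  shows "op (Mult S T) A x = S A x" "op_adj (Mult S T) A x = T A x"
  using assms by (simp_all add: op_def op_adj_def Rep_Mult restrict_family_def)

lemma multiplier_pair_op: "multiplier_pair (op u) (op_adj u)"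
  using Rep_multiplier[of u] by (auto simp: op_def op_adj_def)

lemma mult_pair_op: "cstar_algebra A \<Longrightarrow> mult_pair A (op u A) (op_adj u A)"
  using multiplier_pair_op by (auto simp: multiplier_pair_def)

lemma op_in [simp]:
  "cstar_algebra A \<Longrightarrow> x \<in> carrier A \<Longrightarrow> op u A x \<in> carrier A"
  "cstar_algebra A \<Longrightarrow> x \<in> carrier A \<Longrightarrow> op_adj u A x \<in> carrier A"
  using mult_pair_op[of A u] by (auto simp: mult_pair_def)

lemma multiplier_eqI:
  assumes "\<And>A x. cstar_algebra A \<Longrightarrow> x \<in> carrier A \<Longrightarrow> op u A x = op v A x"
  shows "u = v"
proof -
  have r: "restrict_family (op w) = op w" "restrict_family (op_adj w) = op_adj w" for w :: "'a multiplier"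
    using Rep_multiplier[of w] by (auto simp: op_def op_adj_def)
  have "restrict_family (op u) = restrict_family (op v)"
    using assms by (auto simp: restrict_family_def fun_eq_iff)
  moreover have "op_adj u A x = op_adj v A x" if "cstar_algebra A" "x \<in> carrier A" for A x
    using cstar_algebra.mult_pair_unique[OF that(1) mult_pair_op mult_pair_op] assms that by blast
  then have "restrict_family (op_adj u) = restrict_family (op_adj v)"
    by (auto simp: restrict_family_def fun_eq_iff)
  ultimately have "Rep_multiplier u = Rep_multiplier v"
    by (simp add: r) (simp add: op_def op_adj_def prod_eq_iff)
  then show ?thesis by (simp add: Rep_multiplier_inject)
qed


lemma multiplier_pair_add:
  assumes "multiplier_pair S T" "multiplier_pair S' T'"
  shows "multiplier_pair (\<lambda>A x. S A x \<oplus>\<^bsub>A\<^esub> S' A x) (\<lambda>A x. T A x \<oplus>\<^bsub>A\<^esub> T' A x)"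
proof -
  obtain K where K: "K \<ge> 0" "\<And>A x. cstar_algebra A \<Longrightarrow> x \<in> carrier A \<Longrightarrow> cnorm A (S A x) \<le> K * cnorm A x"
    using assms(1) by (auto simp: multiplier_pair_def)
  obtain L where L: "L \<ge> 0" "\<And>A x. cstar_algebra A \<Longrightarrow> x \<in> carrier A \<Longrightarrow> cnorm A (S' A x) \<le> L * cnorm A x"
    using assms(2) by (auto simp: multiplier_pair_def)
  have p: "mult_pair A (S A) (T A)" "mult_pair A (S' A) (T' A)" if "cstar_algebra A" for A
    using assms that by (auto simp: multiplier_pair_def)
  have "mult_pair A (\<lambda>x. S A x \<oplus>\<^bsub>A\<^esub> S' A x) (\<lambda>x. T A x \<oplus>\<^bsub>A\<^esub> T' A x)" if "cstar_algebra A" for A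
  proof -
    interpret cstar_algebra A by fact
    note D = mult_pairD[OF p(1)[OF that]] mult_pairD[OF p(2)[OF that]]
    show ?thesis unfolding mult_pair_def
      using D by (auto simp: star_add mult_l_distr mult_r_distr)
  qed
  moreover have "cnorm A (S A x \<oplus>\<^bsub>A\<^esub> S' A x) \<le> (K + L) * cnorm A x"
    if "cstar_algebra A" "x \<in> carrier A" for A x
  proof -
    interpret cstar_algebra A by fact
    show ?thesis
      using norm_triangle[of "S A x" "S' A x"] K(2)[OF that] L(2)[OF that]
        mult_pairD[OF p(1)[OF that(1)]] mult_pairD[OF p(2)[OF that(1)]] that
      by (simp add: algebra_simps)
  qed
  ultimately show ?thesis using K(1) L(1) by (auto simp: multiplier_pair_def intro!: exI[of _ "K + L"])
qed

lemma multiplier_pair_smult: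
  assumes "multiplier_pair S T"
  shows "multiplier_pair (\<lambda>A x. t \<odot>\<^bsub>A\<^esub> S A x) (\<lambda>A x. cnj t \<odot>\<^bsub>A\<^esub> T A x)"
proof -
  obtain K where K: "K \<ge> 0" "\<And>A x. cstar_algebra A \<Longrightarrow> x \<in> carrier A \<Longrightarrow> cnorm A (S A x) \<le> K * cnorm A x"
    using assms(1) by (auto simp: multiplier_pair_def)
  have p: "mult_pair A (S A) (T A)" if "cstar_algebra A" for A
    using assms that by (auto simp: multiplier_pair_def)
  have "mult_pair A (\<lambda>x. t \<odot>\<^bsub>A\<^esub> S A x) (\<lambda>x. cnj t \<odot>\<^bsub>A\<^esub> T A x)" if "cstar_algebra A" for A
  proof -
    interpret cstar_algebra A by fact
    note D = mult_pairD[OF p[OF that]]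
    show ?thesis unfolding mult_pair_def
      using D by (auto simp: star_smult mult_smult_l mult_smult_r)
  qed
  moreover have "cnorm A (t \<odot>\<^bsub>A\<^esub> S A x) \<le> (cmod t * K) * cnorm A x"
    if "cstar_algebra A" "x \<in> carrier A" for A x
  proof -
    interpret cstar_algebra A by fact
    show ?thesis
      using K(2)[OF that] mult_pairD[OF p[OF that(1)]] that
      by (simp add: norm_smult mult_left_mono mult.assoc)
  qed
  ultimately show ?thesis
    using K(1) by (auto simp: multiplier_pair_def intro!: exI[of _ "cmod t * K"])
qed

lemma multiplier_pair_comp:
  assumes "multiplier_pair S T" "multiplier_pair S' T'"
  shows "multiplier_pair (\<lambda>A x. S A (S' A x)) (\<lambda>A x. T' A (T A x))"
proof -
  obtain K where K: "K \<ge> 0" "\<And>A x. cstar_algebra A \<Longrightarrow> x \<in> carrier A \<Longrightarrow> cnorm A (S A x) \<le> K * cnorm A x"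
    using assms(1) by (auto simp: multiplier_pair_def)
  obtain L where L: "L \<ge> 0" "\<And>A x. cstar_algebra A \<Longrightarrow> x \<in> carrier A \<Longrightarrow> cnorm A (S' A x) \<le> L * cnorm A x"
    using assms(2) by (auto simp: multiplier_pair_def)
  have p: "mult_pair A (S A) (T A)" "mult_pair A (S' A) (T' A)" if "cstar_algebra A" for A
    using assms that by (auto simp: multiplier_pair_def)
  have "mult_pair A (\<lambda>x. S A (S' A x)) (\<lambda>x. T' A (T A x))" if "cstar_algebra A" for A
  proof -
    interpret cstar_algebra A by fact
    note D = mult_pairD[OF p(1)[OF that]] mult_pairD[OF p(2)[OF that]]
    show ?thesis unfolding mult_pair_def using D by auto
  qed
  moreover have "cnorm A (S A (S' A x)) \<le> (K * L) * cnorm A x"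
    if "cstar_algebra A" "x \<in> carrier A" for A x
  proof -
    have "cnorm A (S A (S' A x)) \<le> K * cnorm A (S' A x)"
      using K(2)[OF that(1)] cstar_algebra.mult_pairD(1)[OF that(1) p(2)] that by blast
    also have "\<dots> \<le> K * (L * cnorm A x)" using L(2)[OF that] K(1) by (rule mult_left_mono)
    finally show ?thesis by (simp add: mult.assoc)
  qed
  ultimately show ?thesis using K(1) L(1) by (auto simp: multiplier_pair_def intro!: exI[of _ "K * L"])
qed

lemma multiplier_pair_id: "multiplier_pair (\<lambda>A x. x) (\<lambda>A x. x)"
  by (auto simp: multiplier_pair_def mult_pair_def intro!: exI[of _ 1])

instantiation multiplier :: (type) "{real_normed_algebra, monoid_mult}"
begin

definition "u + v = Mult (\<lambda>A x. op u A x \<oplus>\<^bsub>A\<^esub> op v A x) (\<lambda>A x. op_adj u A x \<oplus>\<^bsub>A\<^esub> op_adj v A x)"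
  for u v :: "'a multiplier"
definition "u * v = Mult (\<lambda>A x. op u A (op v A x)) (\<lambda>A x. op_adj v A (op_adj u A x))"
definition "1 = Mult (\<lambda>A x. x) (\<lambda>A x. x)"
definition "r *\<^sub>R u =
  Mult (\<lambda>A x. complex_of_real r \<odot>\<^bsub>A\<^esub> op u A x) (\<lambda>A x. cnj (complex_of_real r) \<odot>\<^bsub>A\<^esub> op_adj u A x)"
  for u :: "'a multiplier"
definition "0 = 0 *\<^sub>R (1 :: 'a multiplier)"
definition "- u = (-1) *\<^sub>R u" for u :: "'a multiplier"
definition "u - v = u + (-1) *\<^sub>R v" for u v :: "'a multiplier"
definition "norm u = Inf {K. 0 \<le> K \<and>
    (\<forall>A. cstar_algebra A \<longrightarrow> (\<forall>x\<in>carrier A. cnorm A (op u A x) \<le> K * cnorm A x))}"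
definition "dist u v = norm (u - v)" for u v :: "'a multiplier"
definition "sgn u = inverse (norm u) *\<^sub>R u" for u :: "'a multiplier"
definition "(uniformity :: ('a multiplier \<times> 'a multiplier) filter) =
    (INF e\<in>{0<..}. principal {(x, y). dist x y < e})"
definition "open (U :: 'a multiplier set) \<longleftrightarrow>
    (\<forall>x\<in>U. \<forall>\<^sub>F (x', y) in uniformity. x' = x \<longrightarrow> y \<in> U)"

lemma op_simps:
  assumes "cstar_algebra A" "x \<in> carrier A"
  shows "op (u + v) A x = op u A x \<oplus>\<^bsub>A\<^esub> op v A x"
    "op (u * v) A x = op u A (op v A x)"
    "op 1 A x = x"
    "op (r *\<^sub>R u) A x = complex_of_real r \<odot>\<^bsub>A\<^esub> op u A x"
    "op_adj (u + v) A x = op_adj u A x \<oplus>\<^bsub>A\<^esub> op_adj v A x"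
    "op_adj (u * v) A x = op_adj v A (op_adj u A x)"
    "op_adj (r *\<^sub>R u) A x = complex_of_real r \<odot>\<^bsub>A\<^esub> op_adj u A x"
  using op_Mult[OF multiplier_pair_add[OF multiplier_pair_op multiplier_pair_op] assms, of u v]
    op_Mult[OF multiplier_pair_comp[OF multiplier_pair_op multiplier_pair_op] assms, of u v]
    op_Mult[OF multiplier_pair_id assms]
    op_Mult[OF multiplier_pair_smult[OF multiplier_pair_op] assms, of "complex_of_real r" u]
  by (simp_all add: plus_multiplier_def times_multiplier_def one_multiplier_def
      scaleR_multiplier_def)

lemma op_linear:
  assumes "cstar_algebra A" "x \<in> carrier A" "y \<in> carrier A"
  shows "op u A (x \<oplus>\<^bsub>A\<^esub> y) = op u A x \<oplus>\<^bsub>A\<^esub> op u A y" "op u A (t \<odot>\<^bsub>A\<^esub> x) = t \<odot>\<^bsub>A\<^esub> op u A x"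
  using cstar_algebra.mult_pair_add[OF assms(1) mult_pair_op]
    cstar_algebra.mult_pair_smult[OF assms(1) mult_pair_op] assms by auto

lemma op_zero_diff:
  assumes "cstar_algebra A" "x \<in> carrier A"
  shows "op 0 A x = \<zero>\<^bsub>A\<^esub>" "op (u - v) A x = op u A x \<ominus>\<^bsub>A\<^esub> op v A x"
    "op (- u) A x = (-1) \<odot>\<^bsub>A\<^esub> op u A x"
proof -
  interpret cstar_algebra A by fact
  show "op 0 A x = \<zero>\<^bsub>A\<^esub>" "op (u - v) A x = op u A x \<ominus>\<^bsub>A\<^esub> op v A x"
    "op (- u) A x = (-1) \<odot>\<^bsub>A\<^esub> op u A x"
    using assms by (simp_all add: zero_multiplier_def minus_multiplier_def uminus_multiplier_def
        op_simps minus_eq_smult)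
qed

lemma op_laws:
  fixes a b c :: "'a multiplier"
  assumes "cstar_algebra A" "x \<in> carrier A"
  shows "op (a + b + c) A x = op (a + (b + c)) A x"
    "op (a + b) A x = op (b + a) A x"
    "op (0 + a) A x = op a A x"
    "op (- a + a) A x = op 0 A x"
    "op (a - b) A x = op (a + - b) A x"
    "op (r *\<^sub>R (a + b)) A x = op (r *\<^sub>R a + r *\<^sub>R b) A x"
    "op ((r + s) *\<^sub>R a) A x = op (r *\<^sub>R a + s *\<^sub>R a) A x"
    "op (r *\<^sub>R s *\<^sub>R a) A x = op ((r * s) *\<^sub>R a) A x"
    "op (1 *\<^sub>R a) A x = op a A x"
    "op (a * b * c) A x = op (a * (b * c)) A x"
    "op ((a + b) * c) A x = op (a * c + b * c) A x"
    "op (a * (b + c)) A x = op (a * b + a * c) A x"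
    "op (r *\<^sub>R a * b) A x = op (r *\<^sub>R (a * b)) A x"
    "op (a * r *\<^sub>R b) A x = op (r *\<^sub>R (a * b)) A x"
    "op (1 * a) A x = op a A x"
    "op (a * 1) A x = op a A x"
proof -
  interpret cstar_algebra A by fact
  have *: "(-1) \<odot>\<^bsub>A\<^esub> y \<oplus>\<^bsub>A\<^esub> y = \<zero>\<^bsub>A\<^esub>" if "y \<in> carrier A" for y
    using add_smult[of y "-1" 1] that by simp
  note os = op_simps op_zero_diff op_linear
  show "op (a + b + c) A x = op (a + (b + c)) A x"
    "op (a + b) A x = op (b + a) A x"
    "op (0 + a) A x = op a A x"
    "op (- a + a) A x = op 0 A x"
    "op (a - b) A x = op (a + - b) A x"
    "op (r *\<^sub>R (a + b)) A x = op (r *\<^sub>R a + r *\<^sub>R b) A x"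
    "op ((r + s) *\<^sub>R a) A x = op (r *\<^sub>R a + s *\<^sub>R a) A x"
    "op (r *\<^sub>R s *\<^sub>R a) A x = op ((r * s) *\<^sub>R a) A x"
    "op (1 *\<^sub>R a) A x = op a A x"
    "op (a * b * c) A x = op (a * (b * c)) A x"
    "op ((a + b) * c) A x = op (a * c + b * c) A x"
    "op (a * (b + c)) A x = op (a * b + a * c) A x"
    "op (r *\<^sub>R a * b) A x = op (r *\<^sub>R (a * b)) A x"
    "op (a * r *\<^sub>R b) A x = op (r *\<^sub>R (a * b)) A x"
    "op (1 * a) A x = op a A x"
    "op (a * 1) A x = op a A x"
    using assms by (simp_all add: os * a_assoc minus_eq_smult smult_add add_smult smult_smult)
      (simp_all add: a_comm)
qed

lemma cnorm_op_le:
  assumes "cstar_algebra A" "x \<in> carrier A"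
  shows "cnorm A (op u A x) \<le> norm u * cnorm A x"
proof -
  interpret cstar_algebra A by fact
  let ?S = "{K. 0 \<le> K \<and>
    (\<forall>A. cstar_algebra A \<longrightarrow> (\<forall>x\<in>carrier A. cnorm A (op u A x) \<le> K * cnorm A x))}"
  have ne: "?S \<noteq> {}" using multiplier_pair_op[of u] by (auto simp: multiplier_pair_def)
  show ?thesis
  proof (cases "cnorm A x = 0")
    case True
    obtain K where "K \<in> ?S" using ne by blast
    then show ?thesis using True assms by fastforce
  next
    case False
    then have p: "cnorm A x > 0" using norm_nonneg[OF assms(2)] by simp
    have "cnorm A (op u A x) / cnorm A x \<le> norm u"
      unfolding norm_multiplier_def using ne
    proof (rule cInf_greatest)
      fix K assume "K \<in> ?S"
      then show "cnorm A (op u A x) / cnorm A x \<le> K" using p assms by (auto simp: divide_le_eq)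
    qed
    then show ?thesis using p by (simp add: divide_le_eq)
  qed
qed

lemma norm_multiplier_leI:
  assumes "0 \<le> K" "\<And>A x. cstar_algebra A \<Longrightarrow> x \<in> carrier A \<Longrightarrow> cnorm A (op u A x) \<le> K * cnorm A x"
  shows "norm u \<le> K"
  unfolding norm_multiplier_def using assms by (intro cInf_lower) auto

lemma norm_multiplier_nonneg: "0 \<le> norm (u :: 'a multiplier)"
  unfolding norm_multiplier_def
  using multiplier_pair_op[of u] by (intro cInf_greatest) (auto simp: multiplier_pair_def)

instance
proof
  fix a b c :: "'a multiplier" and r s :: real
  show "a + b + c = a + (b + c)" "a + b = b + a" "0 + a = a" "- a + a = 0" "a - b = a + - b"
    "r *\<^sub>R (a + b) = r *\<^sub>R a + r *\<^sub>R b" "(r + s) *\<^sub>R a = r *\<^sub>R a + s *\<^sub>R a"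
    "r *\<^sub>R s *\<^sub>R a = (r * s) *\<^sub>R a" "1 *\<^sub>R a = a"
    "a * b * c = a * (b * c)" "(a + b) * c = a * c + b * c" "a * (b + c) = a * b + a * c"
    "r *\<^sub>R a * b = r *\<^sub>R (a * b)" "a * r *\<^sub>R b = r *\<^sub>R (a * b)" "1 * a = a" "a * 1 = a"
    by (rule multiplier_eqI, (erule op_laws, assumption))+
  show "dist a b = norm (a - b)" by (rule dist_multiplier_def)
  show "sgn a = inverse (norm a) *\<^sub>R a" by (rule sgn_multiplier_def)
  show "(uniformity :: ('a multiplier \<times> 'a multiplier) filter) =
      (INF e\<in>{0<..}. principal {(x, y). dist x y < e})" by (rule uniformity_multiplier_def)
  show "open U \<longleftrightarrow> (\<forall>x\<in>U. \<forall>\<^sub>F (x', y) in uniformity. x' = x \<longrightarrow> y \<in> U)" for U :: "'a multiplier set"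
    by (rule open_multiplier_def)
  show "norm a = 0 \<longleftrightarrow> a = 0"
  proof
    assume n: "norm a = 0"
    show "a = 0"
    proof (rule multiplier_eqI)
      fix A and x :: 'a assume A: "cstar_algebra A" "x \<in> carrier A"
      interpret cstar_algebra A by fact
      have "cnorm A (op a A x) = 0"
        using cnorm_op_le[OF A, of a] n norm_nonneg[of "op a A x"] A by simp
      then show "op a A x = op 0 A x" using A norm_eq_zero by (simp add: op_zero_diff)
    qed
  next
    assume "a = 0"
    then have "norm a \<le> 0"
      by (intro norm_multiplier_leI)
        (auto simp: op_zero_diff cstar_algebra.norm_zero)
    then show "norm a = 0" using norm_multiplier_nonneg[of a] by simp
  qed
  show "norm (a + b) \<le> norm a + norm b"
  proof (rule norm_multiplier_leI)
    fix A and x :: 'a assume A: "cstar_algebra A" "x \<in> carrier A"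
    interpret cstar_algebra A by fact
    show "cnorm A (op (a + b) A x) \<le> (norm a + norm b) * cnorm A x"
      using norm_triangle[of "op a A x" "op b A x"] cnorm_op_le[OF A, of a] cnorm_op_le[OF A, of b] A
      by (simp add: op_simps algebra_simps)
  qed (simp add: norm_multiplier_nonneg)
  have scale: "norm (r *\<^sub>R a) \<le> \<bar>r\<bar> * norm a" for r and a :: "'a multiplier"
  proof (rule norm_multiplier_leI)
    fix A and x :: 'a assume A: "cstar_algebra A" "x \<in> carrier A"
    interpret cstar_algebra A by fact
    show "cnorm A (op (r *\<^sub>R a) A x) \<le> \<bar>r\<bar> * norm a * cnorm A x"
      using cnorm_op_le[OF A, of a] A
      by (simp add: op_simps norm_smult mult.assoc mult_left_mono)
  qed (simp add: norm_multiplier_nonneg)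
  show "norm (r *\<^sub>R a) = \<bar>r\<bar> * norm a"
  proof (cases "r = 0")
    case True
    then show ?thesis using scale[of r a] norm_multiplier_nonneg[of "r *\<^sub>R a"] by simp
  next
    case False
    have "(1 / r) *\<^sub>R r *\<^sub>R a = a"
      by (rule multiplier_eqI) (use False op_laws(8,9) in \<open>simp\<close>)
    then have "\<bar>r\<bar> * norm a \<le> \<bar>r\<bar> * (\<bar>1 / r\<bar> * norm (r *\<^sub>R a))"
      using scale[of "1 / r" "r *\<^sub>R a"] by (intro mult_left_mono) auto
    also have "\<dots> = norm (r *\<^sub>R a)" using False by (simp add: abs_divide)
    finally show ?thesis using scale[of r a] by simp
  qed
  show "norm (a * b) \<le> norm a * norm b"
  proof (rule norm_multiplier_leI)
    fix A and x :: 'a assume A: "cstar_algebra A" "x \<in> carrier A"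
    have "cnorm A (op a A (op b A x)) \<le> norm a * cnorm A (op b A x)"
      using A by (intro cnorm_op_le) auto
    also have "\<dots> \<le> norm a * (norm b * cnorm A x)"
      using A norm_multiplier_nonneg by (intro mult_left_mono cnorm_op_le) auto
    finally show "cnorm A (op (a * b) A x) \<le> norm a * norm b * cnorm A x"
      using A by (simp add: op_simps mult.assoc)
  qed (simp add: norm_multiplier_nonneg)
qed

end

text \<open>
  The adjoint is needed before the class of unital \<open>C\<^sup>*\<close>-algebras can be instantiated, because
  completeness is proved through it.
\<close>

definition mult_adj :: "'a multiplier \<Rightarrow> 'a multiplier" where
  "mult_adj u = Mult (op_adj u) (op u)"

lemma op_mult_adj:
  assumes "cstar_algebra A" "x \<in> carrier A"
  shows "op (mult_adj u) A x = op_adj u A x" "op_adj (mult_adj u) A x = op u A x"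
  using op_Mult[OF multiplier_pair_swap[OF multiplier_pair_op] assms, of u]
  by (simp_all add: mult_adj_def)

lemma norm_multiplier_adj: "norm (mult_adj u) \<le> norm (u :: 'a multiplier)"
proof (rule norm_multiplier_leI[OF norm_multiplier_nonneg])
  fix A and x :: 'a assume A: "cstar_algebra A" and x: "x \<in> carrier A"
  interpret cstar_algebra A by fact
  let ?y = "op_adj u A x"
  have y: "?y \<in> carrier A" using A x by simp
  have "(cnorm A ?y)\<^sup>2 \<le> cnorm A x * cnorm A (op u A ?y)"
    by (rule norm_mult_pair[OF mult_pair_swap[OF mult_pair_op[OF A]] x])
  also have "\<dots> \<le> cnorm A x * (norm u * cnorm A ?y)"
    using cnorm_op_le[OF A y] norm_nonneg[OF x] by (rule mult_left_mono)
  finally have "cnorm A ?y * cnorm A ?y \<le> (norm u * cnorm A x) * cnorm A ?y"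
    by (simp add: power2_eq_square algebra_simps)
  then have "cnorm A ?y \<le> norm u * cnorm A x"
    using norm_nonneg[OF x] norm_nonneg[OF y] norm_multiplier_nonneg[of u]
    by (cases "cnorm A ?y = 0") auto
  then show "cnorm A (op (mult_adj u) A x) \<le> norm u * cnorm A x" by (simp add: op_mult_adj A x)
qed


lemma op_seq_limit:
  fixes X :: "nat \<Rightarrow> 'a multiplier"
  assumes "Cauchy X" "cstar_algebra A" "x \<in> carrier A"
  shows "\<exists>l\<in>carrier A. \<forall>e>0. \<exists>N. \<forall>n\<ge>N. cnorm A (op (X n) A x \<ominus>\<^bsub>A\<^esub> l) < e"
proof -
  interpret cstar_algebra A by fact
  show ?thesis
  proof (rule complete_sequence)
    show "op (X n) A x \<in> carrier A" for n using assms by simp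
    fix e :: real assume "0 < e"
    then have "0 < e / (cnorm A x + 1)" using norm_nonneg[OF assms(3)] by simp
    then obtain N where N: "\<And>m n. m \<ge> N \<Longrightarrow> n \<ge> N \<Longrightarrow> norm (X m - X n) < e / (cnorm A x + 1)"
      using CauchyD[OF assms(1)] by meson
    have "cnorm A (op (X m) A x \<ominus>\<^bsub>A\<^esub> op (X n) A x) < e" if "m \<ge> N" "n \<ge> N" for m n
    proof -
      have "cnorm A (op (X m) A x \<ominus>\<^bsub>A\<^esub> op (X n) A x) \<le> norm (X m - X n) * cnorm A x"
        using cnorm_op_le[OF assms(2,3), of "X m - X n"] assms by (simp add: op_zero_diff)
      also have "\<dots> \<le> norm (X m - X n) * (cnorm A x + 1)" by (simp add: mult_left_mono)
      also have "\<dots> < e" using N[OF that] norm_nonneg[OF assms(3)] by (simp add: less_divide_eq)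
      finally show ?thesis .
    qed
    then show "\<exists>N. \<forall>m\<ge>N. \<forall>n\<ge>N. cnorm A (op (X m) A x \<ominus>\<^bsub>A\<^esub> op (X n) A x) < e" by blast
  qed
qed

text \<open>
  A Cauchy sequence of multipliers converges pointwise, and so do the adjoints; the two limits are
  again adjoint to each other.
\<close>

lemma multiplier_cauchy_limit:
  fixes X :: "nat \<Rightarrow> 'a multiplier"
  assumes "Cauchy X"
  shows "\<exists>L. \<forall>e>0. \<exists>N. \<forall>n\<ge>N. norm (X n - L) \<le> e"
proof -
  have adj_diff: "mult_adj (u - v) = mult_adj u - mult_adj v" for u v :: "'a multiplier"
  proof (rule multiplier_eqI)
    fix A and x :: 'a assume A: "cstar_algebra A" "x \<in> carrier A"
    interpret cstar_algebra A by fact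
    have "op_adj (u - v) A x = op_adj u A x \<oplus>\<^bsub>A\<^esub> (-1) \<odot>\<^bsub>A\<^esub> op_adj v A x"
      unfolding minus_multiplier_def op_simps[OF A] by simp
    then show "op (mult_adj (u - v)) A x = op (mult_adj u - mult_adj v) A x"
      using A by (simp add: op_mult_adj op_zero_diff minus_eq_smult)
  qed
  have "Cauchy (\<lambda>n. mult_adj (X n))"
  proof (rule CauchyI)
    fix e :: real assume "0 < e"
    then obtain N where "\<And>m n. m \<ge> N \<Longrightarrow> n \<ge> N \<Longrightarrow> norm (X m - X n) < e"
      using CauchyD[OF assms(1)] by meson
    then show "\<exists>M. \<forall>m\<ge>M. \<forall>n\<ge>M. norm (mult_adj (X m) - mult_adj (X n)) < e"
      using norm_multiplier_adj by (metis adj_diff le_less_trans)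
  qed
  note lims = op_seq_limit[OF assms] op_seq_limit[OF this]
  define S where "S = (\<lambda>A x. SOME l. l \<in> carrier A \<and>
      (\<forall>e>0. \<exists>N. \<forall>n\<ge>N. cnorm A (op (X n) A x \<ominus>\<^bsub>A\<^esub> l) < e))"
  define T where "T = (\<lambda>A x. SOME l. l \<in> carrier A \<and>
      (\<forall>e>0. \<exists>N. \<forall>n\<ge>N. cnorm A (op (mult_adj (X n)) A x \<ominus>\<^bsub>A\<^esub> l) < e))"
  have S: "S A x \<in> carrier A \<and> (\<forall>e>0. \<exists>N. \<forall>n\<ge>N. cnorm A (op (X n) A x \<ominus>\<^bsub>A\<^esub> S A x) < e)"
    if "cstar_algebra A" "x \<in> carrier A" for A x
    unfolding S_def by (rule someI_ex) (use lims(1)[OF that] in blast)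
  have T: "T A x \<in> carrier A \<and> (\<forall>e>0. \<exists>N. \<forall>n\<ge>N. cnorm A (op (mult_adj (X n)) A x \<ominus>\<^bsub>A\<^esub> T A x) < e)"
    if "cstar_algebra A" "x \<in> carrier A" for A x
    unfolding T_def by (rule someI_ex) (use lims(2)[OF that] in blast)
  have pair: "mult_pair A (S A) (T A)" if A: "cstar_algebra A" for A
  proof -
    interpret cstar_algebra A by fact
    have "star A (S A x) \<otimes>\<^bsub>A\<^esub> y = star A x \<otimes>\<^bsub>A\<^esub> T A y" if x: "x \<in> carrier A" and y: "y \<in> carrier A" for x y
    proof -
      let ?d = "cnorm A (star A (S A x) \<otimes>\<^bsub>A\<^esub> y \<ominus>\<^bsub>A\<^esub> star A x \<otimes>\<^bsub>A\<^esub> T A y)"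
      note mem = S[OF A x, THEN conjunct1] T[OF A y, THEN conjunct1] x y
      have "?d \<le> 0 + e" if "0 < e" for e
      proof -
        define c where "c = cnorm A x + cnorm A y + 1"
        have c: "c > 0" using norm_nonneg[OF x] norm_nonneg[OF y] by (simp add: c_def)
        then have "0 < e / c" using that by simp
        then obtain N M where "\<forall>n\<ge>N. cnorm A (op (X n) A x \<ominus>\<^bsub>A\<^esub> S A x) < e / c"
          "\<forall>n\<ge>M. cnorm A (op (mult_adj (X n)) A y \<ominus>\<^bsub>A\<^esub> T A y) < e / c"
          using S[OF A x] T[OF A y] by meson
        then obtain n where n: "cnorm A (op (X n) A x \<ominus>\<^bsub>A\<^esub> S A x) \<le> e / c"
          "cnorm A (op (mult_adj (X n)) A y \<ominus>\<^bsub>A\<^esub> T A y) \<le> e / c"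
          by (metis less_imp_le linear)
        let ?u = "op (X n) A x" and ?v = "op (mult_adj (X n)) A y"
        have uv: "?u \<in> carrier A" "?v \<in> carrier A" using A x y by auto
        have eq: "star A ?u \<otimes>\<^bsub>A\<^esub> y = star A x \<otimes>\<^bsub>A\<^esub> ?v"
          using mult_pairD(3)[OF mult_pair_op[OF A] x y] by (simp add: op_mult_adj A y)
        have "?d \<le> cnorm A (star A (S A x) \<otimes>\<^bsub>A\<^esub> y \<ominus>\<^bsub>A\<^esub> star A ?u \<otimes>\<^bsub>A\<^esub> y)
            + cnorm A (star A x \<otimes>\<^bsub>A\<^esub> ?v \<ominus>\<^bsub>A\<^esub> star A x \<otimes>\<^bsub>A\<^esub> T A y)"
          using norm_diff_triangle[of "star A (S A x) \<otimes>\<^bsub>A\<^esub> y" "star A ?u \<otimes>\<^bsub>A\<^esub> y" "star A x \<otimes>\<^bsub>A\<^esub> T A y"] eq mem uv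
          by simp
        also have "star A (S A x) \<otimes>\<^bsub>A\<^esub> y \<ominus>\<^bsub>A\<^esub> star A ?u \<otimes>\<^bsub>A\<^esub> y = star A (S A x \<ominus>\<^bsub>A\<^esub> ?u) \<otimes>\<^bsub>A\<^esub> y"
          using mem uv by (simp add: star_diff diff_mult)
        also have "star A x \<otimes>\<^bsub>A\<^esub> ?v \<ominus>\<^bsub>A\<^esub> star A x \<otimes>\<^bsub>A\<^esub> T A y = star A x \<otimes>\<^bsub>A\<^esub> (?v \<ominus>\<^bsub>A\<^esub> T A y)"
          using mem uv by (simp add: mult_diff)
        also have "cnorm A (star A (S A x \<ominus>\<^bsub>A\<^esub> ?u) \<otimes>\<^bsub>A\<^esub> y) \<le> (e / c) * cnorm A y"
        proof -
          have "cnorm A (star A (S A x \<ominus>\<^bsub>A\<^esub> ?u) \<otimes>\<^bsub>A\<^esub> y) \<le> cnorm A (star A (S A x \<ominus>\<^bsub>A\<^esub> ?u)) * cnorm A y"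
            using mem uv by (intro norm_mult) auto
          also have "\<dots> \<le> (e / c) * cnorm A y"
            using n(1) norm_nonneg[OF y] mem uv
            by (intro mult_right_mono) (auto simp: norm_star norm_diff_swap[of "S A x"])
          finally show ?thesis .
        qed
        also have "cnorm A (star A x \<otimes>\<^bsub>A\<^esub> (?v \<ominus>\<^bsub>A\<^esub> T A y)) \<le> (e / c) * cnorm A x"
        proof -
          have "cnorm A (star A x \<otimes>\<^bsub>A\<^esub> (?v \<ominus>\<^bsub>A\<^esub> T A y)) \<le> cnorm A (star A x) * cnorm A (?v \<ominus>\<^bsub>A\<^esub> T A y)"
            using mem uv by (intro norm_mult) auto
          also have "\<dots> \<le> cnorm A x * (e / c)"
            unfolding norm_star[OF x] using n(2) norm_nonneg[OF x] by (rule mult_left_mono)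
          finally show ?thesis by (simp add: mult.commute)
        qed
        also have "e / c * cnorm A y + e / c * cnorm A x \<le> e / c * c"
          unfolding distrib_left[symmetric] using c that by (intro mult_left_mono) (auto simp: c_def)
        finally show ?thesis using c by simp
      qed
      then have "?d \<le> 0" by (rule field_le_epsilon)
      then have "?d = 0" using norm_nonneg[of "star A (S A x) \<otimes>\<^bsub>A\<^esub> y \<ominus>\<^bsub>A\<^esub> star A x \<otimes>\<^bsub>A\<^esub> T A y"] mem by simp
      then show ?thesis using mem by (simp add: norm_eq_zero diff_eq_zero)
    qed
    then show ?thesis using S[OF A] T[OF A] by (auto simp: mult_pair_def)
  qed
  have conv: "cnorm A (op (X n) A x \<ominus>\<^bsub>A\<^esub> S A x) \<le> e * cnorm A x"
    if A: "cstar_algebra A" "x \<in> carrier A" and N: "\<And>m. m \<ge> N \<Longrightarrow> norm (X n - X m) \<le> e" for A x n N e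
  proof (rule field_le_epsilon)
    interpret cstar_algebra A by fact
    fix d :: real assume "0 < d"
    then obtain M where M: "\<forall>n\<ge>M. cnorm A (op (X n) A x \<ominus>\<^bsub>A\<^esub> S A x) < d" using S[OF A] by meson
    define m where "m = max M N"
    have "cnorm A (op (X n) A x \<ominus>\<^bsub>A\<^esub> S A x)
        \<le> cnorm A (op (X n) A x \<ominus>\<^bsub>A\<^esub> op (X m) A x) + cnorm A (op (X m) A x \<ominus>\<^bsub>A\<^esub> S A x)"
      using S[OF A] A by (intro norm_diff_triangle) auto
    also have "cnorm A (op (X n) A x \<ominus>\<^bsub>A\<^esub> op (X m) A x) \<le> norm (X n - X m) * cnorm A x"
      using cnorm_op_le[OF A, of "X n - X m"] A by (simp add: op_zero_diff)
    also have "norm (X n - X m) * cnorm A x \<le> e * cnorm A x"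
      using N[of m] norm_nonneg[OF A(2)] by (intro mult_right_mono) (auto simp: m_def)
    also have "cnorm A (op (X m) A x \<ominus>\<^bsub>A\<^esub> S A x) \<le> d" using M by (auto simp: m_def less_imp_le)
    finally show "cnorm A (op (X n) A x \<ominus>\<^bsub>A\<^esub> S A x) \<le> e * cnorm A x + d" by simp
  qed
  have cau: "\<exists>N. \<forall>m\<ge>N. \<forall>n\<ge>N. norm (X m - X n) \<le> e" if "0 < e" for e
    using CauchyD[OF assms that] less_imp_le by meson
  obtain N1 where N1: "\<And>m. m \<ge> N1 \<Longrightarrow> norm (X N1 - X m) \<le> 1" using cau[of 1] by auto
  have "cnorm A (S A x) \<le> (norm (X N1) + 1) * cnorm A x" if A: "cstar_algebra A" "x \<in> carrier A" for A x
  proof -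
    interpret cstar_algebra A by fact
    have m: "S A x \<in> carrier A" "op (X N1) A x \<in> carrier A" using S[OF A] A by auto
    have "cnorm A (S A x \<ominus>\<^bsub>A\<^esub> \<zero>\<^bsub>A\<^esub>) \<le> cnorm A (S A x \<ominus>\<^bsub>A\<^esub> op (X N1) A x) + cnorm A (op (X N1) A x \<ominus>\<^bsub>A\<^esub> \<zero>\<^bsub>A\<^esub>)"
      using m by (intro norm_diff_triangle) auto
    moreover have "y \<ominus>\<^bsub>A\<^esub> \<zero>\<^bsub>A\<^esub> = y" if "y \<in> carrier A" for y using that by (simp add: minus_eq_smult)
    ultimately show ?thesis
      using conv[OF A N1, of N1] cnorm_op_le[OF A, of "X N1"] m
      by (simp add: norm_diff_swap[of "S A x"] algebra_simps)
  qed
  then have mp: "multiplier_pair S T"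
    using pair norm_multiplier_nonneg[of "X N1"]
    by (auto simp: multiplier_pair_def intro!: exI[of _ "norm (X N1) + 1"])
  have "norm (X n - Mult S T) \<le> e" if "0 < e" and N: "\<And>m. m \<ge> N \<Longrightarrow> norm (X n - X m) \<le> e" for e n N
  proof (rule norm_multiplier_leI)
    show "cnorm A (op (X n - Mult S T) A x) \<le> e * cnorm A x"
      if A: "cstar_algebra A" "x \<in> carrier A" for A x
      unfolding op_zero_diff[OF A] op_Mult[OF mp A] using A N by (rule conv)
  qed (use that in simp)
  then show ?thesis using cau by (meson order_refl)
qed

instantiation multiplier :: (type) unital_cstar
begin

definition "adj = (mult_adj :: 'a multiplier \<Rightarrow> 'a multiplier)"
definition "imag = (Mult (\<lambda>A x. \<i> \<odot>\<^bsub>A\<^esub> x) (\<lambda>A x. cnj \<i> \<odot>\<^bsub>A\<^esub> x) :: 'a multiplier)"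

lemma op_imag:
  assumes "cstar_algebra A" "x \<in> carrier A"
  shows "op imag A x = \<i> \<odot>\<^bsub>A\<^esub> x" "op_adj imag A x = (- \<i>) \<odot>\<^bsub>A\<^esub> x"
  using op_Mult[OF multiplier_pair_smult[OF multiplier_pair_id] assms, of \<i>]
  by (simp_all add: imag_multiplier_def)

instance
proof
  fix X :: "nat \<Rightarrow> 'a multiplier" assume "Cauchy X"
  then obtain L where L: "\<forall>e>0. \<exists>N. \<forall>n\<ge>N. norm (X n - L) \<le> e"
    using multiplier_cauchy_limit by blast
  have "X \<longlonglongrightarrow> L"
  proof (rule LIMSEQ_I)
    fix r :: real assume "0 < r"
    then obtain N where "\<forall>n\<ge>N. norm (X n - L) \<le> r / 2" using L half_gt_zero by blast
    then show "\<exists>N. \<forall>n\<ge>N. norm (X n - L) < r"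
      using \<open>0 < r\<close> by (intro exI[of _ N]) force
  qed
  then show "convergent X" by (rule convergentI)
next
  fix u v :: "'a multiplier" and r :: real
  note os = op_simps op_zero_diff op_mult_adj op_imag op_linear
  show "adj (adj u) = u" "adj (u + v) = adj u + adj v" "adj (r *\<^sub>R u) = r *\<^sub>R adj u"
    "adj (u * v) = adj v * adj u"
    by (auto intro!: multiplier_eqI simp: adj_multiplier_def os)
  have "op (imag * imag) A x = op (- 1) A x" "op (imag * u) A x = op (u * imag) A x"
    "op (adj imag) A x = op (- imag) A x" if A: "cstar_algebra A" "x \<in> carrier A" for A x
  proof -
    interpret cstar_algebra A by fact
    show "op (imag * imag) A x = op (- 1) A x" "op (imag * u) A x = op (u * imag) A x"
      "op (adj imag) A x = op (- imag) A x"
      using A by (simp_all add: os smult_smult adj_multiplier_def)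
  qed
  then show "imag * imag = (- 1 :: 'a multiplier)" "imag * u = u * imag" "adj imag = (- imag :: 'a multiplier)"
    by (auto intro!: multiplier_eqI)
  have "norm u \<le> sqrt (norm (adj u * u))"
  proof (rule norm_multiplier_leI)
    fix A and x :: 'a assume A: "cstar_algebra A" "x \<in> carrier A"
    interpret cstar_algebra A by fact
    have "(cnorm A (op u A x))\<^sup>2 \<le> cnorm A x * cnorm A (op (adj u * u) A x)"
      using norm_mult_pair[OF mult_pair_op[OF A(1)] A(2), of u] A by (simp add: os adj_multiplier_def)
    also have "\<dots> \<le> cnorm A x * (norm (adj u * u) * cnorm A x)"
      using cnorm_op_le[OF A] norm_nonneg[OF A(2)] by (rule mult_left_mono)
    also have "\<dots> = (sqrt (norm (adj u * u)) * cnorm A x)\<^sup>2"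
      by (simp add: power2_eq_square power_mult_distrib)
    finally show "cnorm A (op u A x) \<le> sqrt (norm (adj u * u)) * cnorm A x"
      by (rule power2_le_imp_le) (simp add: norm_nonneg[OF A(2)])
  qed simp
  then have "(norm u)\<^sup>2 \<le> norm (adj u * u)" using sqrt_ge_absD[of "norm u"] by simp
  moreover have "norm (adj u * u) \<le> norm (adj u) * norm u" by (rule norm_mult_ineq)
  moreover have "norm (adj u) * norm u \<le> (norm u)\<^sup>2"
    using norm_multiplier_adj[of u] by (simp add: adj_multiplier_def power2_eq_square mult_right_mono)
  ultimately show "norm (adj u * u) = (norm u)\<^sup>2" by simp
qed

end

section \<open>Two-by-two matrices over a \<open>C\<^sup>*\<close>-algebra\<close>

text \<open>
  Matrices are normed as operators on the Hilbert module of columns of length two.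
\<close>

type_synonym 'u col = "'u \<times> 'u"

definition col_ip :: "'u::unital_cstar col \<Rightarrow> 'u col \<Rightarrow> 'u" where
  "col_ip x y = adj (fst x) * fst y + adj (snd x) * snd y"

definition col_norm :: "'u::unital_cstar col \<Rightarrow> real" where
  "col_norm x = sqrt (norm (col_ip x x))"

definition col_scale :: "'u::unital_cstar col \<Rightarrow> 'u \<Rightarrow> 'u col" where
  "col_scale x a = (fst x * a, snd x * a)"

lemma col_ip_add:
  "col_ip (x + y) z = col_ip x z + col_ip y z" "col_ip z (x + y) = col_ip z x + col_ip z y"
  by (simp_all add: col_ip_def algebra_simps)

lemma col_ip_diff:
  "col_ip (x - y) z = col_ip x z - col_ip y z" "col_ip z (x - y) = col_ip z x - col_ip z y"
  by (simp_all add: col_ip_def algebra_simps)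

lemma col_ip_scale:
  "col_ip x (col_scale y a) = col_ip x y * a" "col_ip (col_scale x a) y = adj a * col_ip x y"
  by (simp_all add: col_ip_def col_scale_def algebra_simps)

lemma adj_col_ip: "adj (col_ip x y) = col_ip y x"
  by (simp add: col_ip_def)

lemma pos_col_ip: "pos (col_ip x x)"
  unfolding col_ip_def by (intro pos_add pos_adj_mult_self)

lemma col_norm_power2: "(col_norm x)\<^sup>2 = norm (col_ip x x)"
  by (simp add: col_norm_def)

lemma col_norm_nonneg [simp]: "0 \<le> col_norm x"
  by (simp add: col_norm_def)

lemma norm_fst_le: "norm (fst x) \<le> col_norm x" and norm_snd_le: "norm (snd x) \<le> col_norm x"
proof -
  have "(norm (fst x))\<^sup>2 \<le> norm (col_ip x x)" "(norm (snd x))\<^sup>2 \<le> norm (col_ip x x)"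
    using norm_le_sum_adj_mult_self[OF pos_adj_mult_self, of "fst x" "snd x"]
      norm_le_sum_adj_mult_self[OF pos_adj_mult_self, of "snd x" "fst x"]
    by (simp_all add: col_ip_def add.commute)
  then show "norm (fst x) \<le> col_norm x" "norm (snd x) \<le> col_norm x"
    by (simp_all add: col_norm_def real_le_rsqrt)
qed

text \<open>
  For \<open>\<parallel>x\<parallel> \<le> 1\<close> and \<open>a = \<langle>x, y\<rangle>\<close> the element
  \<open>\<langle>y, y\<rangle> - a\<^sup>* a = a\<^sup>* (1 - \<langle>x, x\<rangle>) a + \<langle>y - x a, y - x a\<rangle>\<close> is positive, and norms of positive elements
  are monotone.
\<close>

lemma col_cauchy_schwarz: "norm (col_ip x y) \<le> col_norm x * col_norm y"
proof -
  have unit: "norm (col_ip x y) \<le> col_norm y" if "norm (col_ip x x) \<le> 1" for x y :: "'a col"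
  proof -
    define a where "a = col_ip x y"
    have "col_ip y y = adj a * a + (adj a * (1 *\<^sub>R 1 - col_ip x x) * a
        + col_ip (y - col_scale x a) (y - col_scale x a))"
      by (simp add: col_ip_diff col_ip_scale algebra_simps a_def adj_col_ip)
    moreover have "pos (adj a * (1 *\<^sub>R 1 - col_ip x x) * a
        + col_ip (y - col_scale x a) (y - col_scale x a))"
      using that by (intro pos_add pos_col_ip pos_conj pos_complement) (auto simp: adj_col_ip)
    ultimately have "(norm a)\<^sup>2 \<le> norm (col_ip y y)"
      using norm_le_sum_adj_mult_self by metis
    then show ?thesis by (simp add: col_norm_def a_def real_le_rsqrt)
  qed
  show ?thesis
  proof (cases "col_norm x = 0")
    case True
    then have "fst x = 0" "snd x = 0" using norm_fst_le[of x] norm_snd_le[of x] by auto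
    then show ?thesis by (simp add: col_ip_def)
  next
    case False
    define z where "z = (1 / col_norm x) *\<^sub>R x"
    have ip: "col_ip z w = (1 / col_norm x) *\<^sub>R col_ip x w" "col_ip w z = (1 / col_norm x) *\<^sub>R col_ip w x" for w
      by (simp_all add: z_def col_ip_def algebra_simps)
    have "norm (col_ip z z) = norm (col_ip x x) / (col_norm x)\<^sup>2"
      by (simp add: ip power2_eq_square)
    also have "\<dots> \<le> 1" using False by (simp add: col_norm_power2[symmetric])
    finally have "norm (col_ip z y) \<le> col_norm y" by (rule unit)
    then have "norm (col_ip x y) / col_norm x \<le> col_norm y" by (simp add: ip)
    moreover have "0 < col_norm x" using False col_norm_nonneg[of x] by linarith
    ultimately show ?thesis by (simp add: divide_le_eq mult.commute)
  qed
qed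

lemma col_norm_triangle: "col_norm (x + y) \<le> col_norm x + col_norm y"
proof -
  have "(col_norm (x + y))\<^sup>2 = norm (col_ip x x + col_ip x y + col_ip y x + col_ip y y)"
    by (simp add: col_norm_power2 col_ip_add algebra_simps)
  also have "\<dots> \<le> norm (col_ip x x) + norm (col_ip x y) + norm (col_ip y x) + norm (col_ip y y)"
    by (meson add_mono norm_triangle_ineq order_refl order_trans)
  also have "\<dots> \<le> (col_norm x)\<^sup>2 + col_norm x * col_norm y + col_norm y * col_norm x + (col_norm y)\<^sup>2"
    using col_cauchy_schwarz[of x y] col_cauchy_schwarz[of y x]
    unfolding col_norm_power2 by linarith
  also have "\<dots> = (col_norm x + col_norm y)\<^sup>2" by (simp add: power2_eq_square algebra_simps)
  finally show ?thesis by (rule power2_le_imp_le) simp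
qed

lemma col_norm_scaleR: "col_norm (r *\<^sub>R x) = \<bar>r\<bar> * col_norm x"
proof -
  have "col_ip (r *\<^sub>R x) (r *\<^sub>R x) = (r * r) *\<^sub>R col_ip x x"
    by (simp add: col_ip_def algebra_simps)
  then show ?thesis by (simp add: col_norm_def real_sqrt_mult)
qed

lemma col_norm_axis: "col_norm (x, 0) = norm x" "col_norm (0, x) = norm x"
  by (simp_all add: col_norm_def col_ip_def norm_adj_mult_self)

lemma col_norm_le: "col_norm x \<le> norm (fst x) + norm (snd x)"
  using col_norm_triangle[of "(fst x, 0)" "(0, snd x)"] by (simp add: col_norm_axis)

datatype 'u mat2 = Mat2 (m00: 'u) (m01: 'u) (m10: 'u) (m11: 'u)

definition mat2_apply :: "'u::unital_cstar mat2 \<Rightarrow> 'u col \<Rightarrow> 'u col" where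
  "mat2_apply M x = (m00 M * fst x + m01 M * snd x, m10 M * fst x + m11 M * snd x)"

lemma col_norm_apply_entries:
  fixes M :: "'u::unital_cstar mat2"
  shows "col_norm (mat2_apply M x) \<le>
    (norm (m00 M) + norm (m01 M) + norm (m10 M) + norm (m11 M)) * col_norm x"
proof -
  have *: "norm (a * fst x + b * snd x) \<le> (norm a + norm b) * col_norm x" for a b :: 'u
  proof -
    have "norm (a * fst x + b * snd x) \<le> norm a * norm (fst x) + norm b * norm (snd x)"
      by (meson add_mono norm_mult_ineq norm_triangle_ineq order_trans)
    also have "\<dots> \<le> norm a * col_norm x + norm b * col_norm x"
      using norm_fst_le[of x] norm_snd_le[of x] by (intro add_mono mult_left_mono) auto
    finally show ?thesis by (simp add: algebra_simps)
  qed
  show ?thesis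
    using col_norm_le[of "mat2_apply M x"] *[of "m00 M" "m01 M"] *[of "m10 M" "m11 M"]
    by (simp add: mat2_apply_def algebra_simps)
qed

lemma mat2_eqI:
  "m00 M = m00 N \<Longrightarrow> m01 M = m01 N \<Longrightarrow> m10 M = m10 N \<Longrightarrow> m11 M = m11 N \<Longrightarrow> M = N"
  by (cases M; cases N) simp

instantiation mat2 :: (unital_cstar) "{real_normed_algebra, monoid_mult}"
begin

definition "M + N = Mat2 (m00 M + m00 N) (m01 M + m01 N) (m10 M + m10 N) (m11 M + m11 N)"
definition "M * N = Mat2
  (m00 M * m00 N + m01 M * m10 N) (m00 M * m01 N + m01 M * m11 N)
  (m10 M * m00 N + m11 M * m10 N) (m10 M * m01 N + m11 M * m11 N)"
definition "1 = Mat2 1 0 0 (1 :: 'a)"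
definition "0 = Mat2 0 0 0 (0 :: 'a)"
definition "r *\<^sub>R M = Mat2 (r *\<^sub>R m00 M) (r *\<^sub>R m01 M) (r *\<^sub>R m10 M) (r *\<^sub>R m11 M)"
definition "- M = Mat2 (- m00 M) (- m01 M) (- m10 M) (- m11 M)"
definition "M - N = Mat2 (m00 M - m00 N) (m01 M - m01 N) (m10 M - m10 N) (m11 M - m11 N)"
definition "norm M = Inf {K. 0 \<le> K \<and> (\<forall>x. col_norm (mat2_apply M x) \<le> K * col_norm x)}"
  for M :: "'a mat2"
definition "dist M N = norm (M - N)" for M N :: "'a mat2"
definition "sgn M = inverse (norm M) *\<^sub>R M" for M :: "'a mat2"
definition "(uniformity :: ('a mat2 \<times> 'a mat2) filter) =
    (INF e\<in>{0<..}. principal {(x, y). dist x y < e})"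
definition "open (U :: 'a mat2 set) \<longleftrightarrow>
    (\<forall>x\<in>U. \<forall>\<^sub>F (x', y) in uniformity. x' = x \<longrightarrow> y \<in> U)"

lemmas mat2_defs = plus_mat2_def times_mat2_def one_mat2_def zero_mat2_def scaleR_mat2_def
  uminus_mat2_def minus_mat2_def

lemma mat2_apply_simps:
  fixes M N :: "'a mat2"
  shows "mat2_apply (M + N) x = mat2_apply M x + mat2_apply N x"
  "mat2_apply (M * N) x = mat2_apply M (mat2_apply N x)"
  "mat2_apply (r *\<^sub>R M) x = r *\<^sub>R mat2_apply M x"
  by (simp_all add: mat2_defs mat2_apply_def algebra_simps)

lemma norm_mat2_ex:
  fixes M :: "'a mat2"
  shows "\<exists>K\<ge>0. \<forall>x. col_norm (mat2_apply M x) \<le> K * col_norm x"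
  using col_norm_apply_entries[of M] by (meson add_nonneg_nonneg norm_ge_zero)

lemma col_norm_apply_le:
  fixes M :: "'a mat2"
  shows "col_norm (mat2_apply M x) \<le> norm M * col_norm x"
proof -
  let ?S = "{K. 0 \<le> K \<and> (\<forall>x. col_norm (mat2_apply M x) \<le> K * col_norm x)}"
  have ne: "?S \<noteq> {}" using norm_mat2_ex[of M] by auto
  show ?thesis
  proof (cases "col_norm x = 0")
    case True
    obtain K where "K \<in> ?S" using ne by blast
    then show ?thesis using True by (metis (mono_tags, lifting) mem_Collect_eq mult_zero_right)
  next
    case False
    then have p: "col_norm x > 0" using col_norm_nonneg[of x] by linarith
    have "col_norm (mat2_apply M x) / col_norm x \<le> norm M"
      unfolding norm_mat2_def using ne
      by (rule cInf_greatest) (use p in \<open>auto simp: divide_le_eq simp del: split_paired_All\<close>)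
    then show ?thesis using p by (simp add: divide_le_eq)
  qed
qed

lemma norm_mat2_leI:
  fixes M :: "'a mat2"
  shows "0 \<le> K \<Longrightarrow> (\<And>x. col_norm (mat2_apply M x) \<le> K * col_norm x) \<Longrightarrow> norm M \<le> K"
  unfolding norm_mat2_def by (intro cInf_lower) auto

lemma norm_mat2_nonneg: "0 \<le> norm (M :: 'a mat2)"
  unfolding norm_mat2_def using norm_mat2_ex[of M] by (intro cInf_greatest) auto

lemma norm_entry_le:
  fixes M :: "'a mat2"
  shows "norm (m00 M) \<le> norm M" "norm (m01 M) \<le> norm M" "norm (m10 M) \<le> norm M" "norm (m11 M) \<le> norm M"
proof -
  have fst: "norm (fst (mat2_apply M x)) \<le> norm M" and snd: "norm (snd (mat2_apply M x)) \<le> norm M"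
    if "col_norm x \<le> 1" for x
  proof -
    have "norm M * col_norm x \<le> norm M" using that norm_mat2_nonneg by (rule mult_left_le)
    then show "norm (fst (mat2_apply M x)) \<le> norm M" "norm (snd (mat2_apply M x)) \<le> norm M"
      using norm_fst_le[of "mat2_apply M x"] norm_snd_le[of "mat2_apply M x"] col_norm_apply_le[of M x]
      by linarith+
  qed
  show "norm (m00 M) \<le> norm M" "norm (m01 M) \<le> norm M" "norm (m10 M) \<le> norm M" "norm (m11 M) \<le> norm M"
    using fst[of "(1, 0)"] fst[of "(0, 1)"] snd[of "(1, 0)"] snd[of "(0, 1)"]
    by (simp_all add: col_norm_axis norm_one_le mat2_apply_def)
qed

instance
proof
  fix a b c :: "'a mat2" and r s :: real
  show "a + b + c = a + (b + c)" "a + b = b + a" "0 + a = a" "- a + a = 0" "a - b = a + - b"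
    "r *\<^sub>R (a + b) = r *\<^sub>R a + r *\<^sub>R b" "(r + s) *\<^sub>R a = r *\<^sub>R a + s *\<^sub>R a"
    "r *\<^sub>R s *\<^sub>R a = (r * s) *\<^sub>R a" "1 *\<^sub>R a = a"
    "a * b * c = a * (b * c)" "(a + b) * c = a * c + b * c" "a * (b + c) = a * b + a * c"
    "r *\<^sub>R a * b = r *\<^sub>R (a * b)" "a * r *\<^sub>R b = r *\<^sub>R (a * b)" "1 * a = a" "a * 1 = a"
    by (simp_all add: mat2_defs algebra_simps)
  show "dist a b = norm (a - b)" by (rule dist_mat2_def)
  show "sgn a = inverse (norm a) *\<^sub>R a" by (rule sgn_mat2_def)
  show "(uniformity :: ('a mat2 \<times> 'a mat2) filter) =
      (INF e\<in>{0<..}. principal {(x, y). dist x y < e})" by (rule uniformity_mat2_def)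
  show "open U \<longleftrightarrow> (\<forall>x\<in>U. \<forall>\<^sub>F (x', y) in uniformity. x' = x \<longrightarrow> y \<in> U)" for U :: "'a mat2 set"
    by (rule open_mat2_def)
  show "norm a = 0 \<longleftrightarrow> a = 0"
  proof
    assume "norm a = 0"
    then show "a = 0" using norm_entry_le[of a] by (simp add: zero_mat2_def mat2_eqI)
  next
    assume "a = 0"
    then have "norm a \<le> 0"
      by (intro norm_mat2_leI) (auto simp: mat2_apply_def zero_mat2_def col_norm_axis)
    then show "norm a = 0" using norm_mat2_nonneg[of a] by simp
  qed
  show "norm (a + b) \<le> norm a + norm b"
  proof (rule norm_mat2_leI)
    show "col_norm (mat2_apply (a + b) x) \<le> (norm a + norm b) * col_norm x" for x
      using col_norm_triangle[of "mat2_apply a x" "mat2_apply b x"] col_norm_apply_le[of a x]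
        col_norm_apply_le[of b x] by (simp add: mat2_apply_simps algebra_simps)
  qed (simp add: norm_mat2_nonneg)
  have scale: "norm (r *\<^sub>R a) \<le> \<bar>r\<bar> * norm a" for r and a :: "'a mat2"
    by (rule norm_mat2_leI) (use col_norm_apply_le[of a] in
      \<open>auto simp: mat2_apply_simps col_norm_scaleR norm_mat2_nonneg mult.assoc mult_left_mono\<close>)
  show "norm (r *\<^sub>R a) = \<bar>r\<bar> * norm a"
  proof (cases "r = 0")
    case True
    then show ?thesis using scale[of r a] norm_mat2_nonneg[of "r *\<^sub>R a"] by simp
  next
    case False
    have "(1 / r) *\<^sub>R r *\<^sub>R a = a" using False by (simp add: scaleR_mat2_def)
    then have "\<bar>r\<bar> * norm a \<le> \<bar>r\<bar> * (\<bar>1 / r\<bar> * norm (r *\<^sub>R a))"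
      using scale[of "1 / r" "r *\<^sub>R a"] by (intro mult_left_mono) auto
    also have "\<dots> = norm (r *\<^sub>R a)" using False by (simp add: abs_divide)
    finally show ?thesis using scale[of r a] by simp
  qed
  show "norm (a * b) \<le> norm a * norm b"
  proof (rule norm_mat2_leI)
    fix x
    have "col_norm (mat2_apply a (mat2_apply b x)) \<le> norm a * col_norm (mat2_apply b x)"
      by (rule col_norm_apply_le)
    also have "\<dots> \<le> norm a * (norm b * col_norm x)"
      by (intro mult_left_mono col_norm_apply_le norm_mat2_nonneg)
    finally show "col_norm (mat2_apply (a * b) x) \<le> norm a * norm b * col_norm x"
      by (simp add: mat2_apply_simps mult.assoc)
  qed (simp add: norm_mat2_nonneg)
qed

end

lemma norm_mat2_le:
  "norm M \<le> norm (m00 M) + norm (m01 M) + norm (m10 M) + norm (m11 M)"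
  for M :: "'u::unital_cstar mat2"
  by (rule norm_mat2_leI) (simp_all add: col_norm_apply_entries)

instantiation mat2 :: (unital_cstar) unital_cstar
begin

definition "adj M = Mat2 (adj (m00 M)) (adj (m10 M)) (adj (m01 M)) (adj (m11 M))"
definition "imag = Mat2 imag 0 0 (imag :: 'a)"

lemma col_ip_adj: "col_ip (mat2_apply M x) y = col_ip x (mat2_apply (adj M) y)"
  by (simp add: col_ip_def mat2_apply_def adj_mat2_def algebra_simps)

instance
proof
  fix X :: "nat \<Rightarrow> 'a mat2" assume C: "Cauchy X"
  have lim: "convergent (\<lambda>n. p (X n))"
    if "\<And>M. norm (p M) \<le> norm M" "\<And>M N. p (M - N) = p M - p N" for p :: "'a mat2 \<Rightarrow> 'a"
  proof -
    have "Cauchy (\<lambda>n. p (X n))"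
    proof (rule CauchyI)
      fix e :: real assume "0 < e"
      then show "\<exists>M. \<forall>m\<ge>M. \<forall>n\<ge>M. norm (p (X m) - p (X n)) < e"
        using CauchyD[OF C] that by (metis le_less_trans)
    qed
    then show ?thesis by (rule Cauchy_convergent)
  qed
  have "convergent (\<lambda>n. m00 (X n))" "convergent (\<lambda>n. m01 (X n))" "convergent (\<lambda>n. m10 (X n))"
    "convergent (\<lambda>n. m11 (X n))"
    by (rule lim; simp add: norm_entry_le minus_mat2_def)+
  then obtain a b c d where L: "(\<lambda>n. m00 (X n)) \<longlonglongrightarrow> a" "(\<lambda>n. m01 (X n)) \<longlonglongrightarrow> b"
    "(\<lambda>n. m10 (X n)) \<longlonglongrightarrow> c" "(\<lambda>n. m11 (X n)) \<longlonglongrightarrow> d"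
    by (auto simp: convergent_def)
  let ?e = "\<lambda>n. norm (m00 (X n) - a) + norm (m01 (X n) - b) + norm (m10 (X n) - c) + norm (m11 (X n) - d)"
  have "(\<lambda>n. norm (X n - Mat2 a b c d)) \<longlonglongrightarrow> 0"
  proof (rule Lim_null_comparison)
    show "\<forall>\<^sub>F n in sequentially. norm (norm (X n - Mat2 a b c d)) \<le> ?e n"
      using norm_mat2_le[of "X _ - Mat2 a b c d"] by (simp add: minus_mat2_def)
    have "?e \<longlonglongrightarrow> norm (a - a) + norm (b - b) + norm (c - c) + norm (d - d)"
      by (intro tendsto_intros L)
    then show "?e \<longlonglongrightarrow> 0" by simp
  qed
  then have "X \<longlonglongrightarrow> Mat2 a b c d" by (simp add: LIM_zero_iff tendsto_norm_zero_iff)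
  then show "convergent X" by (rule convergentI)
next
  fix M N :: "'a mat2" and r :: real
  show "adj (adj M) = M" "adj (M + N) = adj M + adj N" "adj (r *\<^sub>R M) = r *\<^sub>R adj M"
    "adj (M * N) = adj N * adj M" "imag * imag = (- 1 :: 'a mat2)" "imag * M = M * imag"
    "adj imag = (- imag :: 'a mat2)"
    by (simp_all add: mat2_defs adj_mat2_def imag_mat2_def algebra_simps imag_square
        imag_commute[of "m00 M"] imag_commute[of "m01 M"] imag_commute[of "m10 M"] imag_commute[of "m11 M"])
  have le: "(norm M)\<^sup>2 \<le> norm (adj M * M)" for M :: "'a mat2"
  proof -
    have "norm M \<le> sqrt (norm (adj M * M))"
    proof (rule norm_mat2_leI)
      fix x
      have "(col_norm (mat2_apply M x))\<^sup>2 = norm (col_ip x (mat2_apply (adj M * M) x))"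
        by (simp add: col_norm_power2 col_ip_adj mat2_apply_simps)
      also have "\<dots> \<le> col_norm x * col_norm (mat2_apply (adj M * M) x)" by (rule col_cauchy_schwarz)
      also have "\<dots> \<le> col_norm x * (norm (adj M * M) * col_norm x)"
        by (intro mult_left_mono col_norm_apply_le) simp
      also have "\<dots> = (sqrt (norm (adj M * M)) * col_norm x)\<^sup>2"
        by (simp add: power2_eq_square power_mult_distrib)
      finally show "col_norm (mat2_apply M x) \<le> sqrt (norm (adj M * M)) * col_norm x"
        by (rule power2_le_imp_le) simp
    qed simp
    then show ?thesis using sqrt_ge_absD[of "norm M"] by simp
  qed
  have "norm M \<le> norm (adj M)" for M :: "'a mat2"
  proof (cases "norm M = 0")
    case False
    have "norm M * norm M \<le> norm (adj M) * norm M"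
      using le[of M] norm_mult_ineq[of "adj M" M] by (simp add: power2_eq_square)
    then show ?thesis using False by simp
  qed simp
  from this[of "adj M"] have "norm (adj M) \<le> norm M"
    by (simp add: adj_mat2_def)
  then have "norm (adj M * M) \<le> (norm M)\<^sup>2"
    using norm_mult_ineq[of "adj M" M] by (simp add: power2_eq_square mult_right_mono order_trans)
  then show "norm (adj M * M) = (norm M)\<^sup>2" using le[of M] by simp
qed

end

lemma norm_mat2_corner: "norm (Mat2 a 0 0 0) = norm a" for a :: "'u::unital_cstar"
  using norm_entry_le(1)[of "Mat2 a 0 0 0"] norm_mat2_le[of "Mat2 a 0 0 0"] by simp

section \<open>Representations\<close>

lemma norm_cscale: "norm (cscale t x) = cmod t * norm x"
proof -
  have "adj (cscale t x) * cscale t x = cscale (t * cnj t) (adj x * x)"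
    by (simp add: adj_cscale cscale_mult_left cscale_mult_right cscale_cscale)
  also have "t * cnj t = complex_of_real ((cmod t)\<^sup>2)"
    by (simp add: complex_norm_square del: of_real_power)
  finally have "(norm (cscale t x))\<^sup>2 = (cmod t * norm x)\<^sup>2"
    using norm_adj_mult_self[of "cscale t x"] norm_adj_mult_self[of x]
    by (simp add: power_mult_distrib del: of_real_power)
  then show ?thesis by simp
qed

text \<open>
  Representations lead from an algebra on a carrier into a type; \<open>faithful_rep\<close> below are the
  isometric ones, through which statements about carriers become statements about the type.
\<close>

definition rep :: "'a cstar \<Rightarrow> ('a \<Rightarrow> 'u::unital_cstar) \<Rightarrow> bool" where
  "rep A \<phi> \<longleftrightarrow>
     (\<forall>x\<in>carrier A. \<forall>y\<in>carrier A. \<phi> (x \<oplus>\<^bsub>A\<^esub> y) = \<phi> x + \<phi> y \<and> \<phi> (x \<otimes>\<^bsub>A\<^esub> y) = \<phi> x * \<phi> y) \<and>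
     (\<forall>t. \<forall>x\<in>carrier A. \<phi> (t \<odot>\<^bsub>A\<^esub> x) = cscale t (\<phi> x)) \<and>
     (\<forall>x\<in>carrier A. \<phi> (star A x) = adj (\<phi> x))"

lemma repD:
  assumes "rep A \<phi>" "x \<in> carrier A"
  shows "y \<in> carrier A \<Longrightarrow> \<phi> (x \<oplus>\<^bsub>A\<^esub> y) = \<phi> x + \<phi> y" "y \<in> carrier A \<Longrightarrow> \<phi> (x \<otimes>\<^bsub>A\<^esub> y) = \<phi> x * \<phi> y"
    "\<phi> (t \<odot>\<^bsub>A\<^esub> x) = cscale t (\<phi> x)" "\<phi> (star A x) = adj (\<phi> x)"
  using assms by (auto simp: rep_def)

lemma star_hom_rep: "star_hom A B \<psi> \<Longrightarrow> rep B \<phi> \<Longrightarrow> rep A (\<lambda>x. \<phi> (\<psi> x))"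
  by (auto simp: star_hom_def rep_def Pi_iff)

text \<open>
  Translates completeness and closedness on a carrier into topological notions of a type.
\<close>

lemma metric_embedding:
  fixes j :: "'a \<Rightarrow> 'u::real_normed_vector"
  assumes d: "\<And>x y. d x y = (if x \<in> M \<and> y \<in> M then dist (j x) (j y) else 0)" and inj: "inj_on j M"
  shows "Metric_space M d"
    and "complete (j ` M) \<Longrightarrow> Metric_space.mcomplete M d"
    and "closed (j ` M) \<Longrightarrow> closedin (Metric_space.mtopology M d) S \<longleftrightarrow> S \<subseteq> M \<and> closed (j ` S)"
proof -
  show M: "Metric_space M d"
  proof
    show "d x z \<le> d x y + d y z" if "x \<in> M" "y \<in> M" "z \<in> M" for x y z
      using that dist_triangle[of "j x" "j z" "j y"] by (simp add: d)
  qed (use inj in \<open>auto simp: d dist_commute inj_on_eq_iff\<close>)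
  interpret Metric_space M d by (rule M)
  have lim: "limitin mtopology s l sequentially \<longleftrightarrow> l \<in> M \<and> (\<lambda>n. j (s n)) \<longlonglongrightarrow> j l"
    if "range s \<subseteq> M" for s l
    using that by (auto simp: limit_metric_sequentially LIMSEQ_def d image_subset_iff)
  show "mcomplete" if C: "complete (j ` M)"
    unfolding mcomplete_def
  proof (intro allI impI)
    fix s assume s: "MCauchy s"
    then have r: "range s \<subseteq> M" by (simp add: MCauchy_def)
    have "Cauchy (\<lambda>n. j (s n))"
      using s r by (auto simp: MCauchy_def Cauchy_def d image_subset_iff)
    moreover have "\<forall>n. j (s n) \<in> j ` M" using r by auto
    ultimately obtain l where "l \<in> M" "(\<lambda>n. j (s n)) \<longlonglongrightarrow> j l"
      using C[unfolded complete_def, rule_format, of "\<lambda>n. j (s n)"] by blast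
    then show "\<exists>x. limitin mtopology s x sequentially" using lim[OF r] by blast
  qed
  show "closedin mtopology S \<longleftrightarrow> S \<subseteq> M \<and> closed (j ` S)" if cl: "closed (j ` M)"
  proof
    assume S: "closedin mtopology S"
    then have SM: "S \<subseteq> M" by (simp add: metric_closedin_iff_sequentially_closed)
    have "l \<in> j ` S" if u: "\<forall>n. u n \<in> j ` S" "u \<longlonglongrightarrow> l" for u l
    proof -
      have "\<forall>n. \<exists>x. x \<in> S \<and> u n = j x" using u(1) by blast
      then obtain s where s: "\<And>n. s n \<in> S" "\<And>n. u n = j (s n)" by metis
      have "\<And>n. u n \<in> j ` M" using s SM by blast
      then have "l \<in> j ` M" using u(2) by (rule closed_sequentially[OF cl])
      then obtain x where x: "x \<in> M" "l = j x" by blast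
      have "range s \<subseteq> S" using s by auto
      moreover have "(\<lambda>n. j (s n)) \<longlonglongrightarrow> j x" using u(2) x(2) by (simp flip: s(2))
      then have "limitin mtopology s x sequentially" using lim[of s x] \<open>range s \<subseteq> S\<close> SM x(1) by auto
      ultimately have "x \<in> S" using S by (auto simp: metric_closedin_iff_sequentially_closed)
      then show ?thesis using x by simp
    qed
    then show "S \<subseteq> M \<and> closed (j ` S)" using SM by (auto simp: closed_sequential_limits)
  next
    assume S: "S \<subseteq> M \<and> closed (j ` S)"
    have "l \<in> S" if "range s \<subseteq> S" "limitin mtopology s l sequentially" for s l
    proof -
      have "l \<in> M" "(\<lambda>n. j (s n)) \<longlonglongrightarrow> j l" using lim[of s l] that S by auto
      moreover have "\<And>n. j (s n) \<in> j ` S" using that by auto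
      ultimately have "j l \<in> j ` S" using S closed_sequentially[of "j ` S" "\<lambda>n. j (s n)" "j l"] by blast
      then show ?thesis using inj S \<open>l \<in> M\<close> by (auto simp: inj_on_def)
    qed
    then show "closedin mtopology S" using S by (auto simp: metric_closedin_iff_sequentially_closed)
  qed
qed

lemma module_embedding:
  fixes V :: "(complex, 't, 'z) module_scheme" and j :: "'t \<Rightarrow> 'u::unital_cstar"
  assumes inj: "inj_on j (carrier V)" and cs: "csubspace (j ` carrier V)"
    and zero: "\<zero>\<^bsub>V\<^esub> \<in> carrier V" "j \<zero>\<^bsub>V\<^esub> = 0"
    and add: "\<And>x y. x \<in> carrier V \<Longrightarrow> y \<in> carrier V \<Longrightarrow> x \<oplus>\<^bsub>V\<^esub> y \<in> carrier V \<and> j (x \<oplus>\<^bsub>V\<^esub> y) = j x + j y"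
    and smult: "\<And>t x. x \<in> carrier V \<Longrightarrow> t \<odot>\<^bsub>V\<^esub> x \<in> carrier V \<and> j (t \<odot>\<^bsub>V\<^esub> x) = cscale t (j x)"
  shows "Module.module complex_ring V"
    and "x \<in> carrier V \<Longrightarrow> y \<in> carrier V \<Longrightarrow> x \<ominus>\<^bsub>V\<^esub> y \<in> carrier V \<and> j (x \<ominus>\<^bsub>V\<^esub> y) = j x - j y"
proof -
  have eq: "x = y" if "j x = j y" "x \<in> carrier V" "y \<in> carrier V" for x y
    using inj that by (auto simp: inj_on_def)
  have ab: "abelian_group V"
  proof (rule abelian_groupI)
    fix x assume x: "x \<in> carrier V"
    have "cscale (-1) (j x) = - j x" by (simp add: cscale_def)
    then have "j ((-1) \<odot>\<^bsub>V\<^esub> x \<oplus>\<^bsub>V\<^esub> x) = 0" using x add smult by simp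
    then have "(-1) \<odot>\<^bsub>V\<^esub> x \<oplus>\<^bsub>V\<^esub> x = \<zero>\<^bsub>V\<^esub>" using x add smult zero by (intro eq) auto
    then show "\<exists>y\<in>carrier V. y \<oplus>\<^bsub>V\<^esub> x = \<zero>\<^bsub>V\<^esub>" using x smult by blast
  qed (use add zero in \<open>auto intro!: eq simp: algebra_simps\<close>)
  show "Module.module complex_ring V"
    by (rule moduleI[OF cring_complex_ring ab])
      (use add smult in \<open>auto intro!: eq simp: cscale_add_left cscale_add_right cscale_cscale\<close>)
  interpret abelian_group V by (rule ab)
  show "x \<ominus>\<^bsub>V\<^esub> y \<in> carrier V \<and> j (x \<ominus>\<^bsub>V\<^esub> y) = j x - j y" if x: "x \<in> carrier V" and y: "y \<in> carrier V"
  proof -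
    have i: "\<ominus>\<^bsub>V\<^esub> y \<in> carrier V" using y by simp
    have "j (\<ominus>\<^bsub>V\<^esub> y \<oplus>\<^bsub>V\<^esub> y) = 0" using y zero l_neg by simp
    then have "j (\<ominus>\<^bsub>V\<^esub> y) + j y = 0" using add[OF i y] by simp
    then have "j (\<ominus>\<^bsub>V\<^esub> y) = - j y" by (simp add: eq_neg_iff_add_eq_0)
    then show ?thesis using add[OF x i] x y by (simp add: a_minus_def)
  qed
qed

locale faithful_rep = cstar_algebra A for A :: "'a cstar" +
  fixes j :: "'a \<Rightarrow> 'u::unital_cstar"
  assumes rep: "rep A j" and isometric: "x \<in> carrier A \<Longrightarrow> norm (j x) = cnorm A x"
begin

lemmas j_simps = repD[OF rep]

lemma j_zero [simp]: "j \<zero>\<^bsub>A\<^esub> = 0"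
  using isometric[of "\<zero>\<^bsub>A\<^esub>"] by simp

lemma j_diff: "x \<in> carrier A \<Longrightarrow> y \<in> carrier A \<Longrightarrow> j (x \<ominus>\<^bsub>A\<^esub> y) = j x - j y"
  using j_simps(3)[of y "-1"] by (simp add: minus_eq_smult j_simps cscale_def)

lemma j_inj: "inj_on j (carrier A)"
proof (rule inj_onI)
  fix x y assume *: "x \<in> carrier A" "y \<in> carrier A" "j x = j y"
  then have "cnorm A (x \<ominus>\<^bsub>A\<^esub> y) = 0" using isometric[of "x \<ominus>\<^bsub>A\<^esub> y"] by (simp add: j_diff)
  then show "x = y" using * by (simp add: norm_eq_zero diff_eq_zero)
qed

lemma j_eq: "x \<in> carrier A \<Longrightarrow> y \<in> carrier A \<Longrightarrow> j x = j y \<Longrightarrow> x = y"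
  using j_inj by (auto simp: inj_on_def)

lemma norm_dist_eq:
  "norm_dist A (cnorm A) x y = (if x \<in> carrier A \<and> y \<in> carrier A then dist (j x) (j y) else 0)"
  by (simp add: norm_dist_def dist_norm isometric[symmetric] j_diff)

lemma csubspace_image: "csubspace (j ` carrier A)"
  unfolding csubspace_def
proof (intro conjI ballI allI)
  show "0 \<in> j ` carrier A" using j_zero by (metis image_eqI zero_closed)
  fix x y assume "x \<in> j ` carrier A" "y \<in> j ` carrier A"
  then obtain a b where "a \<in> carrier A" "b \<in> carrier A" "x = j a" "y = j b" by blast
  then show "x + y \<in> j ` carrier A" using imageI[of "a \<oplus>\<^bsub>A\<^esub> b" "carrier A" j] by (simp add: j_simps)
next
  fix t x assume "x \<in> j ` carrier A"
  then obtain a where "a \<in> carrier A" "x = j a" by blast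
  then show "cscale t x \<in> j ` carrier A" using imageI[of "t \<odot>\<^bsub>A\<^esub> a" "carrier A" j] by (simp add: j_simps)
qed

lemma closed_image: "closed (j ` carrier A)"
  unfolding closed_sequential_limits
proof (intro allI impI)
  fix u l assume u: "(\<forall>n. u n \<in> j ` carrier A) \<and> u \<longlonglongrightarrow> l"
  then have "\<forall>n. \<exists>x. x \<in> carrier A \<and> u n = j x" by blast
  then obtain s where s: "\<And>n. s n \<in> carrier A" "\<And>n. u n = j (s n)" by metis
  have nj: "cnorm A (s m \<ominus>\<^bsub>A\<^esub> y) = norm (u m - j y)" if "y \<in> carrier A" for m y
    using s that by (simp add: isometric[symmetric] j_diff)
  have "Cauchy u" using u LIMSEQ_imp_Cauchy by blast
  then have "\<exists>N. \<forall>m\<ge>N. \<forall>n\<ge>N. cnorm A (s m \<ominus>\<^bsub>A\<^esub> s n) < e" if "0 < e" for e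
    using CauchyD[OF _ that, of u] by (simp add: nj s)
  then obtain x where x: "x \<in> carrier A" "\<forall>e>0. \<exists>N. \<forall>n\<ge>N. cnorm A (s n \<ominus>\<^bsub>A\<^esub> x) < e"
    using complete_sequence[of s] s(1) by blast
  then have "u \<longlonglongrightarrow> j x" by (auto simp: nj intro: LIMSEQ_I)
  then show "l \<in> j ` carrier A" using u x(1) LIMSEQ_unique by blast
qed

lemma closed_star_subalg_image: "closed_star_subalg (j ` carrier A)"
  unfolding closed_star_subalg_def
proof (intro conjI ballI closed_image csubspace_image)
  fix x y assume "x \<in> j ` carrier A" "y \<in> j ` carrier A"
  then obtain a b where "a \<in> carrier A" "b \<in> carrier A" "x = j a" "y = j b" by blast
  then show "x * y \<in> j ` carrier A" using imageI[of "a \<otimes>\<^bsub>A\<^esub> b" "carrier A" j] by (simp add: j_simps)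
next
  fix x assume "x \<in> j ` carrier A"
  then obtain a where "a \<in> carrier A" "x = j a" by blast
  then show "adj x \<in> j ` carrier A" using imageI[of "star A a" "carrier A" j] by (simp add: j_simps)
qed

lemma closed_subspace_iff:
  "closed_subspace A S \<longleftrightarrow> S \<subseteq> carrier A \<and> csubspace (j ` S) \<and> closed (j ` S)"
proof -
  have "csubspace (j ` S) \<longleftrightarrow> \<zero>\<^bsub>A\<^esub> \<in> S \<and> (\<forall>x\<in>S. \<forall>y\<in>S. x \<oplus>\<^bsub>A\<^esub> y \<in> S) \<and> (\<forall>t. \<forall>x\<in>S. t \<odot>\<^bsub>A\<^esub> x \<in> S)"
    if S: "S \<subseteq> carrier A"
  proof -
    have mem: "j x \<in> j ` S \<longleftrightarrow> x \<in> S" if "x \<in> carrier A" for x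
      using that S j_inj by (auto simp: inj_on_def)
    have "0 \<in> j ` S \<longleftrightarrow> \<zero>\<^bsub>A\<^esub> \<in> S" using mem[of "\<zero>\<^bsub>A\<^esub>"] by simp
    moreover have "j x + j y \<in> j ` S \<longleftrightarrow> x \<oplus>\<^bsub>A\<^esub> y \<in> S" if "x \<in> S" "y \<in> S" for x y
      using mem[of "x \<oplus>\<^bsub>A\<^esub> y"] S that j_simps(1)[of x y] by (auto simp: subset_iff)
    moreover have "cscale t (j x) \<in> j ` S \<longleftrightarrow> t \<odot>\<^bsub>A\<^esub> x \<in> S" if "x \<in> S" for x t
      using mem[of "t \<odot>\<^bsub>A\<^esub> x"] S that j_simps(3)[of x t] by (auto simp: subset_iff)
    ultimately show ?thesis by (simp add: csubspace_def)
  qed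
  then show ?thesis
    using metric_embedding(3)[OF norm_dist_eq j_inj closed_image]
    by (auto simp: closed_subspace_def)
qed

lemma cstar_subalgebra_iff:
  "cstar_subalgebra A S \<longleftrightarrow> S \<subseteq> carrier A \<and> closed_star_subalg (j ` S)"
proof -
  have "(\<forall>x\<in>S. \<forall>y\<in>S. x \<otimes>\<^bsub>A\<^esub> y \<in> S) \<and> (\<forall>x\<in>S. star A x \<in> S) \<longleftrightarrow>
      (\<forall>x\<in>j ` S. \<forall>y\<in>j ` S. x * y \<in> j ` S) \<and> (\<forall>x\<in>j ` S. adj x \<in> j ` S)"
    if S: "S \<subseteq> carrier A"
  proof -
    have mem: "j x \<in> j ` S \<longleftrightarrow> x \<in> S" if "x \<in> carrier A" for x
      using that S j_inj by (auto simp: inj_on_def)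
    have "j x * j y \<in> j ` S \<longleftrightarrow> x \<otimes>\<^bsub>A\<^esub> y \<in> S" if "x \<in> S" "y \<in> S" for x y
      using mem[of "x \<otimes>\<^bsub>A\<^esub> y"] S that j_simps(2)[of x y] by (auto simp: subset_iff)
    moreover have "adj (j x) \<in> j ` S \<longleftrightarrow> star A x \<in> S" if "x \<in> S" for x
      using mem[of "star A x"] S that j_simps(4)[of x] by (auto simp: subset_iff)
    ultimately show ?thesis by simp
  qed
  then show ?thesis
    by (auto simp: cstar_subalgebra_def closed_star_subalg_def closed_subspace_iff)
qed

lemma j_finsum:
  "(\<And>e. e \<in> E \<Longrightarrow> g e \<in> carrier A) \<Longrightarrow> finsum A g E \<in> carrier A \<and> j (finsum A g E) = (\<Sum>e\<in>E. j (g e))"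
proof (induction E rule: infinite_finite_induct)
  case (insert x F)
  then have "finsum A g (insert x F) = g x \<oplus>\<^bsub>A\<^esub> finsum A g F" by (intro finsum_insert) auto
  then show ?case using insert by (simp add: j_simps)
qed (simp_all add: finsum_infinite)

end

text \<open>
  Every \<open>C\<^sup>*\<close>-algebra acts faithfully on itself by left multiplication.
\<close>

lemma faithful_rep_exists:
  assumes "cstar_algebra (A :: 'a cstar)"
  shows "\<exists>j :: 'a \<Rightarrow> 'a multiplier. faithful_rep A j"
proof -
  interpret cstar_algebra A by fact
  define j where "j = (\<lambda>x. Mult (\<lambda>A' y. if A' = A then x \<otimes>\<^bsub>A\<^esub> y else \<zero>\<^bsub>A'\<^esub>)
    (\<lambda>A' y. if A' = A then star A x \<otimes>\<^bsub>A\<^esub> y else \<zero>\<^bsub>A'\<^esub>))"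
  have mp: "multiplier_pair (\<lambda>A' y. if A' = A then x \<otimes>\<^bsub>A\<^esub> y else \<zero>\<^bsub>A'\<^esub>)
      (\<lambda>A' y. if A' = A then star A x \<otimes>\<^bsub>A\<^esub> y else \<zero>\<^bsub>A'\<^esub>)" if x: "x \<in> carrier A" for x
  proof -
    have "mult_pair A' (\<lambda>y. if A' = A then x \<otimes>\<^bsub>A\<^esub> y else \<zero>\<^bsub>A'\<^esub>)
      (\<lambda>y. if A' = A then star A x \<otimes>\<^bsub>A\<^esub> y else \<zero>\<^bsub>A'\<^esub>)" if "cstar_algebra A'" for A'
    proof (cases "A' = A")
      case True
      then show ?thesis using x by (auto simp: mult_pair_def star_mult mult_assoc)
    next
      case False
      interpret A': cstar_algebra A' by fact
      show ?thesis using False by (auto simp: mult_pair_def)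
    qed
    moreover have "cnorm A' (if A' = A then x \<otimes>\<^bsub>A\<^esub> y else \<zero>\<^bsub>A'\<^esub>) \<le> cnorm A x * cnorm A' y"
      if "cstar_algebra A'" "y \<in> carrier A'" for A' y
    proof -
      interpret A': cstar_algebra A' by fact
      show ?thesis using x that A'.norm_nonneg norm_nonneg[OF x] by (auto intro!: norm_mult)
    qed
    ultimately show ?thesis
      unfolding multiplier_pair_def using norm_nonneg[OF x] by blast
  qed
  have op_j: "op (j x) A' y = (if A' = A then x \<otimes>\<^bsub>A\<^esub> y else \<zero>\<^bsub>A'\<^esub>)"
    "op_adj (j x) A' y = (if A' = A then star A x \<otimes>\<^bsub>A\<^esub> y else \<zero>\<^bsub>A'\<^esub>)"
    if "x \<in> carrier A" "cstar_algebra A'" "y \<in> carrier A'" for x y A'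
    using op_Mult[OF mp] that by (auto simp: j_def)
  have rep: "rep A j"
    unfolding rep_def
  proof (intro conjI ballI allI)
    fix x y t assume x: "x \<in> carrier A"
    note os = op_simps op_zero_diff op_imag op_mult_adj op_j
    show "j (star A x) = adj (j x)"
      by (rule multiplier_eqI) (use x in \<open>auto simp: os adj_multiplier_def\<close>)
    show "j (t \<odot>\<^bsub>A\<^esub> x) = cscale t (j x)"
    proof (rule multiplier_eqI)
      fix A' and z :: 'a assume A': "cstar_algebra A'" "z \<in> carrier A'"
      interpret A': cstar_algebra A' by fact
      have "complex_of_real (Re t) \<odot>\<^bsub>A\<^esub> y \<oplus>\<^bsub>A\<^esub> (complex_of_real (Im t) * \<i>) \<odot>\<^bsub>A\<^esub> y = t \<odot>\<^bsub>A\<^esub> y"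
        if "y \<in> carrier A" for y
      proof -
        have "complex_of_real (Re t) + complex_of_real (Im t) * \<i> = t" by (simp add: complex_eq_iff)
        then show ?thesis
          using add_smult[OF that, of "complex_of_real (Re t)" "complex_of_real (Im t) * \<i>"] by simp
      qed
      then show "op (j (t \<odot>\<^bsub>A\<^esub> x)) A' z = op (cscale t (j x)) A' z"
        using x A' by (auto simp: cscale_def os mult_smult_l smult_smult)
    qed
    assume y: "y \<in> carrier A"
    show "j (x \<oplus>\<^bsub>A\<^esub> y) = j x + j y"
    proof (rule multiplier_eqI)
      fix A' and z :: 'a assume A': "cstar_algebra A'" "z \<in> carrier A'"
      interpret A': cstar_algebra A' by fact
      show "op (j (x \<oplus>\<^bsub>A\<^esub> y)) A' z = op (j x + j y) A' z"
        using x y A' by (auto simp: os mult_l_distr)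
    qed
    show "j (x \<otimes>\<^bsub>A\<^esub> y) = j x * j y"
    proof (rule multiplier_eqI)
      fix A' and z :: 'a assume A': "cstar_algebra A'" "z \<in> carrier A'"
      interpret A': cstar_algebra A' by fact
      show "op (j (x \<otimes>\<^bsub>A\<^esub> y)) A' z = op (j x * j y) A' z"
        using x y A' by (auto simp: os mult_assoc)
    qed
  qed
  have "norm (j x) = cnorm A x" if x: "x \<in> carrier A" for x
  proof (rule antisym)
    show "norm (j x) \<le> cnorm A x"
    proof (rule norm_multiplier_leI)
      fix A' and y :: 'a assume A': "cstar_algebra A'" "y \<in> carrier A'"
      interpret A': cstar_algebra A' by fact
      show "cnorm A' (op (j x) A' y) \<le> cnorm A x * cnorm A' y"
        using x A' A'.norm_nonneg norm_nonneg[OF x] by (auto simp: op_j intro!: norm_mult)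
    qed (use norm_nonneg x in auto)
    have "(cnorm A x)\<^sup>2 = cnorm A (x \<otimes>\<^bsub>A\<^esub> star A x)"
      using cstar_identity[of "star A x"] x by (simp add: star_star norm_star)
    also have "\<dots> \<le> norm (j x) * cnorm A x"
      using cnorm_op_le[OF assms, of "star A x" "j x"] x assms by (simp add: op_j norm_star)
    finally show "cnorm A x \<le> norm (j x)"
      using norm_nonneg[OF x] by (cases "cnorm A x = 0") (auto simp: power2_eq_square)
  qed
  with rep have "faithful_rep A j" by unfold_locales
  then show ?thesis by blast
qed

section \<open>Representations are contractive\<close>

lemma rep_zero: "cstar_algebra A \<Longrightarrow> rep A \<phi> \<Longrightarrow> \<phi> \<zero>\<^bsub>A\<^esub> = 0"
proof -
  assume A: "cstar_algebra A" and r: "rep A \<phi>"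
  interpret cstar_algebra A by fact
  show ?thesis using repD(3)[OF r, of "\<zero>\<^bsub>A\<^esub>" 0] by (simp add: cscale_def)
qed

text \<open>
  For selfadjoint \<open>h\<close> with \<open>\<parallel>h\<parallel> \<le> 1\<close> there is \<open>a\<close> in the algebra with \<open>h\<^sup>2 + (1 - a)\<^sup>2 = 1\<close>. This relation is
  purely algebraic once expanded, so it passes to the images, where it bounds \<open>\<phi> h\<close> by \<open>1\<close>. The
  general case follows from the \<open>C\<^sup>*\<close>-identity.
\<close>

lemma rep_contractive:
  fixes \<phi> :: "'a \<Rightarrow> 'u::unital_cstar"
  assumes A: "cstar_algebra A" and r: "rep A \<phi>" and x: "x \<in> carrier A"
  shows "norm (\<phi> x) \<le> cnorm A x"
proof -
  obtain j :: "'a \<Rightarrow> 'a multiplier" where "faithful_rep A j" using faithful_rep_exists[OF A] by blast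
  then interpret faithful_rep A j .
  note r = repD[OF r]
  have unit: "norm (\<phi> h) \<le> 1" if h: "h \<in> carrier A" "star A h = h" "cnorm A h \<le> 1" for h
  proof -
    define c where "c = j h * j h"
    have jh: "adj (j h) = j h" using j_simps(4)[of h] h by simp
    have c: "adj c = c" "norm c \<le> 1" "c \<in> j ` carrier A"
      using jh norm_square_selfadj[OF jh] isometric[of h] h norm_nonneg[of h]
        j_simps(2)[of h h] imageI[of "h \<otimes>\<^bsub>A\<^esub> h" "carrier A" j]
      by (simp_all add: c_def power_le_one_iff)
    obtain v where v: "adj v = v" "norm v \<le> 1" "(1 - v) * (1 - v) = 1 - c"
      "\<And>w. w * c = c * w \<Longrightarrow> w * v = v * w"
      "\<And>S. closed_star_subalg S \<Longrightarrow> c \<in> S \<Longrightarrow> v \<in> S"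
      "\<And>S. closed_star_subalg S \<Longrightarrow> 1 - c \<in> S \<Longrightarrow> 1 - v \<in> S"
      by (rule sqrt_one_minus[OF c(1,2)]) (rule that)
    have "v \<in> j ` carrier A" using closed_star_subalg_image c(3) by (rule v(5))
    then obtain a where a: "a \<in> carrier A" "v = j a" by blast
    have vc: "v + v = c + v * v" using v(3) by (simp add: algebra_simps)
    have hv: "j h * v = v * j h" by (rule v(4)) (simp add: c_def mult.assoc)
    have "a \<oplus>\<^bsub>A\<^esub> a = h \<otimes>\<^bsub>A\<^esub> h \<oplus>\<^bsub>A\<^esub> a \<otimes>\<^bsub>A\<^esub> a"
      using vc a h by (intro j_eq) (auto simp: j_simps c_def)
    then have "\<phi> (a \<oplus>\<^bsub>A\<^esub> a) = \<phi> (h \<otimes>\<^bsub>A\<^esub> h \<oplus>\<^bsub>A\<^esub> a \<otimes>\<^bsub>A\<^esub> a)" by simp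
    then have 1: "\<phi> a + \<phi> a = \<phi> h * \<phi> h + \<phi> a * \<phi> a" using a h by (simp add: r)
    have "star A a = a" using v(1) a by (intro j_eq) (auto simp: j_simps)
    then have 2: "adj (\<phi> a) = \<phi> a" using r(4)[of a] a by simp
    have "h \<otimes>\<^bsub>A\<^esub> a = a \<otimes>\<^bsub>A\<^esub> h" using hv a h by (intro j_eq) (auto simp: j_simps)
    then have "\<phi> (h \<otimes>\<^bsub>A\<^esub> a) = \<phi> (a \<otimes>\<^bsub>A\<^esub> h)" by simp
    then have 3: "\<phi> h * \<phi> a = \<phi> a * \<phi> h" using a h by (simp add: r)
    have 4: "adj (\<phi> h) = \<phi> h" using r(4)[of h] h by simp
    have "(norm (\<phi> h))\<^sup>2 \<le> 1"
    proof (rule norm_le_of_squares_eq[where q = "1 - \<phi> a"])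
      have "(1 - \<phi> a) * (1 - \<phi> a) = 1 - (\<phi> a + \<phi> a) + \<phi> a * \<phi> a" by (simp add: algebra_simps)
      then show "\<phi> h * \<phi> h + (1 - \<phi> a) * (1 - \<phi> a) = 1 *\<^sub>R 1" by (simp add: 1)
    qed (simp_all add: 2 4 left_diff_distrib right_diff_distrib 3)
    then show ?thesis by (simp add: power_le_one_iff)
  qed
  have selfadj: "norm (\<phi> h) \<le> cnorm A h" if h: "h \<in> carrier A" "star A h = h" for h
  proof (cases "cnorm A h = 0")
    case True
    then show ?thesis using h norm_eq_zero rep_zero[OF A assms(2)] by simp
  next
    case False
    then have p: "0 < cnorm A h" using norm_nonneg[of h] h by simp
    define t where "t = complex_of_real (1 / cnorm A h)"
    have "norm (\<phi> (t \<odot>\<^bsub>A\<^esub> h)) \<le> 1"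
      using h p by (intro unit) (auto simp: star_smult norm_smult t_def norm_divide)
    then show ?thesis using h p by (simp add: r t_def norm_cscale norm_divide divide_le_eq)
  qed
  have "(norm (\<phi> x))\<^sup>2 = norm (\<phi> (star A x \<otimes>\<^bsub>A\<^esub> x))"
    using x by (simp add: r norm_adj_mult_self)
  also have "\<dots> \<le> cnorm A (star A x \<otimes>\<^bsub>A\<^esub> x)"
    using x by (intro selfadj) (auto simp: star_mult star_star)
  also have "\<dots> = (cnorm A x)\<^sup>2" using x by (rule cstar_identity)
  finally show ?thesis using norm_nonneg[OF x] by (rule power2_le_imp_le)
qed

lemma rep_eq_on_generators:
  fixes \<phi> \<psi> :: "'a \<Rightarrow> 'u::unital_cstar"
  assumes A: "cstar_algebra A" and r: "rep A \<phi>" "rep A \<psi>" and g: "generates A W"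
    and eq: "\<And>w. w \<in> W \<Longrightarrow> \<phi> w = \<psi> w" and x: "x \<in> carrier A"
  shows "\<phi> x = \<psi> x"
proof -
  obtain j :: "'a \<Rightarrow> 'a multiplier" where "faithful_rep A j" using faithful_rep_exists[OF A] by blast
  then interpret faithful_rep A j .
  define S where "S = {x \<in> carrier A. \<phi> x = \<psi> x}"
  have mem: "y \<in> j ` S" if "y = j a" "a \<in> carrier A" "\<phi> a = \<psi> a" for y a
    using that by (auto simp: S_def)
  note D = repD[OF r(1)] repD[OF r(2)]
  have "closed_star_subalg (j ` S)"
    unfolding closed_star_subalg_def csubspace_def
  proof (intro conjI ballI allI)
    show "0 \<in> j ` S" by (rule mem[of _ "\<zero>\<^bsub>A\<^esub>"]) (simp_all add: rep_zero[OF A] r)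
    show "closed (j ` S)"
      unfolding closed_sequential_limits
    proof (intro allI impI)
      fix u l assume u: "(\<forall>n. u n \<in> j ` S) \<and> u \<longlonglongrightarrow> l"
      then have "\<forall>n. \<exists>a. a \<in> S \<and> u n = j a" by blast
      then obtain s where s: "\<And>n. s n \<in> S" "\<And>n. u n = j (s n)" by metis
      have "u n \<in> j ` carrier A" for n using s by (auto simp: S_def)
      then have "l \<in> j ` carrier A" using u closed_sequentially[OF closed_image, of u] by blast
      then obtain a where a: "a \<in> carrier A" "l = j a" by blast
      have lim: "(\<lambda>n. \<theta> (s n)) \<longlonglongrightarrow> \<theta> a" if "rep A \<theta>" for \<theta> :: "'a \<Rightarrow> 'u"
      proof (rule LIM_zero_cancel, rule Lim_null_comparison)
        have "norm (\<theta> (s n) - \<theta> a) \<le> norm (u n - l)" for n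
        proof -
          have sn: "s n \<in> carrier A" using s(1)[of n] by (simp add: S_def)
          have "\<theta> (s n \<ominus>\<^bsub>A\<^esub> a) = \<theta> (s n) - \<theta> a"
            using sn a repD[OF that] by (simp add: minus_eq_smult cscale_def)
          then have "norm (\<theta> (s n) - \<theta> a) \<le> cnorm A (s n \<ominus>\<^bsub>A\<^esub> a)"
            using rep_contractive[OF A that, of "s n \<ominus>\<^bsub>A\<^esub> a"] sn a by simp
          also have "\<dots> = norm (u n - l)"
            using sn a s(2) isometric[of "s n \<ominus>\<^bsub>A\<^esub> a"] by (simp add: j_diff)
          finally show ?thesis .
        qed
        then show "\<forall>\<^sub>F n in sequentially. norm (\<theta> (s n) - \<theta> a) \<le> norm (u n - l)" by simp
        show "(\<lambda>n. norm (u n - l)) \<longlonglongrightarrow> 0" using u by (simp add: LIM_zero_iff tendsto_norm_zero)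
      qed
      have "(\<lambda>n. \<phi> (s n)) = (\<lambda>n. \<psi> (s n))" using s(1) by (auto simp: S_def)
      then have "\<phi> a = \<psi> a" using lim[OF r(1)] lim[OF r(2)] LIMSEQ_unique by metis
      then show "l \<in> j ` S" using a by (intro mem)
    qed
  next
    fix p q assume "p \<in> j ` S" "q \<in> j ` S"
    then obtain a b where ab: "a \<in> carrier A" "\<phi> a = \<psi> a" "b \<in> carrier A" "\<phi> b = \<psi> b" "p = j a" "q = j b"
      by (auto simp: S_def)
    show "p + q \<in> j ` S" by (rule mem[of _ "a \<oplus>\<^bsub>A\<^esub> b"]) (use ab in \<open>simp_all add: D j_simps\<close>)
    show "p * q \<in> j ` S" by (rule mem[of _ "a \<otimes>\<^bsub>A\<^esub> b"]) (use ab in \<open>simp_all add: D j_simps\<close>)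
  next
    fix p t assume "p \<in> j ` S"
    then obtain a where ab: "a \<in> carrier A" "\<phi> a = \<psi> a" "p = j a" by (auto simp: S_def)
    show "cscale t p \<in> j ` S" by (rule mem[of _ "t \<odot>\<^bsub>A\<^esub> a"]) (use ab in \<open>simp_all add: D j_simps\<close>)
  next
    fix p assume "p \<in> j ` S"
    then obtain a where ab: "a \<in> carrier A" "\<phi> a = \<psi> a" "p = j a" by (auto simp: S_def)
    show "adj p \<in> j ` S" by (rule mem[of _ "star A a"]) (use ab in \<open>simp_all add: D j_simps\<close>)
  qed
  then have "cstar_subalgebra A S" by (auto simp: cstar_subalgebra_iff S_def)
  moreover have "W \<subseteq> S" using g eq by (auto simp: generates_def S_def)
  ultimately have "S = carrier A" using g by (auto simp: generates_def)
  then show ?thesis using x by (auto simp: S_def)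
qed

section \<open>Separable subalgebras and the universal property\<close>

definition gen :: "'u::unital_cstar set \<Rightarrow> 'u set" where
  "gen W = \<Inter>{S. closed_star_subalg S \<and> W \<subseteq> S}"

lemma closed_star_subalg_gen: "closed_star_subalg (gen W)"
  unfolding closed_star_subalg_def csubspace_def gen_def
  by (intro conjI closed_Inter)
    (auto simp: closed_star_subalg_def csubspaceD(1,2,3))

lemma gen_superset: "W \<subseteq> gen W"
  by (auto simp: gen_def)

lemma gen_least: "closed_star_subalg S \<Longrightarrow> W \<subseteq> S \<Longrightarrow> gen W \<subseteq> S"
  by (auto simp: gen_def)

lemma (in faithful_rep) image_eq_gen:
  assumes "generates A W" shows "j ` carrier A = gen (j ` W)"
proof
  define S where "S = {x \<in> carrier A. j x \<in> gen (j ` W)}"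
  have W: "W \<subseteq> carrier A" using assms by (simp add: generates_def)
  show le: "gen (j ` W) \<subseteq> j ` carrier A"
    using W by (intro gen_least closed_star_subalg_image) auto
  then have jS: "j ` S = gen (j ` W)" by (auto simp: S_def)
  have "cstar_subalgebra A S"
    unfolding cstar_subalgebra_iff jS using closed_star_subalg_gen by (auto simp: S_def)
  moreover have "W \<subseteq> S" using W gen_superset by (fastforce simp: S_def)
  ultimately have "S = carrier A" using assms by (auto simp: generates_def)
  then show "j ` carrier A \<subseteq> gen (j ` W)" using jS by simp
qed

primrec rational_words :: "'u::unital_cstar set \<Rightarrow> nat \<Rightarrow> 'u set" where
  "rational_words W 0 = insert 0 W"
| "rational_words W (Suc n) = rational_words W n
     \<union> (\<lambda>(x, y). x + y) ` (rational_words W n \<times> rational_words W n)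
     \<union> (\<lambda>(x, y). x * y) ` (rational_words W n \<times> rational_words W n)
     \<union> adj ` rational_words W n \<union> (\<lambda>x. imag * x) ` rational_words W n
     \<union> (\<lambda>(q, x). q *\<^sub>R x) ` (\<rat> \<times> rational_words W n)"

text \<open>
  The words with rational coefficients are countable, and their closure is a subalgebra: real
  multiples of limits are limits of rational multiples.
\<close>

lemma gen_separable:
  assumes "countable (W :: 'u::unital_cstar set)"
  shows "\<exists>d :: nat \<Rightarrow> 'u. gen W \<subseteq> closure (range d)"
proof -
  define D where "D = (\<Union>n. rational_words W n)"
  have cn: "countable (rational_words W n)" for n
    by (induction n) (use assms in \<open>auto intro!: countable_Un countable_image countable_SIGMA countable_rat\<close>)
  then have D: "countable D" by (simp add: D_def)
  have D0: "0 \<in> D" "W \<subseteq> D" by (auto simp: D_def intro!: exI[of _ 0])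
  have mono: "rational_words W m \<subseteq> rational_words W n" if "m \<le> n" for m n
    using that by (induction rule: dec_induct) auto
  have two: "\<exists>n. x \<in> rational_words W n \<and> y \<in> rational_words W n" if xy: "x \<in> D" "y \<in> D" for x y
  proof -
    obtain m n where "x \<in> rational_words W m" "y \<in> rational_words W n" using xy by (auto simp: D_def)
    then show ?thesis using mono[of m "max m n"] mono[of n "max m n"] by (intro exI[of _ "max m n"]) auto
  qed
  have suc: "x \<in> rational_words W (Suc n) \<Longrightarrow> x \<in> D" for x n unfolding D_def by blast
  have D_ops: "x + y \<in> D" "x * y \<in> D" if xy: "x \<in> D" "y \<in> D" for x y
  proof -
    obtain n where n: "x \<in> rational_words W n" "y \<in> rational_words W n" using two[OF xy] by blast
    show "x + y \<in> D" by (rule suc[of _ n]) (use n in force)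
    show "x * y \<in> D" by (rule suc[of _ n]) (use n in force)
  qed
  have D_ops': "adj x \<in> D" "imag * x \<in> D" "q \<in> \<rat> \<Longrightarrow> q *\<^sub>R x \<in> D" if x: "x \<in> D" for x q
  proof -
    obtain n where n: "x \<in> rational_words W n" using x by (auto simp: D_def)
    show "adj x \<in> D" by (rule suc[of _ n]) (use n in force)
    show "imag * x \<in> D" by (rule suc[of _ n]) (use n in force)
    show "q *\<^sub>R x \<in> D" if "q \<in> \<rat>" by (rule suc[of _ n]) (use n that in force)
  qed
  let ?C = "closure D"
  have ext1: "g x \<in> ?C" if g: "continuous_on UNIV g" "\<And>x. x \<in> D \<Longrightarrow> g x \<in> ?C" and x: "x \<in> ?C" for g :: "'u \<Rightarrow> 'u" and x
    using image_closure_subset[of D g ?C] continuous_on_subset[OF g(1)] g(2) x by blast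
  have bin: "g x y \<in> ?C" if c1: "\<And>y. continuous_on UNIV (\<lambda>x. g x y)" and c2: "\<And>x. continuous_on UNIV (g x)"
    and g: "\<And>x y. x \<in> D \<Longrightarrow> y \<in> D \<Longrightarrow> g x y \<in> D" and x: "x \<in> ?C" and y: "y \<in> ?C" for g :: "'u \<Rightarrow> 'u \<Rightarrow> 'u" and x y
  proof -
    have "g x y \<in> ?C" if "x \<in> D" for x
      by (rule ext1[OF c2 _ y]) (use g that closure_subset in blast)
    then show ?thesis by (rule ext1[OF c1 _ x])
  qed
  have real_scale: "r *\<^sub>R x \<in> ?C" if x: "x \<in> ?C" for r x
  proof -
    have "q *\<^sub>R x \<in> ?C" if "q \<in> \<rat>" for q
      by (rule ext1[OF _ _ x]) (use D_ops'(3) that closure_subset in \<open>auto intro!: continuous_intros\<close>)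
    then have "(\<lambda>r. r *\<^sub>R x) ` closure \<rat> \<subseteq> ?C"
      by (intro image_closure_subset) (auto intro!: continuous_intros)
    then show ?thesis using Rats_closure_real by blast
  qed
  have add: "x + y \<in> ?C" if "x \<in> ?C" "y \<in> ?C" for x y
    by (rule bin[of "(+)"]) (use that D_ops in \<open>auto intro!: continuous_intros\<close>)
  have imag: "imag * x \<in> ?C" if "x \<in> ?C" for x
    by (rule ext1[OF _ _ that]) (use D_ops'(2) closure_subset in \<open>auto intro!: continuous_intros\<close>)
  have "closed_star_subalg ?C"
    unfolding closed_star_subalg_def csubspace_def
  proof (intro conjI ballI allI)
    show "0 \<in> ?C" using D0 closure_subset by blast
    show "x * y \<in> ?C" if "x \<in> ?C" "y \<in> ?C" for x y
      by (rule bin[of "(*)"]) (use that D_ops in \<open>auto intro!: continuous_intros\<close>)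
    show "adj x \<in> ?C" if "x \<in> ?C" for x
      by (rule ext1[OF _ _ that]) (use D_ops'(1) closure_subset in \<open>auto intro!: continuous_intros\<close>)
    show "cscale t x \<in> ?C" if "x \<in> ?C" for t x
      unfolding cscale_def using that by (intro add real_scale imag)
  qed (use add in auto)
  then have "gen W \<subseteq> ?C" using D0 closure_subset by (intro gen_least) auto
  moreover have "range (from_nat_into D) = D" using D D0 by (intro range_from_nat_into) auto
  ultimately show ?thesis by metis
qed

text \<open>
  A point of a separable metric space is determined by its distances to a dense sequence.
\<close>

lemma gen_injection:
  assumes "countable (W :: 'u::unital_cstar set)"
  shows "\<exists>enc :: 'u \<Rightarrow> test_space. inj_on enc (gen W)"
proof -
  obtain d :: "nat \<Rightarrow> 'u" where d: "gen W \<subseteq> closure (range d)" using gen_separable[OF assms] by blast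
  have "x = y" if "x \<in> gen W" and eq: "\<And>n. norm (x - d n) = norm (y - d n)" for x y
  proof -
    have "x \<in> closure (range d)" using that(1) d by blast
    have "norm (x - y) \<le> 0 + e" if e: "0 < e" for e
    proof -
      obtain n where n: "dist (d n) x < e / 2"
        using \<open>x \<in> closure (range d)\<close>[unfolded closure_approachable, rule_format, of "e / 2"] e by auto
      have "norm (x - y) \<le> norm (x - d n) + norm (y - d n)"
        using norm_triangle_ineq4[of "x - d n" "y - d n"] by simp
      then show ?thesis using n eq[of n] by (simp add: dist_norm norm_minus_commute)
    qed
    then have "norm (x - y) \<le> 0" by (rule field_le_epsilon)
    then show ?thesis by simp
  qed
  then have "inj_on (\<lambda>x. (\<lambda>_ n. complex_of_real (norm (x - d n)))) (gen W)"
    by (auto simp: inj_on_def fun_eq_iff)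
  then show ?thesis by blast
qed

text \<open>
  The copy of a subalgebra \<open>S\<close> of a type under the injection \<open>enc\<close>.
\<close>

definition record_of :: "'u::unital_cstar set \<Rightarrow> ('u \<Rightarrow> 't) \<Rightarrow> 't cstar" where
  "record_of S enc = (let dec = the_inv_into S enc in
     \<lparr>carrier = enc ` S, mult = (\<lambda>x y. enc (dec x * dec y)), one = enc 0, zero = enc 0,
      add = (\<lambda>x y. enc (dec x + dec y)), smult = (\<lambda>t x. enc (cscale t (dec x))),
      star = (\<lambda>x. enc (adj (dec x))), cnorm = (\<lambda>x. norm (dec x))\<rparr>)"

lemma record_of:
  fixes enc :: "'u::unital_cstar \<Rightarrow> 't"
  assumes S: "closed_star_subalg S" and inj: "inj_on enc S"
  shows "faithful_rep (record_of S enc) (the_inv_into S enc)" and "carrier (record_of S enc) = enc ` S"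
proof -
  define dec where "dec = the_inv_into S enc"
  define A where "A = record_of S enc"
  have dec: "dec (enc x) = x" if "x \<in> S" for x
    using the_inv_into_f_f[OF inj that] by (simp add: dec_def)
  note D = closed_star_subalgD[OF S] csubspaceD[OF closed_star_subalgD(2)[OF S]]
  have A: "carrier A = enc ` S" "x \<otimes>\<^bsub>A\<^esub> y = enc (dec x * dec y)" "\<zero>\<^bsub>A\<^esub> = enc 0"
    "x \<oplus>\<^bsub>A\<^esub> y = enc (dec x + dec y)" "t \<odot>\<^bsub>A\<^esub> x = enc (cscale t (dec x))"
    "star A x = enc (adj (dec x))" "cnorm A x = norm (dec x)" for x y t
    by (simp_all add: A_def record_of_def Let_def dec_def)
  have img: "dec ` carrier A = S" using dec by (force simp: A)
  have di: "inj_on dec (carrier A)" using dec by (auto simp: inj_on_def A)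
  have el: "dec x \<in> S" if "x \<in> carrier A" for x using img that by blast
  have add: "x \<oplus>\<^bsub>A\<^esub> y \<in> carrier A \<and> dec (x \<oplus>\<^bsub>A\<^esub> y) = dec x + dec y" if "x \<in> carrier A" "y \<in> carrier A" for x y
    using D(6)[OF el el] that dec by (auto simp: A)
  have smult: "t \<odot>\<^bsub>A\<^esub> x \<in> carrier A \<and> dec (t \<odot>\<^bsub>A\<^esub> x) = cscale t (dec x)" if "x \<in> carrier A" for x t
    using D(7)[OF el] that dec by (auto simp: A)
  have mult: "x \<otimes>\<^bsub>A\<^esub> y \<in> carrier A \<and> dec (x \<otimes>\<^bsub>A\<^esub> y) = dec x * dec y" if "x \<in> carrier A" "y \<in> carrier A" for x y
    using D(3)[OF el el] that dec by (auto simp: A)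
  have star: "star A x \<in> carrier A \<and> dec (star A x) = adj (dec x)" if "x \<in> carrier A" for x
    using D(4)[OF el] that dec by (auto simp: A)
  have zero: "\<zero>\<^bsub>A\<^esub> \<in> carrier A" "dec \<zero>\<^bsub>A\<^esub> = 0" using D(5) dec by (auto simp: A)
  note M = module_embedding[OF di _ zero add smult, unfolded img, OF D(2)]
  have eq: "x = y" if "dec x = dec y" "x \<in> carrier A" "y \<in> carrier A" for x y
    using di that by (auto simp: inj_on_def)
  have nd: "norm_dist A (cnorm A) x y = (if x \<in> carrier A \<and> y \<in> carrier A then dist (dec x) (dec y) else 0)" for x y
    using M(2)[of x y] by (auto simp: norm_dist_def A(7) dist_norm)
  have "cstar_algebra A"
  proof (intro cstar_algebra.intro cstar_algebra_axioms.intro M(1))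
    fix x y z t
    assume x: "x \<in> carrier A"
    show "star A x \<in> carrier A" "star A (star A x) = x" "0 \<le> cnorm A x"
      "cnorm A x = 0 \<longleftrightarrow> x = \<zero>\<^bsub>A\<^esub>" "star A (t \<odot>\<^bsub>A\<^esub> x) = cnj t \<odot>\<^bsub>A\<^esub> star A x"
      "cnorm A (t \<odot>\<^bsub>A\<^esub> x) = cmod t * cnorm A x"
      "cnorm A (star A x \<otimes>\<^bsub>A\<^esub> x) = (cnorm A x)\<^sup>2"
      using x star smult mult zero
      by (auto simp: A(7) norm_cscale norm_adj_mult_self adj_cscale intro!: eq)
    assume y: "y \<in> carrier A"
    show "x \<otimes>\<^bsub>A\<^esub> y \<in> carrier A" "cnorm A (x \<oplus>\<^bsub>A\<^esub> y) \<le> cnorm A x + cnorm A y"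
      "cnorm A (x \<otimes>\<^bsub>A\<^esub> y) \<le> cnorm A x * cnorm A y" "star A (x \<oplus>\<^bsub>A\<^esub> y) = star A x \<oplus>\<^bsub>A\<^esub> star A y"
      "star A (x \<otimes>\<^bsub>A\<^esub> y) = star A y \<otimes>\<^bsub>A\<^esub> star A x"
      "(t \<odot>\<^bsub>A\<^esub> x) \<otimes>\<^bsub>A\<^esub> y = t \<odot>\<^bsub>A\<^esub> (x \<otimes>\<^bsub>A\<^esub> y)" "x \<otimes>\<^bsub>A\<^esub> (t \<odot>\<^bsub>A\<^esub> y) = t \<odot>\<^bsub>A\<^esub> (x \<otimes>\<^bsub>A\<^esub> y)"
      using x y star smult mult add zero
      by (auto simp: A(7) norm_triangle_ineq norm_mult_ineq cscale_mult_left cscale_mult_right intro!: eq)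
    assume z: "z \<in> carrier A"
    show "x \<otimes>\<^bsub>A\<^esub> y \<otimes>\<^bsub>A\<^esub> z = x \<otimes>\<^bsub>A\<^esub> (y \<otimes>\<^bsub>A\<^esub> z)"
      "(x \<oplus>\<^bsub>A\<^esub> y) \<otimes>\<^bsub>A\<^esub> z = x \<otimes>\<^bsub>A\<^esub> z \<oplus>\<^bsub>A\<^esub> y \<otimes>\<^bsub>A\<^esub> z"
      "x \<otimes>\<^bsub>A\<^esub> (y \<oplus>\<^bsub>A\<^esub> z) = x \<otimes>\<^bsub>A\<^esub> y \<oplus>\<^bsub>A\<^esub> x \<otimes>\<^bsub>A\<^esub> z"
      using x y z mult add by (auto simp: mult.assoc distrib_left distrib_right intro!: eq)
  next
    show "Metric_space.mcomplete (carrier A) (norm_dist A (cnorm A))"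
      by (rule metric_embedding(2)[OF nd di]) (use D(1) img in \<open>simp add: complete_eq_closed\<close>)
  qed
  moreover have "rep A dec" using add mult smult star by (simp add: rep_def)
  ultimately have "faithful_rep A dec"
    by (auto simp: faithful_rep_def faithful_rep_axioms_def A(7))
  then show "faithful_rep (record_of S enc) (the_inv_into S enc)" "carrier (record_of S enc) = enc ` S"
    using A(1) by (simp_all add: A_def dec_def)
qed

section \<open>Cuntz--Krieger families in a typed algebra\<close>

text \<open>
  The images of edges are partial isometries because \<open>t\<^sup>* t = p\<close> with a projection \<open>p\<close> implies
  \<open>t p = t\<close> (\<open>partial_isometry_of_source\<close>).
\<close>

definition ck_typed ::
  "('m, 'k::finite) kgraph \<Rightarrow> ('m \<Rightarrow> 'u::unital_cstar) \<Rightarrow> ('m \<Rightarrow> 'u) \<Rightarrow> bool" where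
  "ck_typed \<Lambda> P T \<longleftrightarrow>
     (\<forall>v\<in>kverts \<Lambda>. adj (P v) = P v \<and> P v * P v = P v) \<and>
     (\<forall>v\<in>kverts \<Lambda>. \<forall>w\<in>kverts \<Lambda>. v \<noteq> w \<longrightarrow> P v * P w = 0) \<and>
     (\<forall>a b f g. commutes \<Lambda> a f g b \<longrightarrow> T a * T f = T g * T b) \<and>
     (\<forall>e\<in>kedges \<Lambda>. adj (T e) * T e = P (src \<Lambda> e)) \<and>
     (\<forall>v\<in>kverts \<Lambda>. \<forall>i.
        P v = (\<Sum>e \<in> {e \<in> of_degree \<Lambda> (axis i 1). rng \<Lambda> e = v}. T e * adj (T e)))"

lemma abs_deg_axis [simp]: "abs_deg (axis i 1) = 1"
  by (simp add: abs_deg_def axis_def)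

lemma abs_deg_add: "abs_deg (m + n) = abs_deg m + abs_deg n"
  by (simp add: abs_deg_def sum.distrib)

lemma abs_deg_0 [simp]: "abs_deg 0 = 0"
  by (simp add: abs_deg_def)

lemma abs_deg_eq_1: assumes "abs_deg n = 1" shows "\<exists>i. n = axis i 1"
proof -
  obtain i where i: "n $ i = 1" "\<And>j. j \<noteq> i \<Longrightarrow> n $ j = 0"
    using assms sum_eq_1_iff[of UNIV "\<lambda>i. n $ i"] by (auto simp: abs_deg_def)
  have "n = axis i 1" by (rule vec_eq_iff[THEN iffD2]) (use i in \<open>auto simp: axis_def\<close>)
  then show ?thesis by blast
qed

lemma of_degree_axis_kedges: "e \<in> of_degree \<Lambda> (axis i 1) \<Longrightarrow> e \<in> kedges \<Lambda>"
  unfolding of_degree_def kedges_def using abs_deg_axis by fastforce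

lemma partial_isometry_of_source:
  fixes t p :: "'u::unital_cstar"
  assumes "adj p = p" "p * p = p" "adj t * t = p"
  shows "t * p = t"
proof -
  have "adj (t - t * p) * (t - t * p) = 0"
    using assms by (simp add: algebra_simps flip: mult.assoc)
      (simp add: mult.assoc)
  then show ?thesis using norm_adj_mult_self[of "t - t * p"] by simp
qed

lemma (in faithful_rep) CK_familyD:
  assumes "CK_family \<Lambda> A P T"
  shows "v \<in> kverts \<Lambda> \<Longrightarrow> P v \<in> carrier A" "e \<in> kedges \<Lambda> \<Longrightarrow> T e \<in> carrier A"
    and "ck_typed \<Lambda> (\<lambda>v. j (P v)) (\<lambda>e. j (T e))"
proof -
  show P: "P v \<in> carrier A" if "v \<in> kverts \<Lambda>" for v
    using assms that by (simp add: CK_family_def projection_def)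
  show T: "T e \<in> carrier A" if "e \<in> kedges \<Lambda>" for e
    using assms that by (simp add: CK_family_def partial_isometry_def)
  show "ck_typed \<Lambda> (\<lambda>v. j (P v)) (\<lambda>e. j (T e))"
    unfolding ck_typed_def
  proof (intro conjI ballI allI impI)
    fix v assume v: "v \<in> kverts \<Lambda>"
    then have pr: "star A (P v) = P v" "P v \<otimes>\<^bsub>A\<^esub> P v = P v"
      using assms by (auto simp: CK_family_def projection_def)
    show "adj (j (P v)) = j (P v)" "j (P v) * j (P v) = j (P v)"
      using pr j_simps(2)[OF P[OF v] P[OF v]] j_simps(4)[OF P[OF v]] by simp_all
    show "j (P v) * j (P w) = 0" if "w \<in> kverts \<Lambda>" "v \<noteq> w" for w
      using assms v that P[OF v] P[of w] j_simps(2)[of "P v" "P w"] by (simp add: CK_family_def)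
    show "j (P v) = (\<Sum>e \<in> {e \<in> of_degree \<Lambda> (axis i 1). rng \<Lambda> e = v}. j (T e) * adj (j (T e)))" for i
    proof -
      let ?E = "{e \<in> of_degree \<Lambda> (axis i 1). rng \<Lambda> e = v}"
      have E: "T e \<in> carrier A" if "e \<in> ?E" for e
        using that by (blast intro: T of_degree_axis_kedges)
      then have "j (finsum A (\<lambda>e. T e \<otimes>\<^bsub>A\<^esub> star A (T e)) ?E) = (\<Sum>e\<in>?E. j (T e \<otimes>\<^bsub>A\<^esub> star A (T e)))"
        by (intro j_finsum[THEN conjunct2]) auto
      moreover have "P v = finsum A (\<lambda>e. T e \<otimes>\<^bsub>A\<^esub> star A (T e)) ?E"
        using assms v unfolding CK_family_def by blast
      ultimately have "j (P v) = (\<Sum>e\<in>?E. j (T e \<otimes>\<^bsub>A\<^esub> star A (T e)))" by simp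
      also have "\<dots> = (\<Sum>e\<in>?E. j (T e) * adj (j (T e)))"
        using E by (intro sum.cong) (auto simp: j_simps)
      finally show ?thesis .
    qed
  next
    fix a b f g assume c: "commutes \<Lambda> a f g b"
    then have "T a \<in> carrier A" "T f \<in> carrier A" "T g \<in> carrier A" "T b \<in> carrier A"
      using T by (auto simp: commutes_def)
    moreover have "T a \<otimes>\<^bsub>A\<^esub> T f = T g \<otimes>\<^bsub>A\<^esub> T b" using assms c by (simp add: CK_family_def)
    ultimately show "j (T a) * j (T f) = j (T g) * j (T b)" by (metis j_simps(2))
  next
    fix e assume e: "e \<in> kedges \<Lambda>"
    then have "star A (T e) \<otimes>\<^bsub>A\<^esub> T e = P (src \<Lambda> e)" using assms by (simp add: CK_family_def)
    then show "adj (j (T e)) * j (T e) = j (P (src \<Lambda> e))" using T[OF e] by (metis j_simps(2,4) star_closed)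
  qed
qed

lemma (in faithful_rep) CK_familyI:
  assumes P: "\<And>v. v \<in> kverts \<Lambda> \<Longrightarrow> P v \<in> carrier A" and T: "\<And>e. e \<in> kedges \<Lambda> \<Longrightarrow> T e \<in> carrier A"
    and src: "\<And>e. e \<in> kedges \<Lambda> \<Longrightarrow> src \<Lambda> e \<in> kverts \<Lambda>"
    and ck: "ck_typed \<Lambda> (\<lambda>v. j (P v)) (\<lambda>e. j (T e))"
  shows "CK_family \<Lambda> A P T"
  unfolding CK_family_def
proof (intro conjI ballI allI impI)
  fix v assume v: "v \<in> kverts \<Lambda>"
  have pr: "adj (j (P v)) = j (P v)" "j (P v) * j (P v) = j (P v)" using ck v by (auto simp: ck_typed_def)
  show "projection A (P v)"
    using P[OF v] pr by (auto simp: projection_def j_simps intro!: j_eq)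
  show "P v \<otimes>\<^bsub>A\<^esub> P w = \<zero>\<^bsub>A\<^esub>" if "w \<in> kverts \<Lambda>" "v \<noteq> w" for w
    using P[OF v] P[of w] that ck v by (intro j_eq) (auto simp: j_simps ck_typed_def)
  show "P v = (\<Oplus>\<^bsub>A\<^esub>e\<in>{e \<in> of_degree \<Lambda> (axis i 1). rng \<Lambda> e = v}. T e \<otimes>\<^bsub>A\<^esub> star A (T e))" for i
  proof (rule j_eq[OF P[OF v]])
    let ?E = "{e \<in> of_degree \<Lambda> (axis i 1). rng \<Lambda> e = v}"
    have E: "T e \<in> carrier A" if "e \<in> ?E" for e
      using that by (blast intro: T of_degree_axis_kedges)
    then have fs: "finsum A (\<lambda>e. T e \<otimes>\<^bsub>A\<^esub> star A (T e)) ?E \<in> carrier A \<and>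
        j (finsum A (\<lambda>e. T e \<otimes>\<^bsub>A\<^esub> star A (T e)) ?E) = (\<Sum>e\<in>?E. j (T e \<otimes>\<^bsub>A\<^esub> star A (T e)))"
      by (intro j_finsum) auto
    show "(\<Oplus>\<^bsub>A\<^esub>e\<in>?E. T e \<otimes>\<^bsub>A\<^esub> star A (T e)) \<in> carrier A" using fs by blast
    have "(\<Sum>e\<in>?E. j (T e \<otimes>\<^bsub>A\<^esub> star A (T e))) = (\<Sum>e\<in>?E. j (T e) * adj (j (T e)))"
      using E by (intro sum.cong) (auto simp: j_simps)
    also have "\<dots> = j (P v)" using ck v by (simp add: ck_typed_def)
    finally show "j (P v) = j (\<Oplus>\<^bsub>A\<^esub>e\<in>?E. T e \<otimes>\<^bsub>A\<^esub> star A (T e))" using fs by simp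
  qed
next
  fix a b f g assume c: "commutes \<Lambda> a f g b"
  then have "T a \<in> carrier A" "T f \<in> carrier A" "T g \<in> carrier A" "T b \<in> carrier A"
    using T by (auto simp: commutes_def)
  then show "T a \<otimes>\<^bsub>A\<^esub> T f = T g \<otimes>\<^bsub>A\<^esub> T b"
    using ck c by (intro j_eq) (auto simp: ck_typed_def j_simps)
next
  fix e assume e: "e \<in> kedges \<Lambda>"
  have tt: "adj (j (T e)) * j (T e) = j (P (src \<Lambda> e))" using ck e by (simp add: ck_typed_def)
  then show "star A (T e) \<otimes>\<^bsub>A\<^esub> T e = P (src \<Lambda> e)"
    using T[OF e] P[OF src[OF e]] by (intro j_eq) (auto simp: j_simps)
  have "j (T e) * j (P (src \<Lambda> e)) = j (T e)"
    by (rule partial_isometry_of_source) (use tt ck src[OF e] in \<open>auto simp: ck_typed_def\<close>)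
  then show "partial_isometry A (T e)"
    using T[OF e] tt unfolding partial_isometry_def
    by (intro conjI j_eq) (auto simp: j_simps mult.assoc)
qed

lemma ck_typed_cong:
  assumes "ck_typed \<Lambda> P T" and src: "\<And>e. e \<in> kedges \<Lambda> \<Longrightarrow> src \<Lambda> e \<in> kverts \<Lambda>"
    and P: "\<And>v. v \<in> kverts \<Lambda> \<Longrightarrow> P' v = P v" and T: "\<And>e. e \<in> kedges \<Lambda> \<Longrightarrow> T' e = T e"
  shows "ck_typed \<Lambda> P' T'"
  unfolding ck_typed_def
proof (intro conjI ballI allI impI)
  fix v assume v: "v \<in> kverts \<Lambda>"
  show "adj (P' v) = P' v" "P' v * P' v = P' v" using assms(1) v P[OF v] by (simp_all add: ck_typed_def)
  show "P' v * P' w = 0" if "w \<in> kverts \<Lambda>" "v \<noteq> w" for w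
    using assms(1) v that P[OF v] P[of w] by (simp add: ck_typed_def)
  show "P' v = (\<Sum>e\<in>{e \<in> of_degree \<Lambda> (axis i 1). rng \<Lambda> e = v}. T' e * adj (T' e))" for i
  proof -
    let ?E = "{e \<in> of_degree \<Lambda> (axis i 1). rng \<Lambda> e = v}"
    have "(\<Sum>e\<in>?E. T' e * adj (T' e)) = (\<Sum>e\<in>?E. T e * adj (T e))"
    proof (rule sum.cong)
      fix e assume "e \<in> ?E"
      then have "e \<in> kedges \<Lambda>" by (blast intro: of_degree_axis_kedges)
      then show "T' e * adj (T' e) = T e * adj (T e)" by (simp add: T)
    qed simp
    moreover have "P v = (\<Sum>e\<in>?E. T e * adj (T e))" using assms(1) v unfolding ck_typed_def by blast
    ultimately show ?thesis using P[OF v] by simp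
  qed
next
  fix a b f g assume c: "commutes \<Lambda> a f g b"
  then show "T' a * T' f = T' g * T' b"
    using assms(1) T by (simp add: ck_typed_def commutes_def)
next
  fix e assume e: "e \<in> kedges \<Lambda>"
  then show "adj (T' e) * T' e = P' (src \<Lambda> e)"
    using assms(1) T[OF e] P[OF src[OF e]] by (simp add: ck_typed_def)
qed

text \<open>
  The universal property speaks about algebras inside the test space only. A countable family
  generates a separable algebra, which has a copy there.
\<close>

lemma universal_rep:
  fixes Q S :: "'m \<Rightarrow> 'u::unital_cstar"
  assumes U: "universal_CK_algebra \<Lambda> A P T" and src: "\<And>e. e \<in> kedges \<Lambda> \<Longrightarrow> src \<Lambda> e \<in> kverts \<Lambda>"
    and ck: "ck_typed \<Lambda> Q S" and count: "countable (Q ` kverts \<Lambda> \<union> S ` kedges \<Lambda>)"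
  shows "\<exists>\<phi>. rep A \<phi> \<and> \<phi> ` carrier A \<subseteq> gen (Q ` kverts \<Lambda> \<union> S ` kedges \<Lambda>) \<and>
    (\<forall>v\<in>kverts \<Lambda>. \<phi> (P v) = Q v) \<and> (\<forall>e\<in>kedges \<Lambda>. \<phi> (T e) = S e)"
proof -
  let ?W = "Q ` kverts \<Lambda> \<union> S ` kedges \<Lambda>"
  obtain enc :: "'u \<Rightarrow> test_space" where inj: "inj_on enc (gen ?W)"
    using gen_injection[OF count] by blast
  define R where "R = record_of (gen ?W) enc"
  define dec where "dec = the_inv_into (gen ?W) enc"
  interpret R: faithful_rep R dec
    unfolding R_def dec_def by (rule record_of(1)[OF closed_star_subalg_gen inj])
  have car: "carrier R = enc ` gen ?W"
    unfolding R_def by (rule record_of(2)[OF closed_star_subalg_gen inj])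
  have dec: "dec (enc x) = x" if "x \<in> gen ?W" for x
    using the_inv_into_f_f[OF inj that] by (simp add: dec_def)
  have mem: "v \<in> kverts \<Lambda> \<Longrightarrow> Q v \<in> gen ?W" "e \<in> kedges \<Lambda> \<Longrightarrow> S e \<in> gen ?W" for v e
    using gen_superset[of ?W] by auto
  have "CK_family \<Lambda> R (\<lambda>v. enc (Q v)) (\<lambda>e. enc (S e))"
  proof (rule R.CK_familyI[OF _ _ src])
    show "ck_typed \<Lambda> (\<lambda>v. dec (enc (Q v))) (\<lambda>e. dec (enc (S e)))"
      by (rule ck_typed_cong[OF ck src]) (auto simp: dec mem)
  qed (auto simp: car mem)
  then obtain \<phi> where \<phi>: "star_hom A R \<phi>" "\<forall>v\<in>kverts \<Lambda>. \<phi> (P v) = enc (Q v)"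
    "\<forall>e\<in>kedges \<Lambda>. \<phi> (T e) = enc (S e)"
    using U R.cstar_algebra_axioms unfolding universal_CK_algebra_def by blast
  have "rep A (\<lambda>x. dec (\<phi> x))" by (rule star_hom_rep[OF \<phi>(1) R.rep])
  moreover have "(\<lambda>x. dec (\<phi> x)) ` carrier A \<subseteq> gen ?W"
    using \<phi>(1) car dec by (auto simp: star_hom_def Pi_iff)
  moreover have "\<forall>v\<in>kverts \<Lambda>. dec (\<phi> (P v)) = Q v" "\<forall>e\<in>kedges \<Lambda>. dec (\<phi> (T e)) = S e"
    using \<phi>(2,3) dec mem by auto
  ultimately show ?thesis by blast
qed

section \<open>Quotients of path categories\<close>

text \<open>
  The quotient of a path category has the expected vertices and edges as soon as the generating
  relations preserve degrees: paths of length at most one are then alone in their classes.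
\<close>

locale graded_graph =
  fixes G :: "('v, 'e, 'k::finite) cgraph" and R :: "'e \<Rightarrow> 'e \<Rightarrow> 'e \<Rightarrow> 'e \<Rightarrow> bool"
  assumes edge_deg: "e \<in> gedges G \<Longrightarrow> abs_deg (gdeg G e) = 1"
    and edge_src: "e \<in> gedges G \<Longrightarrow> gsrc G e \<in> gverts G"
    and edge_rng: "e \<in> gedges G \<Longrightarrow> grng G e \<in> gverts G"
    and rel_deg: "R x y z w \<Longrightarrow> is_path G ([x, y], v) \<Longrightarrow> is_path G ([z, w], v) \<Longrightarrow>
      gdeg G x + gdeg G y = gdeg G z + gdeg G w"
begin

abbreviation "Quot \<equiv> path_quotient G R"

definition vclass :: "'v \<Rightarrow> ('v, 'e) path set" where "vclass v = {([], v)}"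

definition eclass :: "'e \<Rightarrow> ('v, 'e) path set" where "eclass e = {([e], gsrc G e)}"

lemma length_path_cat: "length (fst (path_cat p q)) = length (fst p) + length (fst q)"
  by (cases p; cases q) simp

lemma path_equiv_length: "path_equiv G R p q \<Longrightarrow> length (fst p) = length (fst q)"
  by (induction rule: path_equiv.induct) (simp_all add: length_path_cat)

lemma path_equiv_short: "path_equiv G R p q \<Longrightarrow> length (fst p) \<le> 1 \<Longrightarrow> p = q"
proof (induction rule: path_equiv.induct)
  case (sym p q)
  then show ?case using path_equiv_length[OF sym(1)] by metis
next
  case (trans p q r)
  then show ?case using path_equiv_length[OF trans(1)] by metis
next
  case (cat p1 q1 p2 q2)
  have "length (fst p1) \<le> 1" "length (fst p2) \<le> 1"
    using \<open>length (fst (path_cat p2 p1)) \<le> 1\<close> by (simp_all add: length_path_cat)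
  then show ?case using cat.IH by metis
qed simp_all

lemma path_deg_cat: "path_deg G (path_cat p q) = path_deg G p + path_deg G q"
  by (cases p; cases q) auto

lemma path_equiv_deg: "path_equiv G R p q \<Longrightarrow> path_deg G p = path_deg G q"
proof (induction rule: path_equiv.induct)
  case (base x y z w v)
  then show ?case using rel_deg by auto
qed (simp_all add: path_deg_cat)

text \<open>
  Reduces the commutation relations of a family over the quotient to the generating relations.
\<close>

lemma path_equiv_prod:
  fixes S :: "'e \<Rightarrow> 'u::monoid_mult"
  assumes "\<And>x y z w v. R x y z w \<Longrightarrow> is_path G ([x, y], v) \<Longrightarrow> is_path G ([z, w], v) \<Longrightarrow>
      S x * S y = S z * S w"
  shows "path_equiv G R p q \<Longrightarrow> prod_list (map S (fst p)) = prod_list (map S (fst q))"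
proof (induction rule: path_equiv.induct)
  case (base x y z w v)
  then show ?case using assms[of x y z w v] by simp
next
  case (cat p1 q1 p2 q2)
  then show ?case by (cases p1; cases q1; cases p2; cases q2) simp
qed simp_all

lemma path_class_eq_iff:
  assumes "is_path G p" shows "path_class G R p = path_class G R q \<longleftrightarrow> path_equiv G R p q"
proof
  assume "path_class G R p = path_class G R q"
  moreover have "p \<in> path_class G R p" using assms by (simp add: path_class_def path_equiv.refl)
  ultimately show "path_equiv G R p q" by (auto simp: path_class_def intro: path_equiv.sym)
next
  assume "path_equiv G R p q"
  then have "path_equiv G R p r \<longleftrightarrow> path_equiv G R q r" for r
    using path_equiv.trans[of G R] path_equiv.sym[of G R] by metis
  then show "path_class G R p = path_class G R q" by (simp add: path_class_def)
qed

lemma path_class_short: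
  assumes "is_path G p" "length (fst p) \<le> 1" shows "path_class G R p = {p}"
  using assms path_equiv_short[of p] by (auto simp: path_class_def intro: path_equiv.refl)

lemma path_class_vertex: "v \<in> gverts G \<Longrightarrow> path_class G R ([], v) = vclass v"
  by (simp add: path_class_short vclass_def)

lemma is_path_edge: "e \<in> gedges G \<Longrightarrow> is_path G ([e], gsrc G e)"
  by (simp add: edge_src)

lemma path_class_edge: "e \<in> gedges G \<Longrightarrow> path_class G R ([e], gsrc G e) = eclass e"
  using path_class_short[OF is_path_edge] by (simp add: eclass_def)

lemma Mor_Quot: "Mor Quot = path_class G R ` {p. is_path G p}"
  by (auto simp: path_quotient_def quotient_def path_class_def image_def)

lemma deg_Quot: "is_path G p \<Longrightarrow> deg Quot (path_class G R p) = path_deg G p"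
proof -
  assume p: "is_path G p"
  have "p \<in> path_class G R p" using p by (simp add: path_class_def path_equiv.refl)
  moreover have "path_deg G q = path_deg G p" if "q \<in> path_class G R p" for q
    using that path_equiv_deg[of p q] by (simp add: path_class_def)
  ultimately have "path_deg G ` path_class G R p = {path_deg G p}" by blast
  then show ?thesis by (simp add: path_quotient_def)
qed

lemma abs_deg_path: "is_path G (xs, v) \<Longrightarrow> abs_deg (path_deg G (xs, v)) = length xs"
  by (induction xs) (auto simp: abs_deg_add edge_deg)

lemma of_degree_Quot: "of_degree Quot n = path_class G R ` {p. is_path G p \<and> path_deg G p = n}"
  using deg_Quot by (auto simp: of_degree_def Mor_Quot)

lemma is_path_single: "is_path G ([e], v) \<longleftrightarrow> e \<in> gedges G \<and> v = gsrc G e"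
  using edge_src by auto

lemma kverts_Quot: "kverts Quot = vclass ` gverts G"
proof -
  have "{p. is_path G p \<and> path_deg G p = 0} = (\<lambda>v. ([], v)) ` gverts G"
    using abs_deg_path by (force simp: image_iff)
  then show ?thesis by (simp add: of_degree_Quot image_image path_class_vertex)
qed

lemma edge_paths: "{p. is_path G p \<and> length (fst p) = 1 \<and> D (path_deg G p)} =
    (\<lambda>e. ([e], gsrc G e)) ` {e \<in> gedges G. D (gdeg G e)}"
proof -
  have "p \<in> (\<lambda>e. ([e], gsrc G e)) ` {e \<in> gedges G. D (gdeg G e)}"
    if p: "is_path G p" "length (fst p) = 1" "D (path_deg G p)" for p
  proof -
    obtain e v where "p = ([e], v)" using p(2) by (cases p) (auto simp: length_Suc_conv)
    then show ?thesis using p is_path_single[of e v] by auto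
  qed
  then show ?thesis using is_path_edge by auto
qed

lemma of_degree_axis_Quot:
  "of_degree Quot (axis i 1) = eclass ` {e \<in> gedges G. gdeg G e = axis i 1}"
proof -
  have "{p. is_path G p \<and> path_deg G p = axis i 1} =
      {p. is_path G p \<and> length (fst p) = 1 \<and> path_deg G p = axis i 1}"
    using abs_deg_path abs_deg_axis[of i] by (metis prod.collapse)
  then show ?thesis
    using edge_paths[of "\<lambda>n. n = axis i 1"] by (simp add: of_degree_Quot image_image path_class_edge)
qed

lemma kedges_Quot: "kedges Quot = eclass ` gedges G"
proof -
  have "kedges Quot = path_class G R ` {p. is_path G p \<and> abs_deg (path_deg G p) = 1}"
    using deg_Quot by (auto simp: kedges_def Mor_Quot)
  also have "{p. is_path G p \<and> abs_deg (path_deg G p) = 1} =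
      {p. is_path G p \<and> length (fst p) = 1 \<and> abs_deg (path_deg G p) = 1}"
    using abs_deg_path by (metis prod.collapse)
  also have "\<dots> = (\<lambda>e. ([e], gsrc G e)) ` gedges G"
    using edge_paths[of "\<lambda>n. abs_deg n = 1"] edge_deg by auto
  finally show ?thesis by (simp add: image_image path_class_edge)
qed

lemma rng_src_Quot:
  assumes "e \<in> gedges G"
  shows "rng Quot (eclass e) = vclass (grng G e)" "src Quot (eclass e) = vclass (gsrc G e)"
  using assms by (simp_all add: path_quotient_def eclass_def path_class_vertex edge_src edge_rng)

lemma cmp_Quot: "cmp Quot (eclass x) (eclass y) = path_class G R ([x, y], gsrc G y)"
  by (simp add: path_quotient_def eclass_def)

lemma inj_vclass: "vclass v = vclass w \<longleftrightarrow> v = w"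
  by (simp add: vclass_def)

lemma inj_eclass: "eclass x = eclass y \<longleftrightarrow> x = y"
  by (auto simp: eclass_def)

lemma commutes_Quot:
  assumes "x \<in> gedges G" "y \<in> gedges G" "z \<in> gedges G" "w \<in> gedges G"
  shows "commutes Quot (eclass x) (eclass y) (eclass z) (eclass w) \<longleftrightarrow>
    gsrc G x = grng G y \<and> gsrc G z = grng G w \<and> path_equiv G R ([x, y], gsrc G y) ([z, w], gsrc G w)"
proof -
  have "path_class G R ([x, y], gsrc G y) = path_class G R ([z, w], gsrc G w) \<longleftrightarrow>
      path_equiv G R ([x, y], gsrc G y) ([z, w], gsrc G w)" if "gsrc G x = grng G y"
    by (rule path_class_eq_iff) (use that assms edge_src in auto)
  then show ?thesis
    using assms by (auto simp: commutes_def kedges_Quot rng_src_Quot inj_vclass cmp_Quot)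
qed

definition graph_ck :: "('v \<Rightarrow> 'u::unital_cstar) \<Rightarrow> ('e \<Rightarrow> 'u) \<Rightarrow> bool" where
  "graph_ck Q S \<longleftrightarrow>
     (\<forall>v\<in>gverts G. adj (Q v) = Q v \<and> Q v * Q v = Q v) \<and>
     (\<forall>v\<in>gverts G. \<forall>w\<in>gverts G. v \<noteq> w \<longrightarrow> Q v * Q w = 0) \<and>
     (\<forall>x y z w v. R x y z w \<and> is_path G ([x, y], v) \<and> is_path G ([z, w], v) \<longrightarrow>
        S x * S y = S z * S w) \<and>
     (\<forall>e\<in>gedges G. adj (S e) * S e = Q (gsrc G e)) \<and>
     (\<forall>v\<in>gverts G. \<forall>i.
        Q v = (\<Sum>e \<in> {e \<in> gedges G. gdeg G e = axis i 1 \<and> grng G e = v}. S e * adj (S e)))"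

lemma ck_typed_Quot: "ck_typed Quot Q S \<longleftrightarrow> graph_ck (\<lambda>v. Q (vclass v)) (\<lambda>e. S (eclass e))"
proof -
  have sum: "(\<Sum>e \<in> {e \<in> of_degree Quot (axis i 1). rng Quot e = vclass v}. S e * adj (S e)) =
     (\<Sum>e \<in> {e \<in> gedges G. gdeg G e = axis i 1 \<and> grng G e = v}. S (eclass e) * adj (S (eclass e)))" for i v
  proof -
    have "{e \<in> of_degree Quot (axis i 1). rng Quot e = vclass v} =
        eclass ` {e \<in> gedges G. gdeg G e = axis i 1 \<and> grng G e = v}"
      unfolding of_degree_axis_Quot by (auto simp: rng_src_Quot inj_vclass)
    moreover have "inj_on eclass E" for E by (simp add: inj_on_def inj_eclass)
    ultimately show ?thesis by (simp add: sum.reindex)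
  qed
  have rel: "(\<forall>a b f g. commutes Quot a f g b \<longrightarrow> S a * S f = S g * S b) \<longleftrightarrow>
     (\<forall>x y z w v. R x y z w \<and> is_path G ([x, y], v) \<and> is_path G ([z, w], v) \<longrightarrow>
        S (eclass x) * S (eclass y) = S (eclass z) * S (eclass w))" (is "?L \<longleftrightarrow> ?R")
  proof
    assume L: ?L
    show ?R
    proof (intro allI impI)
      fix x y z w v assume *: "R x y z w \<and> is_path G ([x, y], v) \<and> is_path G ([z, w], v)"
      then have e: "x \<in> gedges G" "y \<in> gedges G" "z \<in> gedges G" "w \<in> gedges G"
        "gsrc G x = grng G y" "gsrc G z = grng G w" "v = gsrc G y" "v = gsrc G w" by auto
      have "path_equiv G R ([x, y], v) ([z, w], v)" using * by (intro path_equiv.base) auto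
      then have "commutes Quot (eclass x) (eclass y) (eclass z) (eclass w)"
        using e commutes_Quot[OF e(1-4)] by simp
      then show "S (eclass x) * S (eclass y) = S (eclass z) * S (eclass w)" using L by blast
    qed
  next
    assume ?R
    then have P: "prod_list (map (\<lambda>e. S (eclass e)) (fst p)) = prod_list (map (\<lambda>e. S (eclass e)) (fst q))"
      if "path_equiv G R p q" for p q
      using path_equiv_prod[of "\<lambda>e. S (eclass e)" p q] that by blast
    show ?L
    proof (intro allI impI)
      fix a b f g assume c: "commutes Quot a f g b"
      then obtain x y z w where e: "a = eclass x" "f = eclass y" "g = eclass z" "b = eclass w"
        "x \<in> gedges G" "y \<in> gedges G" "z \<in> gedges G" "w \<in> gedges G"
        by (auto simp: commutes_def kedges_Quot)
      then have "path_equiv G R ([x, y], gsrc G y) ([z, w], gsrc G w)"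
        using c commutes_Quot by blast
      from P[OF this] show "S a * S f = S g * S b" by (simp add: e)
    qed
  qed
  have src: "(\<forall>e\<in>kedges Quot. adj (S e) * S e = Q (src Quot e)) \<longleftrightarrow>
      (\<forall>e\<in>gedges G. adj (S (eclass e)) * S (eclass e) = Q (vclass (gsrc G e)))"
    by (simp add: kedges_Quot rng_src_Quot)
  show ?thesis
    unfolding ck_typed_def graph_ck_def rel src by (simp add: kverts_Quot sum inj_vclass del: One_nat_def)
qed

lemma src_Quot_kverts: "e \<in> kedges Quot \<Longrightarrow> src Quot e \<in> kverts Quot"
  using edge_src by (auto simp: kedges_Quot kverts_Quot rng_src_Quot)

end

section \<open>The delayed graph\<close>

text \<open>
  Relations (CK3) and (CK4) at one vertex: the range projections are dominated by the vertex
  projection and mutually orthogonal.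
\<close>

lemma finite_range_projections:
  fixes t p :: "'i \<Rightarrow> 'u::unital_cstar"
  assumes fin: "finite I" and t: "\<And>i. i \<in> I \<Longrightarrow> adj (t i) * t i = p i \<and> adj (p i) = p i \<and> p i * p i = p i"
    and q: "q = (\<Sum>i\<in>I. t i * adj (t i))" "q * q = q" and i: "i \<in> I"
  shows "q * t i = t i" and "k \<in> I \<Longrightarrow> i \<noteq> k \<Longrightarrow> adj (t i) * t k = 0"
proof -
  have tp: "t i * p i = t i" if "i \<in> I" for i
    using t[OF that] by (intro partial_isometry_of_source[of "p i" "t i"]) auto
  have ttt: "t i * (adj (t i) * t i) = t i" if "i \<in> I" for i using tp[OF that] t[OF that] by simp
  have pr: "adj (t i * adj (t i)) = t i * adj (t i) \<and> (t i * adj (t i)) * (t i * adj (t i)) = t i * adj (t i)"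
    if "i \<in> I" for i
    using ttt[OF that] by (metis adj_adj adj_mult mult.assoc)
  note orth = orthogonal_of_sum_projection[where p = "\<lambda>i. t i * adj (t i)" and I = I,
      OF fin pr, folded q(1), OF _ q(2) i]
  have "q * (t i * adj (t i)) = t i * adj (t i)" by (rule orth(1))
  then show "q * t i = t i" by (metis mult.assoc ttt[OF i])
  show "adj (t i) * t k = 0" if k: "k \<in> I" "i \<noteq> k"
  proof -
    have z: "t i * adj (t i) * (t k * adj (t k)) = 0" by (rule orth(2)) (use k in auto)
    have a: "adj (t i) * (t i * adj (t i)) = adj (t i)"
      using arg_cong[OF ttt[OF i], of adj] by (simp add: mult.assoc)
    have "adj (t i) * t k = (adj (t i) * (t i * adj (t i))) * (t k * (adj (t k) * t k))"
      by (simp only: a ttt[OF k(1)])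
    also have "\<dots> = adj (t i) * (t i * adj (t i) * (t k * adj (t k))) * t k"
      by (simp only: mult.assoc)
    finally show ?thesis unfolding z by simp
  qed
qed

locale delayed =
  fixes \<Lambda> :: "('m, 'k::finite) kgraph" and f :: 'm
  assumes kg: "k_graph \<Lambda>" and rf: "row_finite \<Lambda>" and f: "f \<in> kedges \<Lambda>"
begin

lemma category: "is_category \<Lambda>" and deg_fun: "degree_functor \<Lambda>" and factor: "factorization_rule \<Lambda>"
  and countable_Mor: "countable (Mor \<Lambda>)"
  using kg by (auto simp: k_graph_def)

lemma endpoints:
  assumes "\<kappa> \<in> Mor \<Lambda>"
  shows "rng \<Lambda> \<kappa> \<in> kverts \<Lambda>" "src \<Lambda> \<kappa> \<in> kverts \<Lambda>"
  using assms category deg_fun by (auto simp: is_category_def degree_functor_def of_degree_def)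

lemma composite:
  assumes "\<mu> \<in> Mor \<Lambda>" "\<nu> \<in> Mor \<Lambda>" "src \<Lambda> \<mu> = rng \<Lambda> \<nu>"
  shows "cmp \<Lambda> \<mu> \<nu> \<in> Mor \<Lambda>" "rng \<Lambda> (cmp \<Lambda> \<mu> \<nu>) = rng \<Lambda> \<mu>" "src \<Lambda> (cmp \<Lambda> \<mu> \<nu>) = src \<Lambda> \<nu>"
    "deg \<Lambda> (cmp \<Lambda> \<mu> \<nu>) = deg \<Lambda> \<mu> + deg \<Lambda> \<nu>"
  using assms category deg_fun by (auto simp: is_category_def degree_functor_def)

lemma factor_unique:
  assumes m: "\<mu> \<in> Mor \<Lambda>" "\<nu> \<in> Mor \<Lambda>" "src \<Lambda> \<mu> = rng \<Lambda> \<nu>" "\<mu>' \<in> Mor \<Lambda>" "\<nu>' \<in> Mor \<Lambda>" "src \<Lambda> \<mu>' = rng \<Lambda> \<nu>'"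
    and eq: "cmp \<Lambda> \<mu> \<nu> = cmp \<Lambda> \<mu>' \<nu>'" "deg \<Lambda> \<mu> = deg \<Lambda> \<mu>'"
  shows "\<mu> = \<mu>'" "\<nu> = \<nu>'"
proof -
  have d: "deg \<Lambda> (cmp \<Lambda> \<mu> \<nu>) = deg \<Lambda> \<nu> + deg \<Lambda> \<mu>" using composite(4)[OF m(1-3)] by (simp add: add.commute)
  have dn: "deg \<Lambda> \<nu> = deg \<Lambda> \<nu>'" using composite(4)[OF m(1-3)] composite(4)[OF m(4-6)] eq by simp
  have "\<exists>!(x, y). x \<in> of_degree \<Lambda> (deg \<Lambda> \<mu>) \<and> y \<in> of_degree \<Lambda> (deg \<Lambda> \<nu>) \<and> src \<Lambda> x = rng \<Lambda> y \<and>
      cmp \<Lambda> x y = cmp \<Lambda> \<mu> \<nu>"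
    using factor composite(1)[OF m(1-3)] d unfolding factorization_rule_def by blast
  then have "(\<mu>, \<nu>) = (\<mu>', \<nu>')"
    by (rule ex1E) (use m eq dn in \<open>auto simp: of_degree_def\<close>)
  then show "\<mu> = \<mu>'" "\<nu> = \<nu>'" by auto
qed

lemma factor_exists:
  assumes "\<kappa> \<in> Mor \<Lambda>" "deg \<Lambda> \<kappa> = n + m"
  shows "\<exists>\<mu> \<nu>. \<mu> \<in> of_degree \<Lambda> m \<and> \<nu> \<in> of_degree \<Lambda> n \<and> src \<Lambda> \<mu> = rng \<Lambda> \<nu> \<and> cmp \<Lambda> \<mu> \<nu> = \<kappa>"
proof -
  have "\<exists>!(x, y). x \<in> of_degree \<Lambda> m \<and> y \<in> of_degree \<Lambda> n \<and> src \<Lambda> x = rng \<Lambda> y \<and> cmp \<Lambda> x y = \<kappa>"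
    using factor assms unfolding factorization_rule_def by blast
  then show ?thesis by (auto dest!: ex1_implies_ex)
qed

abbreviation "d \<equiv> deg \<Lambda> f"
abbreviation "N \<equiv> other_deg \<Lambda> f"
abbreviation "D \<equiv> delay_edges \<Lambda> f"
abbreviation "G \<equiv> delay_graph \<Lambda> f"

lemma abs_deg_d: "abs_deg d = 1"
  using f by (simp add: kedges_def)

lemma N_axis: "n \<in> N \<longleftrightarrow> abs_deg n = 1 \<and> n \<noteq> d"
  using abs_deg_eq_1[of n] by (auto simp: other_deg_def simp del: One_nat_def)

lemma edge_degree:
  assumes "abs_deg n = 1" shows "e \<in> of_degree \<Lambda> n \<Longrightarrow> e \<in> kedges \<Lambda>"
  using assms by (simp add: of_degree_def kedges_def)

lemma kedges_degree: "e \<in> kedges \<Lambda> \<longleftrightarrow> e \<in> Mor \<Lambda> \<and> (deg \<Lambda> e = d \<or> deg \<Lambda> e \<in> N)"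
  using abs_deg_d by (auto simp: kedges_def N_axis)

lemma square_iff:
  assumes "n \<in> N"
  shows "square \<Lambda> f n \<alpha> b g h a \<longleftrightarrow>
    a \<in> of_degree \<Lambda> n \<and> b \<in> of_degree \<Lambda> n \<and> g \<in> of_degree \<Lambda> d \<and> h \<in> of_degree \<Lambda> d \<and>
    src \<Lambda> b = rng \<Lambda> g \<and> src \<Lambda> h = rng \<Lambda> a \<and> cmp \<Lambda> b g = \<alpha> \<and> cmp \<Lambda> h a = \<alpha>"
  using assms edge_degree[of n] edge_degree[OF abs_deg_d]
  by (auto simp: square_def commutes_def N_axis)

lemma square_commutes: "square \<Lambda> f n \<alpha> b g h a \<Longrightarrow> commutes \<Lambda> b g h a"
  by (simp add: square_def)

lemma square_from_bg:
  assumes "n \<in> N" "b \<in> of_degree \<Lambda> n" "g \<in> of_degree \<Lambda> d" "src \<Lambda> b = rng \<Lambda> g"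
  shows "\<exists>h a. square \<Lambda> f n (cmp \<Lambda> b g) b g h a"
proof -
  have "cmp \<Lambda> b g \<in> Mor \<Lambda>" "deg \<Lambda> (cmp \<Lambda> b g) = n + d"
    using assms composite[of b g] by (auto simp: of_degree_def)
  from factor_exists[OF this] show ?thesis using assms by (auto simp: square_iff)
qed

lemma square_from_ha:
  assumes "n \<in> N" "a \<in> of_degree \<Lambda> n" "h \<in> of_degree \<Lambda> d" "src \<Lambda> h = rng \<Lambda> a"
  shows "\<exists>b g. square \<Lambda> f n (cmp \<Lambda> h a) b g h a"
proof -
  have "cmp \<Lambda> h a \<in> Mor \<Lambda>" "deg \<Lambda> (cmp \<Lambda> h a) = d + n"
    using assms composite[of h a] by (auto simp: of_degree_def)
  from factor_exists[OF this] show ?thesis using assms by (auto simp: square_iff)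
qed

lemma square_deg:
  assumes "n \<in> N" "square \<Lambda> f n \<alpha> b g h a" shows "deg \<Lambda> \<alpha> = n + d"
  using assms composite(4)[of b g] by (auto simp: square_iff of_degree_def)

lemma square_unique:
  assumes "n \<in> N" "square \<Lambda> f n \<alpha> b g h a" "n' \<in> N" "square \<Lambda> f n' \<alpha> b' g' h' a'"
  shows "n' = n" "b' = b" "g' = g" "h' = h" "a' = a"
proof -
  show n: "n' = n" using square_deg[OF assms(1,2)] square_deg[OF assms(3,4)] by simp
  note s = assms(2)[unfolded square_iff[OF assms(1)]] assms(4)[unfolded n square_iff[OF assms(1)]]
  show "b' = b" "g' = g" using factor_unique[of b' g' b g] s by (auto simp: of_degree_def)
  show "h' = h" "a' = a" using factor_unique[of h' a' h a] s by (auto simp: of_degree_def)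
qed

lemma delay_level_degree: "g \<in> delay_level \<Lambda> f i \<Longrightarrow> g \<in> of_degree \<Lambda> d"
  using f by (cases i) (auto simp: of_degree_def kedges_def)

lemma D_degree: "g \<in> D \<Longrightarrow> g \<in> of_degree \<Lambda> d"
  using delay_level_degree by (auto simp: delay_edges_def)

lemma D_Mor: "g \<in> D \<Longrightarrow> g \<in> Mor \<Lambda>" and D_deg: "g \<in> D \<Longrightarrow> deg \<Lambda> g = d"
  and D_kedges: "g \<in> D \<Longrightarrow> g \<in> kedges \<Lambda>"
  using D_degree edge_degree[OF abs_deg_d] by (auto simp: of_degree_def)

lemma D_opposite:
  assumes "g \<in> D" "opposite_in_square \<Lambda> f g e" "e \<in> of_degree \<Lambda> d" shows "e \<in> D"
proof -
  obtain i where "g \<in> delay_level \<Lambda> f i" using assms(1) by (auto simp: delay_edges_def)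
  then have "e \<in> delay_level \<Lambda> f (Suc i)" using assms by auto
  then show ?thesis unfolding delay_edges_def by blast
qed

lemma D_square:
  assumes n: "n \<in> N" and s: "square \<Lambda> f n \<alpha> b g h a" shows "g \<in> D \<longleftrightarrow> h \<in> D"
proof -
  note s' = s[unfolded square_iff[OF n]] square_commutes[OF s]
  have c: "commutes \<Lambda> h a b g" using s' by (auto simp: commutes_def)
  show ?thesis
  proof
    assume "g \<in> D"
    then show "h \<in> D"
      by (rule D_opposite) (use s' n in \<open>auto simp: opposite_in_square_def\<close>)
  next
    assume "h \<in> D"
    then show "g \<in> D"
      by (rule D_opposite) (use s' c n in \<open>auto simp: opposite_in_square_def\<close>)
  qed
qed

text \<open>
  The set of delayed edges is closed under passing to the opposite side of a square, so both sides of
  the squares considered here are delayed.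
\<close>

lemma delay_squares_iff:
  assumes n: "n \<in> N"
  shows "\<alpha> \<in> delay_squares \<Lambda> f n \<longleftrightarrow> (\<exists>b g h a. square \<Lambda> f n \<alpha> b g h a \<and> g \<in> D \<and> h \<in> D)"
proof
  assume "\<alpha> \<in> delay_squares \<Lambda> f n"
  then obtain h a where ha: "\<alpha> = cmp \<Lambda> h a" "h \<in> D" "a \<in> of_degree \<Lambda> n" "src \<Lambda> h = rng \<Lambda> a"
    by (auto simp: delay_squares_def)
  then obtain b g where "square \<Lambda> f n \<alpha> b g h a" using square_from_ha[OF n] D_degree by blast
  then show "\<exists>b g h a. square \<Lambda> f n \<alpha> b g h a \<and> g \<in> D \<and> h \<in> D" using ha D_square[OF n] by blast
next
  assume "\<exists>b g h a. square \<Lambda> f n \<alpha> b g h a \<and> g \<in> D \<and> h \<in> D"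
  then obtain b g h a where "square \<Lambda> f n \<alpha> b g h a" "h \<in> D" by blast
  then have "\<alpha> = cmp \<Lambda> h a \<and> h \<in> D \<and> a \<in> of_degree \<Lambda> n \<and> src \<Lambda> h = rng \<Lambda> a"
    by (simp add: square_iff[OF n])
  then show "\<alpha> \<in> delay_squares \<Lambda> f n" unfolding delay_squares_def by blast
qed

lemma EdgeSq_edge:
  "EdgeSq \<alpha> \<in> gedges G \<longleftrightarrow> (\<exists>n\<in>N. \<exists>b g h a. square \<Lambda> f n \<alpha> b g h a \<and> g \<in> D \<and> h \<in> D)"
proof -
  have "EdgeSq \<alpha> \<in> gedges G \<longleftrightarrow> (\<exists>n\<in>N. \<alpha> \<in> delay_squares \<Lambda> f n)" by (auto simp: delay_graph_def)
  then show ?thesis using delay_squares_iff by blast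
qed

lemma EdgeSq_ends:
  assumes n: "n \<in> N" and s: "square \<Lambda> f n \<alpha> b g h a" and g: "g \<in> D"
  shows "gsrc G (EdgeSq \<alpha>) = NewV g" "grng G (EdgeSq \<alpha>) = NewV h" "gdeg G (EdgeSq \<alpha>) = n"
    "EdgeSq \<alpha> \<in> gedges G"
proof -
  have "(THE g. \<exists>n\<in>N. \<exists>b h a. square \<Lambda> f n \<alpha> b g h a) = g"
    using n s square_unique[OF n s] by (intro the_equality) blast+
  then show "gsrc G (EdgeSq \<alpha>) = NewV g" by (simp add: delay_graph_def)
  have "(THE h. \<exists>n\<in>N. \<exists>b g a. square \<Lambda> f n \<alpha> b g h a) = h"
    using n s square_unique[OF n s] by (intro the_equality) blast+
  then show "grng G (EdgeSq \<alpha>) = NewV h" by (simp add: delay_graph_def)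
  have h: "h \<in> D" using D_square[OF n s] g by simp
  have "(THE m. m \<in> N \<and> \<alpha> \<in> delay_squares \<Lambda> f m) = n"
  proof (rule the_equality)
    show "n \<in> N \<and> \<alpha> \<in> delay_squares \<Lambda> f n" using n s g h delay_squares_iff by blast
    show "m = n" if "m \<in> N \<and> \<alpha> \<in> delay_squares \<Lambda> f m" for m
      using that delay_squares_iff square_unique(1)[OF n s] by blast
  qed
  then show "gdeg G (EdgeSq \<alpha>) = n" by (simp add: delay_graph_def)
  show "EdgeSq \<alpha> \<in> gedges G" using n s g h EdgeSq_edge by blast
qed

lemma G_simps [simp]:
  "OldE e \<in> gedges G \<longleftrightarrow> e \<in> kedges \<Lambda> \<and> e \<notin> D"
  "Edge1 g \<in> gedges G \<longleftrightarrow> g \<in> D" "Edge2 g \<in> gedges G \<longleftrightarrow> g \<in> D"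
  "gsrc G (OldE e) = OldV (src \<Lambda> e)" "grng G (OldE e) = OldV (rng \<Lambda> e)" "gdeg G (OldE e) = deg \<Lambda> e"
  "gsrc G (Edge1 g) = OldV (src \<Lambda> g)" "grng G (Edge1 g) = NewV g" "gdeg G (Edge1 g) = d"
  "gsrc G (Edge2 g) = NewV g" "grng G (Edge2 g) = OldV (rng \<Lambda> g)" "gdeg G (Edge2 g) = d"
  "OldV v \<in> gverts G \<longleftrightarrow> v \<in> kverts \<Lambda>" "NewV g \<in> gverts G \<longleftrightarrow> g \<in> D"
  by (auto simp: delay_graph_def)

lemma gedges_cases:
  assumes "x \<in> gedges G"
  obtains (OldE) e where "x = OldE e" "e \<in> kedges \<Lambda>" "e \<notin> D"
  | (Edge1) g where "x = Edge1 g" "g \<in> D"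
  | (Edge2) g where "x = Edge2 g" "g \<in> D"
  | (EdgeSq) n \<alpha> b g h a where "x = EdgeSq \<alpha>" "n \<in> N" "square \<Lambda> f n \<alpha> b g h a" "g \<in> D" "h \<in> D"
  using assms EdgeSq_edge by (cases x) (auto intro: that)

lemma gverts_cases:
  assumes "v \<in> gverts G"
  obtains (OldV) w where "v = OldV w" "w \<in> kverts \<Lambda>" | (NewV) g where "v = NewV g" "g \<in> D"
  using assms by (cases v) auto

lemma EdgeSq_deg: "EdgeSq \<alpha> \<in> gedges G \<Longrightarrow> gdeg G (EdgeSq \<alpha>) + d = deg \<Lambda> \<alpha>"
  using EdgeSq_edge EdgeSq_ends(3) square_deg by metis

lemma kedges_Mor: "e \<in> kedges \<Lambda> \<Longrightarrow> e \<in> Mor \<Lambda>"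
  by (simp add: kedges_def)

lemma commutes_deg: "commutes \<Lambda> x y z w \<Longrightarrow> deg \<Lambda> x + deg \<Lambda> y = deg \<Lambda> z + deg \<Lambda> w"
  using composite(4)[of x y] composite(4)[of z w] kedges_Mor by (auto simp: commutes_def)

sublocale graded_graph G "delay_rel \<Lambda> f"
proof
  fix x assume x: "x \<in> gedges G"
  have "abs_deg (gdeg G x) = 1 \<and> gsrc G x \<in> gverts G \<and> grng G x \<in> gverts G"
    using x
  proof (cases rule: gedges_cases)
    case (OldE e)
    then show ?thesis using endpoints[OF kedges_Mor[OF OldE(2)]] by (simp add: kedges_def)
  next
    case (Edge1 g)
    then show ?thesis using endpoints(2)[OF D_Mor[OF Edge1(2)]] abs_deg_d by simp
  next
    case (Edge2 g)
    then show ?thesis using endpoints(1)[OF D_Mor[OF Edge2(2)]] abs_deg_d by simp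
  next
    case (EdgeSq n \<alpha> b g h a)
    then show ?thesis using EdgeSq_ends[OF EdgeSq(2-4)] N_axis[of n] by simp
  qed
  then show "abs_deg (gdeg G x) = 1" "gsrc G x \<in> gverts G" "grng G x \<in> gverts G" by auto
next
  fix x y z w v assume "delay_rel \<Lambda> f x y z w" "is_path G ([x, y], v)" "is_path G ([z, w], v)"
  then show "gdeg G x + gdeg G y = gdeg G z + gdeg G w"
  proof (cases rule: delay_rel.cases)
    case (old x y z w)
    then show ?thesis using commutes_deg by simp
  next
    case (square_out n \<alpha> b g h a)
    then show ?thesis using EdgeSq_ends(3)[of n \<alpha> b g h a] square_iff[of n] by (auto simp: of_degree_def add.commute)
  next
    case (square_in n \<alpha> b g h a)
    then show ?thesis using EdgeSq_ends(3)[of n \<alpha> b g h a] square_iff[of n] by (auto simp: of_degree_def add.commute)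
  next
    case (cube n m \<alpha> \<beta> b h g a c l d' b' c' l' d'')
    have e: "EdgeSq (cmp \<Lambda> b' l') \<in> gedges G" "EdgeSq (cmp \<Lambda> c' h) \<in> gedges G"
      using \<open>is_path G ([z, w], v)\<close> cube by auto
    have "deg \<Lambda> (cmp \<Lambda> c' h) = m + d"
      using cube composite(4)[of c' h] by (auto simp: of_degree_def commutes_def square_def)
    moreover have "deg \<Lambda> (cmp \<Lambda> b' l') = n + d"
    proof -
      have "src \<Lambda> b' = rng \<Lambda> l'"
      proof -
        have "src \<Lambda> b' = rng \<Lambda> c'" "rng \<Lambda> (cmp \<Lambda> c' h) = rng \<Lambda> (cmp \<Lambda> l' d'')"
          using cube by (auto simp: commutes_def)
        then show ?thesis
          using cube composite(2)[of c' h] composite(2)[of l' d''] D_Mor[of h] by (auto simp: of_degree_def commutes_def)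
      qed
      then show ?thesis using cube composite(4)[of b' l'] by (auto simp: of_degree_def)
    qed
    ultimately have "gdeg G (EdgeSq (cmp \<Lambda> b' l')) = n" "gdeg G (EdgeSq (cmp \<Lambda> c' h)) = m"
      using EdgeSq_deg[OF e(1)] EdgeSq_deg[OF e(2)] by auto
    moreover have "gdeg G (EdgeSq \<alpha>) = n" "gdeg G (EdgeSq \<beta>) = m"
      using cube EdgeSq_ends(3) by auto
    ultimately show ?thesis using cube by (simp add: add.commute)
  qed
qed

lemma delay_eq: "delay \<Lambda> f = path_quotient G (delay_rel \<Lambda> f)"
  by (simp add: delay_def)

text \<open>The edges of the delayed graph with a given range and degree.\<close>

definition outer :: "'m \<Rightarrow> 'm delay_edge" where
  "outer e = (if e \<in> D then Edge2 e else OldE e)"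

lemma edges_to_old:
  "{x \<in> gedges G. gdeg G x = axis i 1 \<and> grng G x = OldV v} =
     outer ` {e \<in> of_degree \<Lambda> (axis i 1). rng \<Lambda> e = v}"
proof -
  have "x \<in> outer ` {e \<in> of_degree \<Lambda> (axis i 1). rng \<Lambda> e = v}"
    if x: "x \<in> gedges G" "gdeg G x = axis i 1" "grng G x = OldV v" for x
    using x(1)
  proof (cases rule: gedges_cases)
    case (OldE e)
    then have "e \<in> of_degree \<Lambda> (axis i 1)" "rng \<Lambda> e = v" "x = outer e"
      using x kedges_Mor by (auto simp: of_degree_def outer_def)
    then show ?thesis by blast
  next
    case (Edge2 e)
    then have "e \<in> of_degree \<Lambda> (axis i 1)" "rng \<Lambda> e = v" "x = outer e"
      using x D_degree by (auto simp: outer_def)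
    then show ?thesis by blast
  qed (use x EdgeSq_ends in auto)
  moreover have "outer e \<in> gedges G \<and> gdeg G (outer e) = axis i 1 \<and> grng G (outer e) = OldV (rng \<Lambda> e)"
    if "e \<in> of_degree \<Lambda> (axis i 1)" for e
    using that D_deg[of e] of_degree_axis_kedges[OF that] by (auto simp: outer_def of_degree_def)
  ultimately show ?thesis by blast
qed

lemma inj_outer: "inj_on outer E"
  by (auto simp: inj_on_def outer_def split: if_splits)

lemma edges_to_new_d:
  assumes "axis i 1 = d" "h \<in> D"
  shows "{x \<in> gedges G. gdeg G x = axis i 1 \<and> grng G x = NewV h} = {Edge1 h}"
proof -
  have "x = Edge1 h" if x: "x \<in> gedges G" "gdeg G x = axis i 1" "grng G x = NewV h" for x
    using x(1) by (cases rule: gedges_cases) (use x assms EdgeSq_ends N_axis in auto)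
  then show ?thesis using assms by auto
qed

lemma edges_to_new:
  assumes "axis i 1 \<noteq> d" "h \<in> D"
  shows "{x \<in> gedges G. gdeg G x = axis i 1 \<and> grng G x = NewV h} =
      (\<lambda>a. EdgeSq (cmp \<Lambda> h a)) ` {a \<in> of_degree \<Lambda> (axis i 1). rng \<Lambda> a = src \<Lambda> h}" (is "?L = ?R")
proof -
  have n: "axis i 1 \<in> N" using assms(1) abs_deg_axis[of i] by (simp add: N_axis del: abs_deg_axis)
  have "x \<in> ?R" if x: "x \<in> gedges G" "gdeg G x = axis i 1" "grng G x = NewV h" for x
    using x(1)
  proof (cases rule: gedges_cases)
    case (EdgeSq n' \<alpha> b g h' a)
    then have "n' = axis i 1" "h' = h" using x EdgeSq_ends(2,3)[OF EdgeSq(2-4)] by auto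
    then have "a \<in> of_degree \<Lambda> (axis i 1) \<and> rng \<Lambda> a = src \<Lambda> h \<and> x = EdgeSq (cmp \<Lambda> h a)"
      using EdgeSq square_iff[OF n] by auto
    then show ?thesis by blast
  qed (use x assms in auto)
  moreover have "EdgeSq (cmp \<Lambda> h a) \<in> ?L" if a: "a \<in> of_degree \<Lambda> (axis i 1)" "rng \<Lambda> a = src \<Lambda> h" for a
  proof -
    obtain b g where s: "square \<Lambda> f (axis i 1) (cmp \<Lambda> h a) b g h a"
      using square_from_ha[OF n a(1) D_degree[OF assms(2)]] a(2) by auto
    then have "g \<in> D" using D_square[OF n s] assms(2) by simp
    then show ?thesis using EdgeSq_ends[OF n s] by simp
  qed
  ultimately show ?thesis by blast
qed

lemma finite_row: "v \<in> kverts \<Lambda> \<Longrightarrow> finite {e \<in> of_degree \<Lambda> (axis i 1). rng \<Lambda> e = v}"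
  using rf by (simp add: row_finite_def)

lemma finite_row_G:
  assumes "v \<in> gverts G" shows "finite {x \<in> gedges G. gdeg G x = axis i 1 \<and> grng G x = v}"
  using assms
proof (cases rule: gverts_cases)
  case (OldV w)
  then show ?thesis unfolding OldV(1) edges_to_old by (intro finite_imageI finite_row)
next
  case (NewV h)
  show ?thesis
  proof (cases "axis i 1 = d")
    case True
    then show ?thesis unfolding NewV(1) edges_to_new_d[OF True NewV(2)] by simp
  next
    case False
    show ?thesis unfolding NewV(1) edges_to_new[OF False NewV(2)]
      using endpoints(2)[OF D_Mor[OF NewV(2)]] by (intro finite_imageI finite_row)
  qed
qed

end

section \<open>From the delayed graph to the original graph\<close>

text \<open>
  Two factorizations of a morphism into two edges have the same degrees, possibly in opposite order.
\<close>

lemma axis_sum_eq: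
  fixes a b c e :: "nat ^ 'k::finite"
  assumes "abs_deg a = 1" "abs_deg b = 1" "abs_deg c = 1" "abs_deg e = 1" "a + b = c + e" "a \<noteq> c"
  shows "e = a" "b = c"
proof -
  obtain i where i: "a = axis i 1" using abs_deg_eq_1[OF assms(1)] by blast
  obtain k where k: "c = axis k 1" using abs_deg_eq_1[OF assms(3)] by blast
  obtain l where l: "e = axis l 1" using abs_deg_eq_1[OF assms(4)] by blast
  have "i \<noteq> k" using assms(6) i k by auto
  have "(a + b) $ i = (c + e) $ i" using assms(5) by simp
  then have "l = i" using \<open>i \<noteq> k\<close> by (auto simp: i k l axis_def split: if_splits)
  then show "e = a" using i l by simp
  then show "b = c" using assms(5) by (simp add: add.commute)
qed

context delayed
begin

lemma graph_ckD:
  assumes "graph_ck Q S"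
  shows "v \<in> gverts G \<Longrightarrow> adj (Q v) = Q v" "v \<in> gverts G \<Longrightarrow> Q v * Q v = Q v"
    "v \<in> gverts G \<Longrightarrow> w \<in> gverts G \<Longrightarrow> v \<noteq> w \<Longrightarrow> Q v * Q w = 0"
    "delay_rel \<Lambda> f x y z w' \<Longrightarrow> is_path G ([x, y], u) \<Longrightarrow> is_path G ([z, w'], u) \<Longrightarrow> S x * S y = S z * S w'"
    "e \<in> gedges G \<Longrightarrow> adj (S e) * S e = Q (gsrc G e)"
    "v \<in> gverts G \<Longrightarrow>
      Q v = (\<Sum>e \<in> {e \<in> gedges G. gdeg G e = axis i 1 \<and> grng G e = v}. S e * adj (S e))"
  using assms unfolding graph_ck_def by blast+

lemma graph_ck_ends:
  assumes ck: "graph_ck Q S" and e: "e \<in> gedges G"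
  shows "S e * Q (gsrc G e) = S e" "Q (grng G e) * S e = S e"
proof -
  show "S e * Q (gsrc G e) = S e"
    by (rule partial_isometry_of_source) (use graph_ckD[OF ck] e edge_src in auto)
  obtain i where i: "gdeg G e = axis i 1" using abs_deg_eq_1[OF edge_deg[OF e]] by blast
  have v: "grng G e \<in> gverts G" using e by (rule edge_rng)
  have "adj (S x) * S x = Q (gsrc G x) \<and> adj (Q (gsrc G x)) = Q (gsrc G x) \<and>
      Q (gsrc G x) * Q (gsrc G x) = Q (gsrc G x)"
    if "x \<in> {x \<in> gedges G. gdeg G x = axis i 1 \<and> grng G x = grng G e}" for x
    using that graph_ckD(5)[OF ck] graph_ckD(1,2)[OF ck edge_src] by simp
  from finite_range_projections(1)[OF finite_row_G[OF v] this graph_ckD(6)[OF ck v] graph_ckD(2)[OF ck v]]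
  show "Q (grng G e) * S e = S e" using e i by blast
qed

definition inner_family :: "('m delay_edge \<Rightarrow> 'u::unital_cstar) \<Rightarrow> 'm \<Rightarrow> 'u" where
  "inner_family S e = (if e \<in> D then S (Edge2 e) * S (Edge1 e) else S (OldE e))"

lemma commutes_square:
  assumes c: "commutes \<Lambda> x y z w" and d: "deg \<Lambda> y = d" "deg \<Lambda> z = d" "deg \<Lambda> x \<noteq> d"
  shows "deg \<Lambda> x \<in> N" "square \<Lambda> f (deg \<Lambda> x) (cmp \<Lambda> x y) x y z w"
proof -
  show n: "deg \<Lambda> x \<in> N" using c d kedges_degree by (auto simp: commutes_def)
  have "deg \<Lambda> w = deg \<Lambda> x" using commutes_deg[OF c] d by (simp add: add.commute)
  then show "square \<Lambda> f (deg \<Lambda> x) (cmp \<Lambda> x y) x y z w"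
    using c d by (auto simp: square_def of_degree_def kedges_def commutes_def)
qed

text \<open>
  If \<open>y\<close> and \<open>z\<close> are delayed, the square \<open>x y = z w\<close> is traversed in two steps:
  \<open>x y\<^sup>2 y\<^sup>1 \<sim>\<^sub>D z\<^sup>2 e\<^sub>\<alpha> y\<^sup>1 \<sim>\<^sub>D z\<^sup>2 z\<^sup>1 w\<close>.
\<close>

lemma inner_family_square:
  assumes ck: "graph_ck Q S" and c: "commutes \<Lambda> x y z w"
    and d: "deg \<Lambda> y = d" "deg \<Lambda> z = d" "deg \<Lambda> x \<noteq> d"
  shows "inner_family S x * inner_family S y = inner_family S z * inner_family S w"
proof -
  let ?\<alpha> = "cmp \<Lambda> x y"
  note n = commutes_square[OF c d]
  have e: "x \<in> kedges \<Lambda>" "y \<in> kedges \<Lambda>" "z \<in> kedges \<Lambda>" "w \<in> kedges \<Lambda>"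
    "src \<Lambda> x = rng \<Lambda> y" "src \<Lambda> z = rng \<Lambda> w"
    using c by (auto simp: commutes_def)
  have w: "deg \<Lambda> w = deg \<Lambda> x" using commutes_deg[OF c] d by (simp add: add.commute)
  then have nD: "x \<notin> D" "w \<notin> D" using d(3) D_deg by auto
  have sw: "src \<Lambda> w = src \<Lambda> y"
    using c e composite(3)[of x y] composite(3)[of z w] kedges_Mor by (auto simp: commutes_def)
  have rx: "rng \<Lambda> x = rng \<Lambda> z"
    using c e composite(2)[of x y] composite(2)[of z w] kedges_Mor by (auto simp: commutes_def)
  show ?thesis
  proof (cases "y \<in> D")
    case True
    then have z: "z \<in> D" using D_square[OF n] by simp
    note E = EdgeSq_ends[OF n True]
    have sq: "?\<alpha> \<in> delay_squares \<Lambda> f (deg \<Lambda> x)" using delay_squares_iff[OF n(1)] n(2) True z by blast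
    have "S (OldE x) * S (Edge2 y) = S (Edge2 z) * S (EdgeSq ?\<alpha>)"
      by (rule graph_ckD(4)[OF ck delay_rel.square_out[OF n(1) sq n(2) True z], of "NewV y"])
        (use e nD E True z in auto)
    moreover have "S (EdgeSq ?\<alpha>) * S (Edge1 y) = S (Edge1 z) * S (OldE w)"
      by (rule graph_ckD(4)[OF ck delay_rel.square_in[OF n(1) sq n(2) True z], of "OldV (src \<Lambda> y)"])
        (use e nD E True z sw endpoints(2)[OF kedges_Mor[OF e(2)]] in auto)
    ultimately show ?thesis using nD True z by (simp add: inner_family_def) (metis mult.assoc)
  next
    case False
    then have z: "z \<notin> D" using D_square[OF n] by simp
    have "S (OldE x) * S (OldE y) = S (OldE z) * S (OldE w)"
      by (rule graph_ckD(4)[OF ck delay_rel.old[OF c], of "OldV (src \<Lambda> y)"])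
        (use e nD False z sw w d endpoints(2)[OF kedges_Mor[OF e(2)]] in auto)
    then show ?thesis using nD False z by (simp add: inner_family_def)
  qed
qed

text \<open>
  In (CK4) the range projection of \<open>S\<^bsub>e\<^sup>2\<^esub> S\<^bsub>e\<^sup>1\<^esub>\<close> is that of \<open>S\<^bsub>e\<^sup>2\<^esub>\<close>, because \<open>e\<^sup>1\<close> is the only edge of its
  degree with range \<open>v\<^sub>e\<close>. So summing over the edges of \<open>\<Lambda>\<close> with a given range amounts to summing over the
  edges of the delayed graph.
\<close>

theorem inner_family_ck:
  assumes ck: "graph_ck Q S"
  shows "ck_typed \<Lambda> (\<lambda>v. Q (OldV v)) (inner_family S)"
  unfolding ck_typed_def
proof (intro conjI ballI allI impI)
  note C = graph_ckD[OF ck]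
  fix v assume v: "v \<in> kverts \<Lambda>"
  show "adj (Q (OldV v)) = Q (OldV v)" "Q (OldV v) * Q (OldV v) = Q (OldV v)" using C(1,2) v by simp_all
  show "Q (OldV v) * Q (OldV w) = 0" if "w \<in> kverts \<Lambda>" "v \<noteq> w" for w using C(3) v that by simp
  fix i
  have "Q (OldV v) = (\<Sum>x \<in> outer ` {e \<in> of_degree \<Lambda> (axis i 1). rng \<Lambda> e = v}. S x * adj (S x))"
    using C(6)[of "OldV v" i] v unfolding edges_to_old by simp
  also have "\<dots> = (\<Sum>e\<in>{e \<in> of_degree \<Lambda> (axis i 1). rng \<Lambda> e = v}. S (outer e) * adj (S (outer e)))"
    by (simp add: sum.reindex[OF inj_outer])
  also have "\<dots> = (\<Sum>e\<in>{e \<in> of_degree \<Lambda> (axis i 1). rng \<Lambda> e = v}. inner_family S e * adj (inner_family S e))"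
  proof (rule sum.cong)
    fix e
    show "S (outer e) * adj (S (outer e)) = inner_family S e * adj (inner_family S e)"
    proof (cases "e \<in> D")
      case True
      obtain i where i: "axis i 1 = d" using abs_deg_eq_1[OF abs_deg_d] by metis
      have "Q (NewV e) = S (Edge1 e) * adj (S (Edge1 e))"
        using C(6)[of "NewV e" i] True edges_to_new_d[OF i True] by simp
      moreover have "S (Edge2 e) * Q (NewV e) = S (Edge2 e)"
        using graph_ck_ends(1)[OF ck, of "Edge2 e"] True by simp
      ultimately have "S (Edge2 e) * (S (Edge1 e) * adj (S (Edge1 e))) = S (Edge2 e)" by simp
      then show ?thesis using True by (simp add: inner_family_def outer_def) (metis mult.assoc)
    qed (simp add: inner_family_def outer_def)
  qed simp
  finally show "Q (OldV v) =
    (\<Sum>e\<in>{e \<in> of_degree \<Lambda> (axis i 1). rng \<Lambda> e = v}. inner_family S e * adj (inner_family S e))" .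
next
  note C = graph_ckD[OF ck]
  fix e assume e: "e \<in> kedges \<Lambda>"
  show "adj (inner_family S e) * inner_family S e = Q (OldV (src \<Lambda> e))"
  proof (cases "e \<in> D")
    case True
    have "adj (S (Edge2 e)) * S (Edge2 e) = Q (NewV e)" "adj (S (Edge1 e)) * S (Edge1 e) = Q (OldV (src \<Lambda> e))"
      using C(5)[of "Edge2 e"] C(5)[of "Edge1 e"] True by simp_all
    moreover have "Q (NewV e) * S (Edge1 e) = S (Edge1 e)"
      using graph_ck_ends(2)[OF ck, of "Edge1 e"] True by simp
    ultimately show ?thesis using True by (simp add: inner_family_def) (metis mult.assoc)
  next
    case False
    then show ?thesis using C(5)[of "OldE e"] e by (simp add: inner_family_def)
  qed
next
  fix x z y w assume c: "commutes \<Lambda> x y z w"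
  then have e: "x \<in> kedges \<Lambda>" "y \<in> kedges \<Lambda>" "z \<in> kedges \<Lambda>" "w \<in> kedges \<Lambda>"
    "src \<Lambda> x = rng \<Lambda> y" "src \<Lambda> z = rng \<Lambda> w" "cmp \<Lambda> x y = cmp \<Lambda> z w"
    by (auto simp: commutes_def)
  show "inner_family S x * inner_family S y = inner_family S z * inner_family S w"
  proof (cases "deg \<Lambda> x = deg \<Lambda> z")
    case True
    then show ?thesis using factor_unique[of x y z w] e kedges_Mor by auto
  next
    case False
    have deg: "deg \<Lambda> w = deg \<Lambda> x" "deg \<Lambda> y = deg \<Lambda> z"
      using axis_sum_eq[OF _ _ _ _ commutes_deg[OF c] False] e by (auto simp: kedges_def)
    consider "deg \<Lambda> y = d" | "deg \<Lambda> x = d" | "deg \<Lambda> y \<noteq> d" "deg \<Lambda> x \<noteq> d" by blast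
    then show ?thesis
    proof cases
      case 1
      then show ?thesis using inner_family_square[OF ck c] deg False by simp
    next
      case 2
      have "commutes \<Lambda> z w x y" using c by (auto simp: commutes_def)
      from inner_family_square[OF ck this] show ?thesis using 2 deg False by simp
    next
      case 3
      then have nD: "x \<notin> D" "y \<notin> D" "z \<notin> D" "w \<notin> D" using D_deg deg by auto
      have sw: "src \<Lambda> w = src \<Lambda> y"
        using e composite(3)[of x y] composite(3)[of z w] kedges_Mor by auto
      have "S (OldE x) * S (OldE y) = S (OldE z) * S (OldE w)"
        by (rule graph_ckD(4)[OF ck delay_rel.old[OF c], of "OldV (src \<Lambda> y)"])
          (use e nD sw deg False endpoints(2)[OF kedges_Mor[OF e(2)]] in auto)
      then show ?thesis using nD by (simp add: inner_family_def)
    qed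
  qed
qed

section \<open>From the original graph to the delayed graph\<close>

lemma ck_typedD:
  assumes "ck_typed \<Lambda> P T"
  shows "v \<in> kverts \<Lambda> \<Longrightarrow> adj (P v) = P v" "v \<in> kverts \<Lambda> \<Longrightarrow> P v * P v = P v"
    "v \<in> kverts \<Lambda> \<Longrightarrow> w \<in> kverts \<Lambda> \<Longrightarrow> v \<noteq> w \<Longrightarrow> P v * P w = 0"
    "commutes \<Lambda> x y z w \<Longrightarrow> T x * T y = T z * T w"
    "e \<in> kedges \<Lambda> \<Longrightarrow> adj (T e) * T e = P (src \<Lambda> e)"
    "v \<in> kverts \<Lambda> \<Longrightarrow> P v = (\<Sum>e \<in> {e \<in> of_degree \<Lambda> (axis i 1). rng \<Lambda> e = v}. T e * adj (T e))"
proof -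
  note c = assms[unfolded ck_typed_def]
  note c1 = c[THEN conjunct1] and c' = c[THEN conjunct2]
  note c2 = c'[THEN conjunct1] and c'' = c'[THEN conjunct2]
  note c3 = c''[THEN conjunct1] and c4 = c''[THEN conjunct2, THEN conjunct1]
    and c5 = c''[THEN conjunct2, THEN conjunct2]
  show "v \<in> kverts \<Lambda> \<Longrightarrow> adj (P v) = P v" "v \<in> kverts \<Lambda> \<Longrightarrow> P v * P v = P v" using c1 by blast+
  show "v \<in> kverts \<Lambda> \<Longrightarrow> w \<in> kverts \<Lambda> \<Longrightarrow> v \<noteq> w \<Longrightarrow> P v * P w = 0" using c2 by blast
  show "commutes \<Lambda> x y z w \<Longrightarrow> T x * T y = T z * T w" by (rule c3[rule_format])
  show "e \<in> kedges \<Lambda> \<Longrightarrow> adj (T e) * T e = P (src \<Lambda> e)" by (rule c4[rule_format])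
  show "v \<in> kverts \<Lambda> \<Longrightarrow> P v = (\<Sum>e \<in> {e \<in> of_degree \<Lambda> (axis i 1). rng \<Lambda> e = v}. T e * adj (T e))"
    by (rule c5[rule_format])
qed

lemma ck_typed_ends:
  assumes ck: "ck_typed \<Lambda> P T" and e: "e \<in> kedges \<Lambda>"
  shows "T e * P (src \<Lambda> e) = T e" "P (rng \<Lambda> e) * T e = T e"
    "e' \<in> kedges \<Lambda> \<Longrightarrow> deg \<Lambda> e' = deg \<Lambda> e \<Longrightarrow> e \<noteq> e' \<Longrightarrow> adj (T e) * T e' = 0"
proof -
  note C = ck_typedD[OF ck]
  have r: "P (rng \<Lambda> e) * T e = T e"
    "e' \<in> kedges \<Lambda> \<Longrightarrow> deg \<Lambda> e' = deg \<Lambda> e \<Longrightarrow> rng \<Lambda> e' = rng \<Lambda> e \<Longrightarrow> e \<noteq> e' \<Longrightarrow> adj (T e) * T e' = 0"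
    if e: "e \<in> kedges \<Lambda>" for e e'
  proof -
    obtain i where i: "deg \<Lambda> e = axis i 1" using abs_deg_eq_1[of "deg \<Lambda> e"] e by (auto simp: kedges_def)
    have v: "rng \<Lambda> e \<in> kverts \<Lambda>" using e kedges_Mor endpoints by blast
    let ?E = "{x \<in> of_degree \<Lambda> (axis i 1). rng \<Lambda> x = rng \<Lambda> e}"
    have mem: "x \<in> ?E" if "x \<in> kedges \<Lambda>" "deg \<Lambda> x = deg \<Lambda> e" "rng \<Lambda> x = rng \<Lambda> e" for x
      using that i kedges_Mor by (simp add: of_degree_def)
    have "adj (T x) * T x = P (src \<Lambda> x) \<and> adj (P (src \<Lambda> x)) = P (src \<Lambda> x) \<and> P (src \<Lambda> x) * P (src \<Lambda> x) = P (src \<Lambda> x)"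
      if "x \<in> ?E" for x
    proof -
      have "x \<in> kedges \<Lambda>" using that by (blast intro: of_degree_axis_kedges)
      then show ?thesis using C(1,2,5) endpoints(2) kedges_Mor by blast
    qed
    note fr = finite_range_projections[OF finite_row[OF v] this C(6)[OF v] C(2)[OF v] mem[OF e HOL.refl HOL.refl]]
    show "P (rng \<Lambda> e) * T e = T e" by (rule fr(1))
    show "adj (T e) * T e' = 0" if "e' \<in> kedges \<Lambda>" "deg \<Lambda> e' = deg \<Lambda> e" "rng \<Lambda> e' = rng \<Lambda> e" "e \<noteq> e'"
      by (rule fr(2)[OF _ mem[OF that(1-3)] that(4)])
  qed
  have s: "src \<Lambda> e \<in> kverts \<Lambda>" using e kedges_Mor endpoints by blast
  show "T e * P (src \<Lambda> e) = T e"
    by (rule partial_isometry_of_source) (use C(1,2)[OF s] C(5)[OF e] in auto)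
  show "P (rng \<Lambda> e) * T e = T e" by (rule r(1)[OF e])
  show "adj (T e) * T e' = 0" if e': "e' \<in> kedges \<Lambda>" "deg \<Lambda> e' = deg \<Lambda> e" "e \<noteq> e'"
  proof (cases "rng \<Lambda> e' = rng \<Lambda> e")
    case True
    then show ?thesis using r(2)[OF e] that by blast
  next
    case False
    have v: "rng \<Lambda> e \<in> kverts \<Lambda>" "rng \<Lambda> e' \<in> kverts \<Lambda>" using e e' kedges_Mor endpoints by blast+
    have "adj (T e) * P (rng \<Lambda> e) = adj (T e)"
      using arg_cong[OF r(1)[OF e], of adj] C(1)[OF v(1)] by simp
    then have "adj (T e) * T e' = adj (T e) * P (rng \<Lambda> e) * (P (rng \<Lambda> e') * T e')"
      using r(1)[OF e'(1)] by simp
    also have "\<dots> = adj (T e) * (P (rng \<Lambda> e) * P (rng \<Lambda> e')) * T e'" by (simp only: mult.assoc)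
    finally show ?thesis using C(3)[OF v] False by simp
  qed
qed

text \<open>
  The operator \<open>T\<^sub>b T\<^sub>g T\<^sub>g\<^sup>*\<close> for \<open>\<alpha> = [bg]\<close>; the factorization is unique.
\<close>

definition square_op :: "('m \<Rightarrow> 'u::unital_cstar) \<Rightarrow> 'm \<Rightarrow> 'u" where
  "square_op T \<alpha> = (THE t. \<exists>n\<in>N. \<exists>b g h a. square \<Lambda> f n \<alpha> b g h a \<and> t = T b * T g * adj (T g))"

lemma square_op_eq:
  assumes "n \<in> N" "square \<Lambda> f n \<alpha> b g h a"
  shows "square_op T \<alpha> = T b * T g * adj (T g)"
  unfolding square_op_def using assms square_unique[OF assms] by (intro the_equality) blast+

definition mat_vert :: "('m \<Rightarrow> 'u::unital_cstar) \<Rightarrow> ('m \<Rightarrow> 'u) \<Rightarrow> 'm delay_vert \<Rightarrow> 'u mat2" where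
  "mat_vert P T v = (case v of OldV v \<Rightarrow> Mat2 (P v) 0 0 0 | NewV g \<Rightarrow> Mat2 0 0 0 (T g * adj (T g)))"

definition mat_edge :: "('m \<Rightarrow> 'u::unital_cstar) \<Rightarrow> 'm delay_edge \<Rightarrow> 'u mat2" where
  "mat_edge T x = (case x of OldE e \<Rightarrow> Mat2 (T e) 0 0 0 | Edge1 g \<Rightarrow> Mat2 0 0 (T g) 0
     | Edge2 g \<Rightarrow> Mat2 0 (T g * adj (T g)) 0 0 | EdgeSq \<alpha> \<Rightarrow> Mat2 0 0 0 (square_op T \<alpha>))"

lemma sum_Mat2:
  "(\<Sum>i\<in>I. Mat2 (a i) 0 0 0) = Mat2 (sum a I) 0 0 (0::'u::unital_cstar)"
  "(\<Sum>i\<in>I. Mat2 0 0 0 (a i)) = Mat2 0 0 0 (sum a I :: 'u)"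
  by (induction I rule: infinite_finite_induct) (simp_all add: zero_mat2_def plus_mat2_def)

text \<open>
  The operator of a square \<open>[bg] = [ha]\<close> is also \<open>T\<^sub>h T\<^sub>a T\<^sub>g\<^sup>*\<close>. In this form its range projections sum to
  \<open>T\<^sub>h P\<^bsub>s(h)\<^esub> T\<^sub>h\<^sup>* = T\<^sub>h T\<^sub>h\<^sup>*\<close> over all \<open>a\<close>, which is (CK4) at \<open>v\<^sub>h\<close>. The relations of the delayed
  graph follow from \<open>T\<^sub>g T\<^sub>g\<^sup>* T\<^sub>g = T\<^sub>g\<close> and the commuting squares of \<open>\<Lambda>\<close>; for a cube both sides equal
  \<open>T\<^sub>c T\<^sub>b T\<^sub>h T\<^sub>h\<^sup>*\<close>.
\<close>

theorem matrix_family_ck: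
  fixes P T :: "'m \<Rightarrow> 'u::unital_cstar"
  assumes ck: "ck_typed \<Lambda> P T"
  shows "graph_ck (mat_vert P T) (mat_edge T)"
proof -
  note C = ck_typedD[OF ck] and E = ck_typed_ends[OF ck]
  note M = mat2_defs adj_mat2_def mat_vert_def mat_edge_def
  have src: "src \<Lambda> e \<in> kverts \<Lambda>" and rng: "rng \<Lambda> e \<in> kverts \<Lambda>" if "e \<in> kedges \<Lambda>" for e
    using that kedges_Mor endpoints by blast+
  have ttt: "T e * (adj (T e) * T e) = T e" if "e \<in> kedges \<Lambda>" for e
    using E(1)[OF that] C(5)[OF that] by simp
  have ttt': "adj (T e) * (T e * adj (T e)) = adj (T e)" if "e \<in> kedges \<Lambda>" for e
    using arg_cong[OF ttt[OF that], of adj] by (simp add: mult.assoc)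
  have ttt'': "T e * adj (T e) * T e = T e" "adj (T e) * (T e * x) = P (src \<Lambda> e) * x"
    if e: "e \<in> kedges \<Lambda>" for e x
  proof -
    show "T e * adj (T e) * T e = T e" using ttt[OF e] by (simp add: mult.assoc)
    show "adj (T e) * (T e * x) = P (src \<Lambda> e) * x" using C(5)[OF e] by (simp flip: mult.assoc)
  qed
  have sq: "T b * T g * adj (T g) = T h * T a * adj (T g)" "src \<Lambda> g = src \<Lambda> a"
    "b \<in> kedges \<Lambda>" "g \<in> kedges \<Lambda>" "h \<in> kedges \<Lambda>" "a \<in> kedges \<Lambda>"
    "src \<Lambda> b = rng \<Lambda> g" "src \<Lambda> h = rng \<Lambda> a"
    if "square \<Lambda> f n \<alpha> b g h a" for n \<alpha> b g h a
  proof -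
    have c: "commutes \<Lambda> b g h a" using that by (rule square_commutes)
    show "T b * T g * adj (T g) = T h * T a * adj (T g)" using C(4)[OF c] by simp
    show e: "b \<in> kedges \<Lambda>" "g \<in> kedges \<Lambda>" "h \<in> kedges \<Lambda>" "a \<in> kedges \<Lambda>"
      "src \<Lambda> b = rng \<Lambda> g" "src \<Lambda> h = rng \<Lambda> a"
      using c by (auto simp: commutes_def)
    show "src \<Lambda> g = src \<Lambda> a"
      using c e composite(3)[of b g] composite(3)[of h a] kedges_Mor by (auto simp: commutes_def)
  qed
  show ?thesis
    unfolding graph_ck_def
  proof (intro conjI ballI allI impI)
    fix v assume v: "v \<in> gverts G"
    show "adj (mat_vert P T v) = mat_vert P T v" "mat_vert P T v * mat_vert P T v = mat_vert P T v"
      using v ttt' by (cases rule: gverts_cases; simp add: M C(1,2) mult.assoc D_kedges)+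
    show "mat_vert P T v * mat_vert P T w = 0" if w: "w \<in> gverts G" "v \<noteq> w" for w
    proof -
      have "T g * adj (T g) * (T h * adj (T h)) = 0" if "g \<in> D" "h \<in> D" "g \<noteq> h" for g h
      proof -
        have "adj (T g) * T h = 0"
          using E(3)[OF D_kedges[OF that(1)] D_kedges[OF that(2)]] that D_deg by simp
        then have "T g * (adj (T g) * T h) * adj (T h) = 0" by simp
        then show ?thesis by (simp only: mult.assoc)
      qed
      then show ?thesis using v w C(3) by (auto simp: M elim!: gverts_cases)
    qed
    fix i
    show "mat_vert P T v =
      (\<Sum>x \<in> {x \<in> gedges G. gdeg G x = axis i 1 \<and> grng G x = v}. mat_edge T x * adj (mat_edge T x))"
      using v
    proof (cases rule: gverts_cases)
      case (OldV u)
      have "mat_edge T (outer e) * adj (mat_edge T (outer e)) = Mat2 (T e * adj (T e)) 0 0 0"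
        if "e \<in> of_degree \<Lambda> (axis i 1)" for e
        using ttt'[OF of_degree_axis_kedges[OF that]] by (simp add: outer_def M mult.assoc)
      then have "(\<Sum>e\<in>{e \<in> of_degree \<Lambda> (axis i 1). rng \<Lambda> e = u}. mat_edge T (outer e) * adj (mat_edge T (outer e))) =
          (\<Sum>e\<in>{e \<in> of_degree \<Lambda> (axis i 1). rng \<Lambda> e = u}. Mat2 (T e * adj (T e)) 0 0 0)"
        by (intro sum.cong) auto
      also have "\<dots> = Mat2 (P u) 0 0 0" unfolding sum_Mat2 using C(6)[OF OldV(2), of i] by simp
      finally show ?thesis
        unfolding OldV(1) edges_to_old by (simp add: sum.reindex[OF inj_outer] mat_vert_def)
    next
      case (NewV h)
      note h = D_kedges[OF NewV(2)]
      show ?thesis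
      proof (cases "axis i 1 = d")
        case True
        show ?thesis
          unfolding NewV(1) edges_to_new_d[OF True NewV(2)] by (simp add: M)
      next
        case False
        then have n: "axis i 1 \<in> N" using abs_deg_axis[of i] by (simp add: N_axis del: abs_deg_axis)
        let ?A = "{a \<in> of_degree \<Lambda> (axis i 1). rng \<Lambda> a = src \<Lambda> h}"
        have inj: "inj_on (\<lambda>a. EdgeSq (cmp \<Lambda> h a)) ?A"
          using factor_unique(2)[of h _ h] kedges_Mor[OF h] by (auto simp: inj_on_def of_degree_def)
        have summand: "mat_edge T (EdgeSq (cmp \<Lambda> h a)) * adj (mat_edge T (EdgeSq (cmp \<Lambda> h a))) =
            Mat2 0 0 0 (T h * (T a * adj (T a)) * adj (T h))" if a: "a \<in> ?A" for a
        proof -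
          obtain b g where s: "square \<Lambda> f (axis i 1) (cmp \<Lambda> h a) b g h a"
            using square_from_ha[OF n _ D_degree[OF NewV(2)]] a by fastforce
          have "T a * (adj (T g) * (T g * adj (T a))) = T a * P (src \<Lambda> a) * adj (T a)"
            by (simp only: ttt''(2)[OF sq(4)[OF s]] sq(2)[OF s] mult.assoc)
          then have "T a * (adj (T g) * (T g * adj (T a))) = T a * adj (T a)"
            by (simp only: E(1)[OF sq(6)[OF s]])
          then have "T h * T a * adj (T g) * adj (T h * T a * adj (T g)) = T h * (T a * adj (T a)) * adj (T h)"
            by (simp add: mult.assoc) (metis mult.assoc)
          then show ?thesis by (simp add: M square_op_eq[OF n s] sq(1)[OF s])
        qed
        have "(\<Sum>a\<in>?A. mat_edge T (EdgeSq (cmp \<Lambda> h a)) * adj (mat_edge T (EdgeSq (cmp \<Lambda> h a)))) =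
            (\<Sum>a\<in>?A. Mat2 0 0 0 (T h * (T a * adj (T a)) * adj (T h)))"
          by (rule sum.cong[OF HOL.refl summand])
        also have "\<dots> = Mat2 0 0 0 (T h * P (src \<Lambda> h) * adj (T h))"
          unfolding sum_Mat2 C(6)[OF src[OF h], of i] by (simp add: sum_distrib_left sum_distrib_right)
        also have "\<dots> = mat_vert P T v" by (simp add: E(1)[OF h] NewV(1) mat_vert_def)
        finally show ?thesis
          unfolding NewV(1) edges_to_new[OF False NewV(2)] sum.reindex[OF inj] by (simp add: NewV(1))
      qed
    qed
  next
    fix x assume x: "x \<in> gedges G"
    then show "adj (mat_edge T x) * mat_edge T x = mat_vert P T (gsrc G x)"
    proof (cases rule: gedges_cases)
      case (OldE e)
      then show ?thesis by (simp add: M C(5))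
    next
      case (Edge1 g)
      then show ?thesis by (simp add: M C(5) D_kedges)
    next
      case (Edge2 g)
      then show ?thesis using ttt'[OF D_kedges[OF Edge2(2)]] by (simp add: M mult.assoc)
    next
      case (EdgeSq n \<alpha> b g h a)
      note s = EdgeSq(3)
      have "adj (T b * T g) * (T b * T g) = adj (T g) * (P (src \<Lambda> b) * T g)"
        by (simp add: mult.assoc ttt''(2)[OF sq(3)[OF s]])
      also have "\<dots> = adj (T g) * T g" using sq(7)[OF s] E(2)[OF sq(4)[OF s]] by simp
      finally have "T g * (adj (T b * T g) * (T b * T g)) * adj (T g) = T g * adj (T g) * T g * adj (T g)"
        by (simp add: mult.assoc)
      also have "\<dots> = T g * adj (T g)" using ttt''(1)[OF sq(4)[OF s]] by simp
      finally have "adj (T b * T g * adj (T g)) * (T b * T g * adj (T g)) = T g * adj (T g)"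
        by (simp add: mult.assoc)
      then show ?thesis
        using EdgeSq EdgeSq_ends(1)[OF EdgeSq(2-4)] by (simp add: M square_op_eq[OF EdgeSq(2) s])
    qed
  next
    fix x y z w v
    assume *: "delay_rel \<Lambda> f x y z w \<and> is_path G ([x, y], v) \<and> is_path G ([z, w], v)"
    then have "delay_rel \<Lambda> f x y z w" by simp
    then show "mat_edge T x * mat_edge T y = mat_edge T z * mat_edge T w"
    proof (cases rule: delay_rel.cases)
      case (old x y z w)
      then show ?thesis using C(4)[OF old(5)] by (simp add: M)
    next
      case (square_out n \<alpha> b g h a)
      note s = \<open>square \<Lambda> f n \<alpha> b g h a\<close>
      have "T h * adj (T h) * (T h * T a * adj (T g)) = T h * T a * adj (T g)"
        using ttt''(1)[OF sq(5)[OF s]] by (simp flip: mult.assoc)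
      then have "T h * adj (T h) * (T b * T g * adj (T g)) = T b * T g * adj (T g)"
        by (simp only: sq(1)[OF s])
      then show ?thesis using square_out by (simp add: M square_op_eq[OF square_out(5) s] mult.assoc)
    next
      case (square_in n \<alpha> b g h a)
      note s = \<open>square \<Lambda> f n \<alpha> b g h a\<close>
      have "T b * T g * adj (T g) * T g = T b * T g"
        using ttt[OF sq(4)[OF s]] by (simp add: mult.assoc)
      also have "\<dots> = T h * T a" by (rule C(4)[OF square_commutes[OF s]])
      finally show ?thesis using square_in by (simp add: M square_op_eq[OF square_in(5) s])
    next
      case (cube n m \<alpha> \<beta> b h g a c l d' b' c' l' d'')
      note s1 = \<open>square \<Lambda> f n \<alpha> b h g a\<close> and s2 = \<open>square \<Lambda> f m \<beta> c g l d'\<close>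
      have nm: "n \<in> N" "m \<in> N" using cube by auto
      have cb: "commutes \<Lambda> c b b' c'" and chl: "commutes \<Lambda> c' h l' d''" using cube by auto
      have hk: "h \<in> kedges \<Lambda>" by (rule sq(4)[OF s1])
      have s3: "square \<Lambda> f m (cmp \<Lambda> c' h) c' h l' d''"
        using cube sq(4)[OF s1] s1 unfolding square_def by auto
      have bl: "src \<Lambda> b' = rng \<Lambda> l'"
      proof -
        have "src \<Lambda> b' = rng \<Lambda> c'" using cb by (simp add: commutes_def)
        moreover have "rng \<Lambda> (cmp \<Lambda> c' h) = rng \<Lambda> c'" "rng \<Lambda> (cmp \<Lambda> l' d'') = rng \<Lambda> l'"
          using chl kedges_Mor composite(2)[of c' h] composite(2)[of l' d''] by (simp_all add: commutes_def)
        ultimately show ?thesis using chl by (simp add: commutes_def)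
      qed
      obtain h'' a'' where s4: "square \<Lambda> f n (cmp \<Lambda> b' l') b' l' h'' a''"
        using square_from_bg[OF nm(1) _ _ bl] cube by blast
      have lk: "l' \<in> kedges \<Lambda>" by (rule sq(4)[OF s4])
      have "T c * T g * adj (T g) * (T b * T h * adj (T h)) = T c * T g * adj (T g) * (T g * T a * adj (T h))"
        by (simp only: sq(1)[OF s1])
      also have "\<dots> = T c * (T g * adj (T g) * T g) * T a * adj (T h)" by (simp only: mult.assoc)
      also have "\<dots> = T c * T g * T a * adj (T h)" by (simp only: ttt''(1)[OF sq(4)[OF s2]])
      also have "\<dots> = T c * (T g * T a) * adj (T h)" by (simp only: mult.assoc)
      also have "T g * T a = T b * T h" using C(4)[OF square_commutes[OF s1]] by simp
      also have "T c * (T b * T h) * adj (T h) = (T c * T b) * T h * adj (T h)" by (simp only: mult.assoc)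
      also have "T c * T b = T b' * T c'" by (rule C(4)[OF cb])
      also have "T b' * T c' * T h * adj (T h) = T b' * (T c' * T h) * adj (T h)" by (simp only: mult.assoc)
      also have "T c' * T h = T l' * T d''" by (rule C(4)[OF chl])
      also have "T b' * (T l' * T d'') * adj (T h) = T b' * (T l' * adj (T l') * T l' * T d'') * adj (T h)"
        by (simp only: ttt''(1)[OF lk])
      also have "\<dots> = T b' * T l' * adj (T l') * (T l' * T d'' * adj (T h))" by (simp only: mult.assoc)
      also have "T l' * T d'' * adj (T h) = T c' * T h * adj (T h)"
        by (simp only: C(4)[OF chl])
      finally have "T c * T g * adj (T g) * (T b * T h * adj (T h)) =
          T b' * T l' * adj (T l') * (T c' * T h * adj (T h))" .
      then show ?thesis
        using cube by (simp add: M square_op_eq[OF nm(1) s1] square_op_eq[OF nm(2) s2]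
            square_op_eq[OF nm(2) s3] square_op_eq[OF nm(1) s4])
    qed
  qed
qed

end

section \<open>The imprimitivity bimodule\<close>

definition closed_span :: "'u::unital_cstar set \<Rightarrow> 'u set" where
  "closed_span W = \<Inter>{S. closed S \<and> csubspace S \<and> W \<subseteq> S}"

lemma closed_closed_span: "closed (closed_span W)"
  unfolding closed_span_def by (intro closed_Inter) auto

lemma csubspace_closed_span: "csubspace (closed_span W)"
  unfolding closed_span_def csubspace_def by (auto simp: csubspaceD(1,2,3))

lemma closed_span_superset: "W \<subseteq> closed_span W"
  by (auto simp: closed_span_def)

lemma closed_span_least: "closed S \<Longrightarrow> csubspace S \<Longrightarrow> W \<subseteq> S \<Longrightarrow> closed_span W \<subseteq> S"
  by (auto simp: closed_span_def)

lemma closed_csubspace_vimage: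
  assumes "closed Y" "csubspace Y"
  shows "closed {x. b * x \<in> Y}" "csubspace {x. b * x \<in> Y}"
    "closed {x. x * b \<in> Y}" "csubspace {x. x * b \<in> Y}" "closed {x. adj x \<in> Y}" "csubspace {x. adj x \<in> Y}"
proof -
  show "closed {x. b * x \<in> Y}" "closed {x. x * b \<in> Y}" "closed {x. adj x \<in> Y}"
    using continuous_closed_vimage[OF assms(1), of "\<lambda>x. b * x"]
      continuous_closed_vimage[OF assms(1), of "\<lambda>x. x * b"]
      continuous_closed_vimage[OF assms(1) linear_continuous_at[OF bounded_linear_adj]]
    by (auto simp: vimage_def intro!: continuous_intros)
  show "csubspace {x. b * x \<in> Y}" "csubspace {x. x * b \<in> Y}" "csubspace {x. adj x \<in> Y}"
    using csubspaceD(1,2,3)[OF assms(2)]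
    by (auto simp: csubspace_def distrib_left distrib_right cscale_mult_left cscale_mult_right adj_cscale)
qed

lemma closed_span_mult:
  assumes Y: "closed Y" "csubspace Y" and x: "x \<in> closed_span W"
  shows "(\<And>w. w \<in> W \<Longrightarrow> b * w \<in> Y) \<Longrightarrow> b * x \<in> Y"
    and "(\<And>w. w \<in> W \<Longrightarrow> w * b \<in> Y) \<Longrightarrow> x * b \<in> Y"
    and "(\<And>w. w \<in> W \<Longrightarrow> adj w \<in> Y) \<Longrightarrow> adj x \<in> Y"
  using x closed_span_least[of "{x. b * x \<in> Y}" W] closed_span_least[of "{x. x * b \<in> Y}" W]
    closed_span_least[of "{x. adj x \<in> Y}" W] closed_csubspace_vimage(1-4)[OF Y, of b] closed_csubspace_vimage(5,6)[OF Y]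
  by blast+

lemma closed_star_subalg_closed_span:
  assumes mult: "\<And>x y. x \<in> closed_span W \<Longrightarrow> y \<in> W \<Longrightarrow> x * y \<in> closed_span W" and adj: "\<And>w. w \<in> W \<Longrightarrow> adj w \<in> closed_span W"
  shows "closed_star_subalg (closed_span W)"
  unfolding closed_star_subalg_def
  using closed_closed_span csubspace_closed_span closed_span_mult(1)[OF closed_closed_span csubspace_closed_span]
    closed_span_mult(3)[OF closed_closed_span csubspace_closed_span] mult adj by blast

text \<open>
  Think of \<open>C\<close> as a corner of \<open>BB\<close>, the algebra generated by \<open>C\<close> and the \<open>V\<^sub>i\<close>. Each \<open>V\<^sub>i\<close> maps a piece
  of the corner isometrically onto a piece orthogonal to it. Then \<open>BB\<close> is spanned by \<open>C\<close>, \<open>V\<^sub>i C\<close>,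
  \<open>C V\<^sub>i\<^sup>*\<close> and \<open>V\<^sub>i C V\<^sub>k\<^sup>*\<close>, and \<open>X\<close> is the first column of this matrix. The condition on \<open>W\<close>
  replaces a unit of \<open>C\<close>.
\<close>

locale corner =
  fixes C W :: "'u::unital_cstar set" and V :: "'i \<Rightarrow> 'u" and I :: "'i set"
  assumes C_eq: "C = gen W"
    and unit: "w \<in> W \<Longrightarrow> \<exists>e\<in>C. adj e = e \<and> w * e = w"
    and source: "i \<in> I \<Longrightarrow> adj (V i) * V i \<in> C"
    and isometry: "i \<in> I \<Longrightarrow> V i * (adj (V i) * V i) = V i"
    and orth: "i \<in> I \<Longrightarrow> k \<in> I \<Longrightarrow> i \<noteq> k \<Longrightarrow> adj (V i) * V k = 0"
    and annihilate: "c \<in> C \<Longrightarrow> i \<in> I \<Longrightarrow> c * V i = 0"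
begin

definition "X0 = C \<union> {V i * c | i c. i \<in> I \<and> c \<in> C}"
definition "X = closed_span X0"
definition "BB = gen (C \<union> V ` I)"

lemma C: "closed_star_subalg C"
  unfolding C_eq by (rule closed_star_subalg_gen)

lemmas CD = closed_star_subalgD[OF C] csubspaceD[OF closed_star_subalgD(2)[OF C]]

lemma BB: "closed_star_subalg BB"
  unfolding BB_def by (rule closed_star_subalg_gen)

lemmas BD = closed_star_subalgD[OF BB] csubspaceD[OF closed_star_subalgD(2)[OF BB]]

lemma X: "closed X" "csubspace X"
  unfolding X_def by (rule closed_closed_span csubspace_closed_span)+

lemma C_BB: "C \<subseteq> BB" and V_BB: "i \<in> I \<Longrightarrow> V i \<in> BB"
  using gen_superset[of "C \<union> V ` I"] by (auto simp: BB_def)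

lemma X_BB: "X \<subseteq> BB"
  unfolding X_def using C_BB V_BB BD by (intro closed_span_least) (auto simp: X0_def)

lemma C_X: "c \<in> C \<Longrightarrow> c \<in> X" and VC_X: "i \<in> I \<Longrightarrow> c \<in> C \<Longrightarrow> V i * c \<in> X"
  using closed_span_superset[of X0] by (auto simp: X_def X0_def)

lemma annihilate': assumes "c \<in> C" "i \<in> I" shows "adj (V i) * c = 0"
  using arg_cong[OF annihilate[of "adj c" i], of adj] assms CD(4) by simp

lemma V_V: assumes "i \<in> I" "k \<in> I" shows "V i * V k = 0"
proof -
  have "V i * V k = V i * (adj (V i) * V i * V k)" using isometry[OF assms(1)] by (metis mult.assoc)
  then show ?thesis using annihilate[OF source[OF assms(1)] assms(2)] by simp
qed

lemma V_star_V_C: "i \<in> I \<Longrightarrow> k \<in> I \<Longrightarrow> c \<in> C \<Longrightarrow> adj (V i) * (V k * c) \<in> C"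
  using orth[of i k] source[of i] CD(3)[of "adj (V i) * V i" c] CD(5)
  by (cases "i = k") (simp_all flip: mult.assoc)

lemma X_ip: assumes x: "x \<in> X" and y: "y \<in> X" shows "adj x * y \<in> C"
proof -
  have gens: "adj u * v \<in> C" if u0: "u \<in> X0" and v0: "v \<in> X0" for u v
  proof -
    consider "u \<in> C" | i c where "i \<in> I" "c \<in> C" "u = V i * c" using u0 by (auto simp: X0_def)
    then show ?thesis
    proof cases
      case 1
      then have u: "adj u \<in> C" by (rule CD(4))
      consider "v \<in> C" | k e where "k \<in> I" "e \<in> C" "v = V k * e" using v0 by (auto simp: X0_def)
      then show ?thesis
      proof cases
        case 1
        then show ?thesis using u CD(3) by blast
      next
        case 2
        then show ?thesis using annihilate[OF u, of k] CD(5) by (simp flip: mult.assoc)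
      qed
    next
      case u: 2
      have "adj (V i) * v \<in> C"
        using v0 annihilate'[OF _ u(1)] V_star_V_C[OF u(1)] CD(5) by (auto simp: X0_def)
      then show ?thesis using u CD(3)[of "adj c" "adj (V i) * v"] CD(4) by (simp add: mult.assoc)
    qed
  qed
  have "adj u * y \<in> C" if "u \<in> X0" for u
    using closed_span_mult(1)[OF CD(1,2) y[unfolded X_def]] gens that by blast
  then have "adj y * u \<in> C" if "u \<in> X0" for u
    using CD(4)[of "adj u * y"] that by simp
  then have "adj y * x \<in> C" using closed_span_mult(1)[OF CD(1,2) x[unfolded X_def]] by blast
  then show ?thesis using CD(4)[of "adj y * x"] by simp
qed

text \<open>
  The \<open>b\<close> for which both \<open>b\<close> and \<open>b\<^sup>*\<close> map \<open>X\<close> into itself form a closed subalgebra, so it suffices to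
  consider the generators of \<open>BB\<close>.
\<close>

lemma X_left: assumes b: "b \<in> BB" and x: "x \<in> X" shows "b * x \<in> X"
proof -
  define L where "L = {b. (\<forall>x\<in>X. b * x \<in> X) \<and> (\<forall>x\<in>X. adj b * x \<in> X)}"
  have L_eq: "L = (\<Inter>x\<in>X. {b. b * x \<in> X}) \<inter> (\<Inter>x\<in>X. {b. adj b \<in> {b. b * x \<in> X}})"
    by (auto simp: L_def)
  have "closed L"
    unfolding L_eq by (intro closed_Int closed_INT ballI closed_csubspace_vimage X)
  moreover have "csubspace L"
    unfolding csubspace_def L_def using csubspaceD(1,2,3)[OF X(2)]
    by (auto simp: distrib_right cscale_mult_left adj_cscale)
  ultimately have L: "closed_star_subalg L"
    by (auto simp: closed_star_subalg_def L_def mult.assoc)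
  have X0_X: "u \<in> X0 \<Longrightarrow> u \<in> X" for u using closed_span_superset by (auto simp: X_def)
  have memL: "b \<in> L" if "\<And>u. u \<in> X0 \<Longrightarrow> b * u \<in> X" "\<And>u. u \<in> X0 \<Longrightarrow> adj b * u \<in> X" for b
    using closed_span_mult(1)[OF X, of _ X0] that by (auto simp: L_def X_def)
  have CX: "c * u \<in> X" if c: "c \<in> C" and u: "u \<in> X0" for c u
  proof -
    consider "u \<in> C" | i e where "i \<in> I" "e \<in> C" "u = V i * e" using u by (auto simp: X0_def)
    then show ?thesis
    proof cases
      case 1
      then show ?thesis using c CD(3) C_X by blast
    next
      case 2
      then show ?thesis using annihilate[OF c, of i] csubspaceD(1)[OF X(2)] by (simp flip: mult.assoc)
    qed
  qed
  have "C \<subseteq> L" using CX CD(4) by (auto intro: memL)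
  moreover have "V i \<in> L" if i: "i \<in> I" for i
  proof (rule memL)
    fix u assume "u \<in> X0"
    then consider "u \<in> C" | k e where "k \<in> I" "e \<in> C" "u = V k * e" by (auto simp: X0_def)
    then have "V i * u \<in> X \<and> adj (V i) * u \<in> X"
    proof cases
      case 1
      then show ?thesis using i VC_X annihilate' csubspaceD(1)[OF X(2)] by simp
    next
      case 2
      then show ?thesis
        using i V_V[OF i 2(1)] V_star_V_C C_X csubspaceD(1)[OF X(2)] by (simp flip: mult.assoc)
    qed
    then show "V i * u \<in> X" "adj (V i) * u \<in> X" by auto
  qed
  ultimately have "BB \<subseteq> L" unfolding BB_def using L by (intro gen_least) auto
  then show ?thesis using b x by (auto simp: L_def)
qed

lemma X_right: assumes x: "x \<in> X" and c: "c \<in> C" shows "x * c \<in> X"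
proof (rule closed_span_mult(2)[OF X x[unfolded X_def]])
  fix u assume "u \<in> X0"
  then show "u * c \<in> X"
    using c CD(3) C_X VC_X by (auto simp: X0_def mult.assoc)
qed

text \<open>
  The closed span of the products \<open>x y\<^sup>*\<close> is a subalgebra by \<open>X_left\<close>, and it contains the generators of
  \<open>BB\<close>: \<open>w = w e\<^sup>*\<close> for \<open>w\<close> in \<open>W\<close>, and \<open>V\<^sub>i = V\<^sub>i (V\<^sub>i\<^sup>* V\<^sub>i)\<close>.
\<close>

lemma X_full_left:
  assumes S: "closed S" "csubspace S" and ip: "\<And>x y. x \<in> X \<Longrightarrow> y \<in> X \<Longrightarrow> x * adj y \<in> S"
  shows "BB \<subseteq> S"
proof -
  define J0 where "J0 = {x * adj y | x y. x \<in> X \<and> y \<in> X}"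
  have "x * adj y \<in> BB" if "x \<in> X" "y \<in> X" for x y
    using that X_BB BD(3)[of x "adj y"] BD(4)[of y] by blast
  then have "closed_span J0 \<subseteq> BB"
    using BD(1,2) by (intro closed_span_least) (auto simp: J0_def)
  then have J: "closed_star_subalg (closed_span J0)"
  proof (intro closed_star_subalg_closed_span)
    fix x y assume "closed_span J0 \<subseteq> BB" "x \<in> closed_span J0" "y \<in> J0"
    moreover then obtain u v where "y = u * adj v" "u \<in> X" "v \<in> X" by (auto simp: J0_def)
    ultimately have "x * y = (x * u) * adj v" "x * u \<in> X" "v \<in> X"
      using X_left[of x u] by (auto simp: mult.assoc)
    then have "x * y \<in> J0" unfolding J0_def by blast
    then show "x * y \<in> closed_span J0" using closed_span_superset by blast
  next
    fix w assume "w \<in> J0"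
    then obtain x y where "w = x * adj y" "x \<in> X" "y \<in> X" by (auto simp: J0_def)
    then have "adj w = y * adj x" "x \<in> X" "y \<in> X" by auto
    then have "adj w \<in> J0" unfolding J0_def by blast
    then show "adj w \<in> closed_span J0" using closed_span_superset by blast
  qed
  have mem: "x * adj y \<in> closed_span J0" if "x \<in> X" "y \<in> X" for x y
    using that closed_span_superset[of J0] by (auto simp: J0_def)
  have "W \<subseteq> closed_span J0"
  proof
    fix w assume w: "w \<in> W"
    then obtain e where e: "e \<in> C" "adj e = e" "w * e = w" using unit by blast
    have "w \<in> C" using w gen_superset by (auto simp: C_eq)
    then show "w \<in> closed_span J0" using mem[of w e] e C_X by simp
  qed
  then have "C \<subseteq> closed_span J0" unfolding C_eq using J by (rule gen_least[rotated])
  moreover have "V i \<in> closed_span J0" if i: "i \<in> I" for i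
  proof -
    let ?p = "adj (V i) * V i"
    have "V i * adj ?p \<in> closed_span J0"
      using VC_X[OF i source[OF i]] isometry[OF i] C_X[OF source[OF i]] by (intro mem) simp_all
    then show ?thesis using isometry[OF i] by simp
  qed
  ultimately have "BB \<subseteq> closed_span J0" unfolding BB_def using J by (intro gen_least) auto
  also have "\<dots> \<subseteq> S" using S ip by (intro closed_span_least) (auto simp: J0_def)
  finally show ?thesis .
qed

lemma X_full_right:
  assumes S: "closed S" "csubspace S" and ip: "\<And>x y. x \<in> X \<Longrightarrow> y \<in> X \<Longrightarrow> adj x * y \<in> S"
  shows "C \<subseteq> S"
proof -
  define J0 where "J0 = {adj x * y | x y. x \<in> X \<and> y \<in> X}"
  have J: "closed_star_subalg (closed_span J0)"
  proof (intro closed_star_subalg_closed_span)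
    fix z w assume z: "z \<in> closed_span J0" and w: "w \<in> J0"
    show "z * w \<in> closed_span J0"
    proof (rule closed_span_mult(2)[OF closed_closed_span csubspace_closed_span z])
      fix u assume "u \<in> J0"
      then obtain x y x' y' where *: "u = adj x * y" "w = adj x' * y'" "x \<in> X" "y \<in> X" "x' \<in> X" "y' \<in> X"
        using w by (auto simp: J0_def)
      have "y * adj x' \<in> BB" using * X_BB BD(3,4) by blast
      then have "y * adj x' * y' \<in> X" using X_left * by blast
      moreover have "u * w = adj x * (y * adj x' * y')" by (simp add: * mult.assoc)
      ultimately have "u * w \<in> J0" using * by (auto simp: J0_def)
      then show "u * w \<in> closed_span J0" using closed_span_superset by blast
    qed
  next
    fix w assume "w \<in> J0"
    then obtain x y where "w = adj x * y" "x \<in> X" "y \<in> X" by (auto simp: J0_def)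
    then have "adj w = adj y * x" "x \<in> X" "y \<in> X" by auto
    then have "adj w \<in> J0" unfolding J0_def by blast
    then show "adj w \<in> closed_span J0" using closed_span_superset by blast
  qed
  have "W \<subseteq> closed_span J0"
  proof
    fix w assume w: "w \<in> W"
    then obtain e where e: "e \<in> C" "adj e = e" "w * e = w" using unit by blast
    have "adj w \<in> C" using w gen_superset CD(4) by (auto simp: C_eq)
    then have "adj (adj w) * e \<in> J0" using C_X e(1) unfolding J0_def by blast
    then show "w \<in> closed_span J0" using e closed_span_superset[of J0] by auto
  qed
  then have "C \<subseteq> closed_span J0" unfolding C_eq using J by (rule gen_least[rotated])
  also have "\<dots> \<subseteq> S" using S ip by (intro closed_span_least) (auto simp: J0_def)
  finally show ?thesis .
qed

text \<open>
  The element \<open>x\<^sup>* x\<close> has a square root in \<open>C\<close>, although \<open>x\<close> itself lies in the larger algebra only.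
\<close>

lemma X_pos: assumes "x \<in> X" shows "\<exists>k\<in>C. adj x * x = adj k * k"
proof -
  obtain k where k: "pos k" "k * k = adj x * x" "\<And>w. w * (adj x * x) = adj x * x * w \<Longrightarrow> w * k = k * w"
    "\<And>S. closed_star_subalg S \<Longrightarrow> adj x * x \<in> S \<Longrightarrow> k \<in> S"
    by (rule pos_sqrt[OF pos_adj_mult_self]) (rule that)
  have "k \<in> C" using C X_ip[OF assms assms] by (rule k(4))
  then show ?thesis using k(2) pos_adj[OF k(1)] by metis
qed

text \<open>
  The norm that either inner product induces on \<open>X\<close> is the norm of \<open>BB\<close>. Each module axiom is an
  identity between products in \<open>BB\<close>, transported by the isometries \<open>\<beta>\<close> and \<open>\<phi>\<close>.
\<close>

theorem imprimitivity:
  fixes A :: "'a cstar" and B :: "'b cstar"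
  assumes B: "faithful_rep B \<beta>" "\<beta> ` carrier B = BB" and A: "faithful_rep A \<phi>" "\<phi> ` carrier A = C"
  shows "morita_equivalent B A"
proof -
  interpret B: faithful_rep B \<beta> by (rule B(1))
  interpret A: faithful_rep A \<phi> by (rule A(1))
  define ib where "ib = inv_into (carrier B) \<beta>"
  define ia where "ia = inv_into (carrier A) \<phi>"
  have ib: "ib u \<in> carrier B \<and> \<beta> (ib u) = u" if "u \<in> BB" for u
    using that B(2) by (metis f_inv_into_f ib_def inv_into_into)
  have ia: "ia u \<in> carrier A \<and> \<phi> (ia u) = u" if "u \<in> C" for u
    using that A(2) by (metis f_inv_into_f ia_def inv_into_into)
  have \<phi>C: "\<phi> a \<in> C" if "a \<in> carrier A" for a using that A(2) by blast
  have \<beta>B: "\<beta> b \<in> BB" if "b \<in> carrier B" for b using that B(2) by blast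
  \<comment> \<open>The second components are constant: all the information is in \<open>B\<close>.\<close>
  define M :: "(complex, 'b \<times> 'a) module" where
    "M = \<lparr>carrier = {(x, \<zero>\<^bsub>A\<^esub>) | x. x \<in> carrier B \<and> \<beta> x \<in> X}, mult = (\<lambda>p q. p), one = (\<zero>\<^bsub>B\<^esub>, \<zero>\<^bsub>A\<^esub>),
      zero = (\<zero>\<^bsub>B\<^esub>, \<zero>\<^bsub>A\<^esub>), add = (\<lambda>p q. (fst p \<oplus>\<^bsub>B\<^esub> fst q, \<zero>\<^bsub>A\<^esub>)),
      smult = (\<lambda>t p. (t \<odot>\<^bsub>B\<^esub> fst p, \<zero>\<^bsub>A\<^esub>))\<rparr>"
  define j where "j = (\<lambda>p :: 'b \<times> 'a. \<beta> (fst p))"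
  define L where "L = (\<lambda>b (p :: 'b \<times> 'a). (b \<otimes>\<^bsub>B\<^esub> fst p, \<zero>\<^bsub>A\<^esub>))"
  define R where "R = (\<lambda>p a. (ib (j p * \<phi> a), \<zero>\<^bsub>A\<^esub>))"
  define ipB where "ipB = (\<lambda>(p :: 'b \<times> 'a) (q :: 'b \<times> 'a). fst p \<otimes>\<^bsub>B\<^esub> star B (fst q))"
  define ipA where "ipA = (\<lambda>p q. ia (adj (j p) * j q))"
  have M: "p \<in> carrier M \<longleftrightarrow> fst p \<in> carrier B \<and> j p \<in> X \<and> snd p = \<zero>\<^bsub>A\<^esub>" for p
    by (cases p) (auto simp: M_def j_def)
  have jX: "j p \<in> X" if "p \<in> carrier M" for p using that by (simp add: M)
  have inj: "inj_on j (carrier M)"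
    by (rule inj_onI) (auto simp: M j_def prod_eq_iff intro: B.j_eq)
  have eqM: "p = q" if "j p = j q" "p \<in> carrier M" "q \<in> carrier M" for p q
    using inj that by (auto simp: inj_on_def)
  have img: "j ` carrier M = X"
  proof
    show "X \<subseteq> j ` carrier M"
    proof
      fix x assume x: "x \<in> X"
      then have "ib x \<in> carrier B \<and> \<beta> (ib x) = x" using X_BB ib by blast
      then have "(ib x, \<zero>\<^bsub>A\<^esub>) \<in> carrier M" "j (ib x, \<zero>\<^bsub>A\<^esub>) = x" using x by (auto simp: M j_def)
      then show "x \<in> j ` carrier M" by (metis image_eqI)
    qed
  qed (use jX in auto)
  have zero: "\<zero>\<^bsub>M\<^esub> \<in> carrier M" "j \<zero>\<^bsub>M\<^esub> = 0"
    using csubspaceD(1)[OF X(2)] by (simp_all add: M) (simp_all add: M_def j_def)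
  have add: "p \<oplus>\<^bsub>M\<^esub> q \<in> carrier M \<and> j (p \<oplus>\<^bsub>M\<^esub> q) = j p + j q" if "p \<in> carrier M" "q \<in> carrier M" for p q
    using that csubspaceD(2)[OF X(2), of "j p" "j q"]
    by (simp add: M) (simp add: M_def j_def B.j_simps)
  have smult: "t \<odot>\<^bsub>M\<^esub> p \<in> carrier M \<and> j (t \<odot>\<^bsub>M\<^esub> p) = cscale t (j p)" if "p \<in> carrier M" for p t
    using that csubspaceD(3)[OF X(2), of "j p"] by (simp add: M) (simp add: M_def j_def B.j_simps)
  have LM: "L b p \<in> carrier M \<and> j (L b p) = \<beta> b * j p" if "b \<in> carrier B" "p \<in> carrier M" for b p
    using that X_left[OF \<beta>B] by (simp add: M L_def j_def B.j_simps)
  have RM: "R p a \<in> carrier M \<and> j (R p a) = j p * \<phi> a" if "a \<in> carrier A" "p \<in> carrier M" for a p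
  proof -
    have "j p * \<phi> a \<in> X" using that X_right jX \<phi>C by blast
    then show ?thesis using ib X_BB by (auto simp: M R_def j_def)
  qed
  have ipBM: "ipB p q \<in> carrier B \<and> \<beta> (ipB p q) = j p * adj (j q)" if "p \<in> carrier M" "q \<in> carrier M" for p q
    using that by (simp add: M ipB_def j_def B.j_simps)
  have ipAM: "ipA p q \<in> carrier A \<and> \<phi> (ipA p q) = adj (j p) * j q" if "p \<in> carrier M" "q \<in> carrier M" for p q
    using that ia[OF X_ip[OF jX jX]] by (simp add: ipA_def)
  note mod = module_embedding[OF inj _ zero add smult, unfolded img, OF X(2)]
  have pos0: "x = 0" if "adj x * x = 0 \<or> x * adj x = 0" for x :: 'u
    using that norm_adj_mult_self[of x] norm_mult_adj_self[of x] by auto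
  have complete: "Metric_space.mcomplete (carrier M) (norm_dist M (\<lambda>x. sqrt (n x)))"
    if n: "\<And>x. x \<in> carrier M \<Longrightarrow> n x = (norm (j x))\<^sup>2" for n
  proof (rule metric_embedding(2)[OF _ inj])
    show "norm_dist M (\<lambda>x. sqrt (n x)) x y = (if x \<in> carrier M \<and> y \<in> carrier M then dist (j x) (j y) else 0)" for x y
      using mod(2)[of x y] by (auto simp: norm_dist_def n dist_norm)
    show "complete (j ` carrier M)" unfolding img using X(1) by (simp add: complete_eq_closed)
  qed
  note S = add[THEN conjunct1] add[THEN conjunct2] smult[THEN conjunct1] smult[THEN conjunct2]
    LM[THEN conjunct1] LM[THEN conjunct2] RM[THEN conjunct1] RM[THEN conjunct2]
    ipBM[THEN conjunct1] ipBM[THEN conjunct2] ipAM[THEN conjunct1] ipAM[THEN conjunct2]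
  have "left_hilbert_module B M L ipB"
    unfolding left_hilbert_module_def
  proof (intro conjI ballI allI impI mod(1))
    show "Metric_space.mcomplete (carrier M) (norm_dist M (\<lambda>x. sqrt (cnorm B (ipB x x))))"
      by (rule complete) (use ipBM B.isometric norm_mult_adj_self in metis)
    show "positive B (ipB x x)" if "x \<in> carrier M" for x
      using that unfolding positive_def ipB_def
      by (intro bexI[of _ "star B (fst x)"]) (auto simp: M B.star_star)
    show "x = \<zero>\<^bsub>M\<^esub>" if "x \<in> carrier M" "ipB x x = \<zero>\<^bsub>B\<^esub>" for x
      using that ipBM[of x x] pos0[of "j x"] zero by (intro eqM) auto
  qed (auto intro!: eqM B.j_eq simp: S B.j_simps algebra_simps cscale_add_right
        cscale_mult_left cscale_mult_right)
  moreover have "right_hilbert_module A M R ipA"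
    unfolding right_hilbert_module_def
  proof (intro conjI ballI allI impI mod(1))
    show "Metric_space.mcomplete (carrier M) (norm_dist M (\<lambda>x. sqrt (cnorm A (ipA x x))))"
      by (rule complete) (use ipAM A.isometric norm_adj_mult_self in metis)
    show "positive A (ipA x x)" if x: "x \<in> carrier M" for x
    proof -
      obtain k where k: "k \<in> C" "adj (j x) * j x = adj k * k" using X_pos[OF jX[OF x]] by blast
      then have "ipA x x = star A (ia k) \<otimes>\<^bsub>A\<^esub> ia k"
        using ia[OF k(1)] ipAM[OF x x] by (intro A.j_eq) (auto simp: A.j_simps)
      then show ?thesis using ia[OF k(1)] by (auto simp: positive_def)
    qed
    show "x = \<zero>\<^bsub>M\<^esub>" if "x \<in> carrier M" "ipA x x = \<zero>\<^bsub>A\<^esub>" for x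
      using that ipAM[of x x] pos0[of "j x"] zero by (intro eqM) auto
  qed (auto intro!: eqM A.j_eq simp: S A.j_simps algebra_simps cscale_add_right
        cscale_mult_left cscale_mult_right)
  moreover have "full_inner_product B M ipB"
    unfolding full_inner_product_def
  proof (intro allI impI)
    fix T assume T: "closed_subspace B T \<and> (\<forall>x\<in>carrier M. \<forall>y\<in>carrier M. ipB x y \<in> T)"
    then have cl: "T \<subseteq> carrier B" "csubspace (\<beta> ` T)" "closed (\<beta> ` T)" by (auto simp: B.closed_subspace_iff)
    have "BB \<subseteq> \<beta> ` T"
    proof (rule X_full_left[OF cl(3,2)])
      fix x y assume "x \<in> X" "y \<in> X"
      then obtain p q where "p \<in> carrier M" "q \<in> carrier M" "x = j p" "y = j q" using img by blast
      then show "x * adj y \<in> \<beta> ` T" using T ipBM[of p q] by (metis image_eqI)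
    qed
    then show "T = carrier B" using B(2) cl(1) B.j_inj by (metis inj_on_image_eq_iff order_refl subset_antisym image_mono)
  qed
  moreover have "full_inner_product A M ipA"
    unfolding full_inner_product_def
  proof (intro allI impI)
    fix T assume T: "closed_subspace A T \<and> (\<forall>x\<in>carrier M. \<forall>y\<in>carrier M. ipA x y \<in> T)"
    then have cl: "T \<subseteq> carrier A" "csubspace (\<phi> ` T)" "closed (\<phi> ` T)" by (auto simp: A.closed_subspace_iff)
    have "C \<subseteq> \<phi> ` T"
    proof (rule X_full_right[OF cl(3,2)])
      fix x y assume "x \<in> X" "y \<in> X"
      then obtain p q where "p \<in> carrier M" "q \<in> carrier M" "x = j p" "y = j q" using img by blast
      then show "adj x * y \<in> \<phi> ` T" using T ipAM[of p q] by (metis image_eqI)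
    qed
    then show "T = carrier A" using A(2) cl(1) A.j_inj by (metis inj_on_image_eq_iff order_refl subset_antisym image_mono)
  qed
  moreover have "\<forall>b\<in>carrier B. \<forall>x\<in>carrier M. \<forall>a\<in>carrier A. R (L b x) a = L b (R x a)"
    by (auto intro!: eqM simp: S mult.assoc)
  moreover have "\<forall>b\<in>carrier B. \<forall>x\<in>carrier M. \<forall>y\<in>carrier M. ipA (L b x) y = ipA x (L (star B b) y)"
    by (auto intro!: A.j_eq simp: S B.j_simps mult.assoc)
  moreover have "\<forall>a\<in>carrier A. \<forall>x\<in>carrier M. \<forall>y\<in>carrier M. ipB (R x a) y = ipB x (R y (star A a))"
    by (auto intro!: B.j_eq simp: S A.j_simps mult.assoc)
  moreover have "\<forall>x\<in>carrier M. \<forall>y\<in>carrier M. \<forall>z\<in>carrier M. L (ipB x y) z = R x (ipA y z)"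
    by (auto intro!: eqM simp: S mult.assoc)
  ultimately have "imprimitivity_bimodule B A M L R ipB ipA"
    by (simp add: imprimitivity_bimodule_def)
  then show ?thesis
    using A.cstar_algebra_axioms B.cstar_algebra_axioms unfolding morita_equivalent_def by blast
qed

end

section \<open>Morita equivalence\<close>

lemma rep_corner: assumes "rep A j" shows "rep A (\<lambda>x. Mat2 (j x) 0 0 0)"
  using assms by (simp add: rep_def mat2_defs adj_mat2_def imag_mat2_def cscale_def)

context delayed
begin

lemma countable_delay: "countable (Q ` kverts (delay \<Lambda> f) \<union> S ` kedges (delay \<Lambda> f))"
proof -
  have D: "D \<subseteq> Mor \<Lambda>" using D_Mor by blast
  have "gverts G \<subseteq> OldV ` Mor \<Lambda> \<union> NewV ` Mor \<Lambda>"
    using D by (auto simp: of_degree_def elim!: gverts_cases)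
  then have "countable (gverts G)"
    by (rule countable_subset) (use countable_Mor in auto)
  moreover have "gedges G \<subseteq> OldE ` Mor \<Lambda> \<union> Edge1 ` Mor \<Lambda> \<union> Edge2 ` Mor \<Lambda> \<union> EdgeSq ` Mor \<Lambda>"
  proof
    fix x assume "x \<in> gedges G"
    then show "x \<in> OldE ` Mor \<Lambda> \<union> Edge1 ` Mor \<Lambda> \<union> Edge2 ` Mor \<Lambda> \<union> EdgeSq ` Mor \<Lambda>"
    proof (cases rule: gedges_cases)
      case (EdgeSq n \<alpha> b g h a)
      then have "\<alpha> \<in> Mor \<Lambda>"
        using composite(1)[of b g] by (auto simp: square_iff of_degree_def)
      then show ?thesis using EdgeSq by blast
    qed (use D kedges_Mor in auto)
  qed
  then have "countable (gedges G)"
    by (rule countable_subset) (use countable_Mor in auto)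
  ultimately show ?thesis by (simp add: delay_eq kverts_Quot kedges_Quot)
qed

lemma countable_original: "countable (P ` kverts \<Lambda> \<union> T ` kedges \<Lambda>)"
proof -
  have "kverts \<Lambda> \<subseteq> Mor \<Lambda>" "kedges \<Lambda> \<subseteq> Mor \<Lambda>" by (auto simp: of_degree_def kedges_def)
  then show ?thesis using countable_Mor by (auto intro: countable_subset)
qed

text \<open>
  The matrix family yields \<open>\<psi> : B \<rightarrow> M\<^sub>2(A)\<close>. On the generators \<open>\<psi> \<circ> \<pi>\<close> is the embedding of \<open>A\<close> as the
  upper left entry, since \<open>T\<^sub>e T\<^sub>e\<^sup>* T\<^sub>e = T\<^sub>e\<close>, and both maps are contractive.
\<close>

theorem isometric_rep:
  fixes \<phi> :: "'a \<Rightarrow> 'u::unital_cstar" and \<beta> :: "'b \<Rightarrow> 'u"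
  assumes A: "universal_CK_algebra \<Lambda> A P T" and B: "universal_CK_algebra (delay \<Lambda> f) B Q S"
    and \<beta>: "faithful_rep B \<beta>" and \<phi>: "rep A \<phi>" "\<phi> ` carrier A \<subseteq> \<beta> ` carrier B"
    and \<phi>P: "\<And>v. v \<in> kverts \<Lambda> \<Longrightarrow> \<phi> (P v) = \<beta> (Q (vclass (OldV v)))"
    and \<phi>T: "\<And>e. e \<in> kedges \<Lambda> \<Longrightarrow> \<phi> (T e) = inner_family (\<lambda>x. \<beta> (S (eclass x))) e"
  shows "faithful_rep A \<phi>"
proof -
  interpret B: faithful_rep B \<beta> by (rule \<beta>)
  have calgA: "cstar_algebra A" and ckA: "CK_family \<Lambda> A P T"
    and genA: "generates A (P ` kverts \<Lambda> \<union> T ` kedges \<Lambda>)"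
    using A by (auto simp: universal_CK_algebra_def)
  have calgB: "cstar_algebra B" and ckB: "CK_family (delay \<Lambda> f) B Q S"
    using B by (auto simp: universal_CK_algebra_def)
  obtain j :: "'a \<Rightarrow> 'a multiplier" where "faithful_rep A j" using faithful_rep_exists[OF calgA] by blast
  then interpret A: faithful_rep A j .
  let ?P = "\<lambda>v. j (P v)" and ?T = "\<lambda>e. j (T e)"
  let ?Q = "\<lambda>c. mat_vert ?P ?T (snd (the_elem c))" and ?S = "\<lambda>c. mat_edge ?T (hd (fst (the_elem c)))"
  have ckj: "ck_typed \<Lambda> ?P ?T" by (rule A.CK_familyD(3)[OF ckA])
  have "graph_ck (mat_vert ?P ?T) (mat_edge ?T)" by (rule matrix_family_ck[OF ckj])
  then have "ck_typed (delay \<Lambda> f) ?Q ?S"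
    unfolding delay_eq ck_typed_Quot by (simp add: vclass_def eclass_def)
  from universal_rep[OF B _ this countable_delay] obtain \<psi> where \<psi>: "rep B \<psi>"
    "\<forall>c\<in>kverts (delay \<Lambda> f). \<psi> (Q c) = ?Q c" "\<forall>c\<in>kedges (delay \<Lambda> f). \<psi> (S c) = ?S c"
    using src_Quot_kverts delay_eq by auto
  have \<psi>Q: "\<psi> (Q (vclass v)) = mat_vert ?P ?T v" if "v \<in> gverts G" for v
    using \<psi>(2) that by (auto simp: delay_eq kverts_Quot vclass_def)
  have \<psi>S: "\<psi> (S (eclass e)) = mat_edge ?T e" if "e \<in> gedges G" for e
    using \<psi>(3) that by (auto simp: delay_eq kedges_Quot eclass_def)
  have Q: "Q (vclass v) \<in> carrier B" if "v \<in> gverts G" for v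
    using B.CK_familyD(1)[OF ckB] that by (simp add: delay_eq kverts_Quot)
  have S: "S (eclass e) \<in> carrier B" if "e \<in> gedges G" for e
    using B.CK_familyD(2)[OF ckB] that by (simp add: delay_eq kedges_Quot)
  define \<pi> where "\<pi> = (\<lambda>a. inv_into (carrier B) \<beta> (\<phi> a))"
  have \<pi>: "\<pi> a \<in> carrier B" "\<beta> (\<pi> a) = \<phi> a" if "a \<in> carrier A" for a
    using \<phi>(2) that by (auto simp: \<pi>_def f_inv_into_f inv_into_into image_subset_iff)
  note r = repD[OF \<phi>(1)]
  have "star_hom A B \<pi>"
    unfolding star_hom_def
    using \<pi> A.star_closed by (auto intro!: B.j_eq simp: r B.j_simps)
  then have \<psi>\<pi>: "rep A (\<lambda>a. \<psi> (\<pi> a))" using \<psi>(1) by (rule star_hom_rep)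
  have gens: "\<psi> (\<pi> w) = Mat2 (j w) 0 0 0" if "w \<in> P ` kverts \<Lambda> \<union> T ` kedges \<Lambda>" for w
    using that
  proof
    assume "w \<in> P ` kverts \<Lambda>"
    then obtain v where v: "v \<in> kverts \<Lambda>" "w = P v" by blast
    then have "\<pi> w = Q (vclass (OldV v))"
      using \<pi>[OF A.CK_familyD(1)[OF ckA v(1)]] \<phi>P[OF v(1)] Q[of "OldV v"] by (intro B.j_eq) auto
    then show ?thesis using \<psi>Q[of "OldV v"] v by (simp add: mat_vert_def)
  next
    assume "w \<in> T ` kedges \<Lambda>"
    then obtain e where e: "e \<in> kedges \<Lambda>" "w = T e" by blast
    have w: "\<pi> w \<in> carrier B" "\<beta> (\<pi> w) = inner_family (\<lambda>x. \<beta> (S (eclass x))) e"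
      using \<pi>[OF A.CK_familyD(2)[OF ckA e(1)]] \<phi>T[OF e(1)] e(2) by auto
    show ?thesis
    proof (cases "e \<in> D")
      case True
      then have S12: "S (eclass (Edge1 e)) \<in> carrier B" "S (eclass (Edge2 e)) \<in> carrier B"
        using S by auto
      have "\<pi> w = S (eclass (Edge2 e)) \<otimes>\<^bsub>B\<^esub> S (eclass (Edge1 e))"
        using w S12 True by (intro B.j_eq) (auto simp: inner_family_def B.j_simps)
      then have "\<psi> (\<pi> w) = mat_edge ?T (Edge2 e) * mat_edge ?T (Edge1 e)"
        using repD(2)[OF \<psi>(1) S12(2) S12(1)] \<psi>S True by simp
      also have "\<dots> = Mat2 (?T e * adj (?T e) * ?T e) 0 0 0" by (simp add: mat_edge_def mat2_defs)
      also have "?T e * adj (?T e) * ?T e = ?T e"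
        using ck_typed_ends(1)[OF ckj e(1)] ck_typedD(5)[OF ckj e(1)] by (simp add: mult.assoc)
      finally show ?thesis using e by simp
    next
      case False
      then have So: "S (eclass (OldE e)) \<in> carrier B" using S e by auto
      have "\<pi> w = S (eclass (OldE e))"
        using w So False by (intro B.j_eq) (auto simp: inner_family_def)
      then show ?thesis using \<psi>S[of "OldE e"] False e by (simp add: mat_edge_def)
    qed
  qed
  have "norm (\<phi> a) = cnorm A a" if a: "a \<in> carrier A" for a
  proof (rule antisym)
    show "norm (\<phi> a) \<le> cnorm A a" by (rule rep_contractive[OF calgA \<phi>(1) a])
    have "\<psi> (\<pi> a) = Mat2 (j a) 0 0 0"
      by (rule rep_eq_on_generators[OF calgA \<psi>\<pi> rep_corner[OF A.rep] genA gens a])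
    then have "cnorm A a = norm (\<psi> (\<pi> a))" using A.isometric[OF a] norm_mat2_corner[of "j a"] by simp
    also have "\<dots> \<le> cnorm B (\<pi> a)" using \<pi>(1)[OF a] by (rule rep_contractive[OF calgB \<psi>(1)])
    also have "\<dots> = norm (\<phi> a)" using B.isometric[OF \<pi>(1)[OF a]] \<pi>(2)[OF a] by simp
    finally show "cnorm A a \<le> norm (\<phi> a)" .
  qed
  then show ?thesis
    using calgA \<phi>(1) by (simp add: faithful_rep_def faithful_rep_axioms_def)
qed

text \<open>
  It remains to see that \<open>C = \<phi>(A)\<close> and \<open>V\<^sub>g = S\<^bsub>g\<^sup>1\<^esub>\<close> generate \<open>B\<close>. As \<open>V\<^sub>g V\<^sub>g\<^sup>*\<close> is the projection of
  \<open>v\<^sub>g\<close>, one has \<open>S\<^bsub>g\<^sup>2\<^esub> = S\<^bsub>g\<^sup>2\<^esub> V\<^sub>g V\<^sub>g\<^sup>* = T\<^sub>g V\<^sub>g\<^sup>*\<close>, and for a square \<open>\<alpha> = [bg] = [ha]\<close> likewise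
  \<open>S\<^bsub>e\<^sub>\<alpha>\<^esub> = S\<^bsub>e\<^sub>\<alpha>\<^esub> V\<^sub>g V\<^sub>g\<^sup>* = V\<^sub>h T\<^sub>a V\<^sub>g\<^sup>*\<close>.
\<close>

theorem delay_morita:
  fixes A :: "'a cstar" and B :: "'b cstar"
  assumes A: "universal_CK_algebra \<Lambda> A P T" and B: "universal_CK_algebra (delay \<Lambda> f) B Q S"
  shows "morita_equivalent B A"
proof -
  have calgB: "cstar_algebra B" and ckB: "CK_family (delay \<Lambda> f) B Q S"
    and genB: "generates B (Q ` kverts (delay \<Lambda> f) \<union> S ` kedges (delay \<Lambda> f))"
    using B by (auto simp: universal_CK_algebra_def)
  have genA: "generates A (P ` kverts \<Lambda> \<union> T ` kedges \<Lambda>)" and ckA: "CK_family \<Lambda> A P T"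
    using A by (auto simp: universal_CK_algebra_def)
  obtain \<beta> :: "'b \<Rightarrow> 'b multiplier" where \<beta>: "faithful_rep B \<beta>" using faithful_rep_exists[OF calgB] by blast
  interpret B: faithful_rep B \<beta> by (rule \<beta>)
  define q where "q = (\<lambda>v. \<beta> (Q (vclass v)))"
  define s where "s = (\<lambda>e. \<beta> (S (eclass e)))"
  have gck: "graph_ck q s"
    using B.CK_familyD(3)[OF ckB] unfolding delay_eq ck_typed_Quot by (simp add: q_def s_def)
  note g = graph_ckD[OF gck] and ge = graph_ck_ends[OF gck]
  have ck: "ck_typed \<Lambda> (\<lambda>v. q (OldV v)) (inner_family s)" by (rule inner_family_ck[OF gck])
  have Q: "Q (vclass v) \<in> carrier B" if "v \<in> gverts G" for v
    using B.CK_familyD(1)[OF ckB] that by (simp add: delay_eq kverts_Quot)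
  have S: "S (eclass e) \<in> carrier B" if "e \<in> gedges G" for e
    using B.CK_familyD(2)[OF ckB] that by (simp add: delay_eq kedges_Quot)
  have qB: "q v \<in> \<beta> ` carrier B" if "v \<in> gverts G" for v using Q[OF that] by (simp add: q_def)
  have sB: "s e \<in> \<beta> ` carrier B" if "e \<in> gedges G" for e using S[OF that] by (simp add: s_def)
  note BD = closed_star_subalgD[OF B.closed_star_subalg_image]
  have innerB: "inner_family s e \<in> \<beta> ` carrier B" if "e \<in> kedges \<Lambda>" for e
    using that sB BD(3) by (auto simp: inner_family_def)
  obtain \<phi> where \<phi>: "rep A \<phi>"
    "\<phi> ` carrier A \<subseteq> gen ((\<lambda>v. q (OldV v)) ` kverts \<Lambda> \<union> inner_family s ` kedges \<Lambda>)"
    "\<forall>v\<in>kverts \<Lambda>. \<phi> (P v) = q (OldV v)" "\<forall>e\<in>kedges \<Lambda>. \<phi> (T e) = inner_family s e"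
    using universal_rep[OF A _ ck countable_original] endpoints(2)[OF kedges_Mor] by blast
  have "gen ((\<lambda>v. q (OldV v)) ` kverts \<Lambda> \<union> inner_family s ` kedges \<Lambda>) \<subseteq> \<beta> ` carrier B"
    using qB innerB by (intro gen_least B.closed_star_subalg_image) auto
  then have sub: "\<phi> ` carrier A \<subseteq> \<beta> ` carrier B" using \<phi>(2) by blast
  have fA: "faithful_rep A \<phi>"
    by (rule isometric_rep[OF A B \<beta> \<phi>(1) sub]) (use \<phi>(3,4) in \<open>auto simp: q_def s_def\<close>)
  interpret A: faithful_rep A \<phi> by (rule fA)
  define W where "W = \<phi> ` (P ` kverts \<Lambda> \<union> T ` kedges \<Lambda>)"
  define C where "C = \<phi> ` carrier A"
  define V where "V = (\<lambda>g. s (Edge1 g))"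
  have CW: "C = gen W" unfolding C_def W_def by (rule A.image_eq_gen[OF genA])
  note CD = closed_star_subalgD[OF A.closed_star_subalg_image, folded C_def]
  have PC: "q (OldV v) \<in> C" if "v \<in> kverts \<Lambda>" for v
    using imageI[OF A.CK_familyD(1)[OF ckA that], of \<phi>] \<phi>(3) that by (simp add: C_def)
  have TC: "inner_family s e \<in> C" if "e \<in> kedges \<Lambda>" for e
    using imageI[OF A.CK_familyD(2)[OF ckA that], of \<phi>] \<phi>(4) that by (simp add: C_def)
  have W_cases: "(\<exists>v\<in>kverts \<Lambda>. w = q (OldV v)) \<or> (\<exists>e\<in>kedges \<Lambda>. w = inner_family s e)" if "w \<in> W" for w
    using that \<phi>(3,4) by (auto simp: W_def)
  have src: "src \<Lambda> e \<in> kverts \<Lambda>" and rng: "rng \<Lambda> e \<in> kverts \<Lambda>" if "e \<in> kedges \<Lambda>" for e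
    using that kedges_Mor endpoints by blast+
  have VV: "adj (V g) * V g = q (OldV (src \<Lambda> g))" if "g \<in> D" for g
    using g(5)[of "Edge1 g"] that by (simp add: V_def)
  have qV: "q (NewV g) * V g = V g" "V g * q (OldV (src \<Lambda> g)) = V g" if "g \<in> D" for g
    using ge[of "Edge1 g"] that by (simp_all add: V_def)
  have qV0: "q v * V g = 0" if "v \<in> gverts G" "g \<in> D" "v \<noteq> NewV g" for v g
  proof -
    have "q v * (q (NewV g) * V g) = 0"
      using g(3)[of v "NewV g"] that by (simp flip: mult.assoc)
    then show ?thesis using qV(1)[OF that(2)] by simp
  qed
  have CV: "c * V g = 0" if "c \<in> C" and gD: "g \<in> D" for c g
  proof -
    define K where "K = {c. c * V g \<in> {0} \<and> adj c * V g \<in> {0}}"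
    have "K = {c. c * V g \<in> {0}} \<inter> {c. adj c \<in> {c. c * V g \<in> {0}}}" by (auto simp: K_def)
    then have "closed K"
      using closed_csubspace_vimage(3)[of "{0}" "V g"] closed_csubspace_vimage(4)[of "{0}" "V g"]
        closed_csubspace_vimage(5)[of "{c. c * V g \<in> {0}}"]
      by (auto simp: csubspace_def)
    then have K: "closed_star_subalg K"
      by (auto simp: closed_star_subalg_def csubspace_def K_def distrib_right cscale_mult_left
          adj_cscale mult.assoc)
    have "w \<in> K" if "w \<in> W" for w
      using W_cases[OF that]
    proof (elim disjE bexE)
      fix v assume v: "v \<in> kverts \<Lambda>" "w = q (OldV v)"
      then show ?thesis using qV0[of "OldV v" g] g(1)[of "OldV v"] gD by (simp add: K_def)
    next
      fix e assume e: "e \<in> kedges \<Lambda>" "w = inner_family s e"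
      have "w * (q (OldV (src \<Lambda> e)) * V g) = 0" "adj w * (q (OldV (rng \<Lambda> e)) * V g) = 0"
        using qV0[of "OldV (src \<Lambda> e)" g] qV0[of "OldV (rng \<Lambda> e)" g] src[OF e(1)] rng[OF e(1)] gD by simp_all
      moreover have "w * q (OldV (src \<Lambda> e)) = w" "q (OldV (rng \<Lambda> e)) * w = w"
        using ck_typed_ends(1,2)[OF ck e(1)] e(2) by auto
      moreover have "adj w * q (OldV (rng \<Lambda> e)) = adj w"
        using arg_cong[OF \<open>q (OldV (rng \<Lambda> e)) * w = w\<close>, of adj] g(1)[of "OldV (rng \<Lambda> e)"] rng[OF e(1)] by simp
      ultimately show ?thesis by (simp add: K_def flip: mult.assoc)
    qed
    then have "C \<subseteq> K" unfolding CW by (intro gen_least K) auto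
    then show ?thesis using that by (auto simp: K_def)
  qed
  interpret corner C W V D
  proof
    show "C = gen W" by (rule CW)
    show "\<exists>e\<in>C. adj e = e \<and> w * e = w" if "w \<in> W" for w
      using W_cases[OF that]
    proof (elim disjE bexE)
      fix v assume "v \<in> kverts \<Lambda>" "w = q (OldV v)"
      then show ?thesis using PC g(1,2)[of "OldV v"] by (intro bexI[of _ "q (OldV v)"]) auto
    next
      fix e assume e: "e \<in> kedges \<Lambda>" "w = inner_family s e"
      then show ?thesis
        using PC[OF src[OF e(1)]] ck_typed_ends(1)[OF ck e(1)] g(1)[of "OldV (src \<Lambda> e)"] src[OF e(1)]
        by (intro bexI[of _ "q (OldV (src \<Lambda> e))"]) auto
    qed
    show "adj (V g) * V g \<in> C" if "g \<in> D" for g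
      using VV[OF that] PC[OF src[OF D_kedges[OF that]]] by simp
    show "V g * (adj (V g) * V g) = V g" if "g \<in> D" for g using VV[OF that] qV(2)[OF that] by simp
    show "adj (V g) * V h = 0" if "g \<in> D" "h \<in> D" "g \<noteq> h" for g h
    proof -
      have "adj (V g) * q (NewV g) = adj (V g)"
        using arg_cong[OF qV(1)[OF that(1)], of adj] g(1)[of "NewV g"] that(1) by simp
      then have "adj (V g) * V h = adj (V g) * (q (NewV g) * V h)" by (simp flip: mult.assoc)
      then show ?thesis using qV0[of "NewV g" h] that by simp
    qed
    show "c * V g = 0" if "c \<in> C" "g \<in> D" for c g using CV that .
  qed
  have CB: "c \<in> C \<Longrightarrow> c \<in> BB" and VB: "g \<in> D \<Longrightarrow> V g \<in> BB" for c g using C_BB V_BB by auto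
  note BBD = closed_star_subalgD(3,4)[OF BB]
  have vertB: "q v \<in> BB" if "v \<in> gverts G" for v
    using that
  proof (cases rule: gverts_cases)
    case (OldV u)
    then show ?thesis using PC CB by simp
  next
    case (NewV h)
    obtain i where i: "axis i 1 = d" using abs_deg_eq_1[OF abs_deg_d] by metis
    have "q (NewV h) = V h * adj (V h)"
      using g(6)[of "NewV h" i] NewV(2) edges_to_new_d[OF i NewV(2)] by (simp add: V_def)
    then show ?thesis using NewV VB BBD by simp
  qed
  have edgeB: "s x \<in> BB" if "x \<in> gedges G" for x
    using that
  proof (cases rule: gedges_cases)
    case (OldE e)
    then show ?thesis using CB[OF TC[of e]] by (simp add: inner_family_def)
  next
    case (Edge1 h)
    then show ?thesis using VB by (simp add: V_def)
  next
    case (Edge2 h)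
    obtain i where i: "axis i 1 = d" using abs_deg_eq_1[OF abs_deg_d] by metis
    have "q (NewV h) = V h * adj (V h)"
      using g(6)[of "NewV h" i] Edge2(2) edges_to_new_d[OF i Edge2(2)] by (simp add: V_def)
    then have "s (Edge2 h) = s (Edge2 h) * (V h * adj (V h))"
      using ge(1)[of "Edge2 h"] Edge2(2) by simp
    also have "\<dots> = inner_family s h * adj (V h)"
      using Edge2(2) by (simp add: inner_family_def V_def mult.assoc)
    finally have "s (Edge2 h) = inner_family s h * adj (V h)" .
    then show ?thesis
      using Edge2 CB[OF TC[OF D_kedges[OF Edge2(2)]]] VB[OF Edge2(2)] BBD by simp
  next
    case (EdgeSq n \<alpha> b k h a)
    note E = EdgeSq_ends[OF EdgeSq(2-4)] and sq = EdgeSq(3)[unfolded square_iff[OF EdgeSq(2)]]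
    obtain i where i: "axis i 1 = d" using abs_deg_eq_1[OF abs_deg_d] by metis
    have qk: "q (NewV k) = V k * adj (V k)"
      using g(6)[of "NewV k" i] EdgeSq(4) edges_to_new_d[OF i EdgeSq(4)] by (simp add: V_def)
    have aD: "a \<notin> D" "a \<in> kedges \<Lambda>"
      using sq EdgeSq(2) D_deg[of a] kedges_degree[of a] by (auto simp: N_axis of_degree_def)
    have ds: "\<alpha> \<in> delay_squares \<Lambda> f n" using delay_squares_iff[OF EdgeSq(2)] EdgeSq by blast
    have sak: "src \<Lambda> a = src \<Lambda> k"
      using sq composite(3)[of b k] composite(3)[of h a] by (auto simp: of_degree_def)
    have rel: "s (EdgeSq \<alpha>) * V k = V h * s (OldE a)"
      unfolding V_def
      by (rule g(4)[OF delay_rel.square_in[OF EdgeSq(2) ds EdgeSq(3-5)], of "OldV (src \<Lambda> k)"])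
        (use E EdgeSq(4,5) aD sq sak src[OF D_kedges[OF EdgeSq(4)]] in auto)
    have "s (EdgeSq \<alpha>) = s (EdgeSq \<alpha>) * V k * adj (V k)"
      using ge(1)[OF E(4)] E(1) qk by (simp add: mult.assoc)
    also have "\<dots> = V h * inner_family s a * adj (V k)"
      unfolding rel using aD by (simp add: inner_family_def)
    finally have "s (EdgeSq \<alpha>) = V h * inner_family s a * adj (V k)" .
    then show ?thesis
      using EdgeSq(1) VB[OF EdgeSq(5)] VB[OF EdgeSq(4)] CB[OF TC[OF aD(2)]] BBD by simp
  qed
  have "\<beta> ` carrier B = BB"
  proof
    have eq: "\<beta> ` carrier B = gen (\<beta> ` (Q ` kverts (delay \<Lambda> f) \<union> S ` kedges (delay \<Lambda> f)))"
      by (rule B.image_eq_gen[OF genB])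
    show "\<beta> ` carrier B \<subseteq> BB"
      unfolding eq using vertB edgeB
      by (intro gen_least BB) (auto simp: delay_eq kverts_Quot kedges_Quot q_def s_def)
    show "BB \<subseteq> \<beta> ` carrier B"
      unfolding BB_def using sub sB
      by (intro gen_least B.closed_star_subalg_image) (auto simp: C_def V_def)
  qed
  then show ?thesis by (rule imprimitivity[OF \<beta> _ fA C_def[symmetric]])
qed

end

theorem theorem4p3:
  fixes \<Lambda> :: "('m, 'k::finite) kgraph" and f :: 'm
    and A :: "'a cstar" and B :: "'b cstar"
  assumes "k_graph \<Lambda>" and "row_finite \<Lambda>" and "source_free \<Lambda>"
    and "f \<in> kedges \<Lambda>"
    and "universal_CK_algebra \<Lambda> A P T"
    and "universal_CK_algebra (delay \<Lambda> f) B Q S"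
  shows "morita_equivalent B A"
proof -
  interpret delayed \<Lambda> f using assms by unfold_locales
  show ?thesis using assms(5,6) by (rule delay_morita)
qed

end
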